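(* For every real number $d\neq 0$, every compact set $K\subset D$ with connected complement and every $\varepsilon>0$, it holds that \[ \liminf_{T\to\infty}\frac{1}{T}\,\mu\Bigl\{\tau\in[0,T] : \sup_{s\in K}\bigl|\log\zeta(s+i\tau)-\log\zeta(s+id\tau)\bigr|<\varepsilon\Bigr\}>0 . \]
   Context: $\zeta(s)$ is the Riemann zeta function. $D:=\{s\in\mathbb{C}: 1/2<\Re(s)<1\}$. $\mu\{A\}$ denotes the Lebesgue measure of a measurable set $A\subset\mathbb{R}$. $\log\zeta(s)$ denotes the logarithm of the zeta function, given for $\Re s>1$ by $\sum_p\sum_{k\ge1}k^{-1}p^{-ks}$ and extended by analytic continuation along horizontal line segments from the right (defined at points not lying on a horizontal segment extending to the left from a zero or the pole of $\zeta$); the inequality in the set is understood to require that both logarithms be defined on $K$. *)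

theory Defs
  imports "HOL-Complex_Analysis.Complex_Analysis" "HOL-Computational_Algebra.Primes"
begin

text \<open>
  The Riemann zeta function, as the unique analytic continuation of its Dirichlet series to the
  plane without the pole; the value at the pole is set to \<open>0\<close> so that the description is unique.
\<close>
definition zeta :: "complex \<Rightarrow> complex" where
  "zeta = (THE f. f holomorphic_on (- {1}) \<and> f 1 = 0 \<and>
             (\<forall>s. Re s > 1 \<longrightarrow> f s = (\<Sum>n. 1 / of_nat (Suc n) powr s)))"

definition log_zeta_series :: "complex \<Rightarrow> complex" where
  "log_zeta_series s =
     (\<Sum>\<^sub>\<infinity>p\<in>{p::nat. prime p}. \<Sum>\<^sub>\<infinity>k\<in>{1::nat..}. of_nat p powr (- (of_nat k * s)) / of_nat k)"

definition right_ray :: "complex \<Rightarrow> complex set" where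
  "right_ray s = {z. Im z = Im s \<and> Re s \<le> Re z}"

text \<open>
  The complement of all horizontal rays running to the left from a zero or the pole of \<open>zeta\<close>.
\<close>
definition log_zeta_dom :: "complex set" where
  "log_zeta_dom = {s. \<forall>\<rho>. \<rho> = 1 \<or> zeta \<rho> = 0 \<longrightarrow> \<rho> \<notin> right_ray s}"

text \<open>
  The value at \<open>s\<close> of the analytic continuation of the series along the horizontal line from the
  right: \<open>g\<close> continues the series to a connected open neighbourhood of the ray from \<open>s\<close> to the right.
  By the identity theorem the value \<open>g s\<close> does not depend on the choice of \<open>U\<close> and \<open>g\<close>; such a
  continuation exists when \<open>s \<in> log_zeta_dom\<close>, and the value is meaningful only there.
\<close>
definition log_zeta :: "complex \<Rightarrow> complex" where
  "log_zeta s = (THE w. \<exists>U g. open U \<and> connected U \<and> right_ray s \<subseteq> U \<and> g holomorphic_on U \<and>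
                   (\<forall>z\<in>U. Re z > 1 \<longrightarrow> g z = log_zeta_series z) \<and> g s = w)"

end

theory Submission imports Defs begin

text \<open>
  Let \<open>S\<close> be the set of primes up to \<open>N\<close> and split \<open>log \<zeta>\<close> into the Euler factors at \<open>S\<close> and the logarithm of
  \<open>\<zeta>\<^sub>S = \<zeta> \<cdot> (\<Prod>p\<in>S. 1 - p\<^sup>-\<^sup>s)\<close>. The first part nearly agrees at \<open>s + i\<tau>\<close> and \<open>s + id\<tau>\<close> as soon as all
  \<open>p\<close> to the power \<open>i(1-d)\<tau>\<close>, \<open>p \<in> S\<close>, are close to 1, which is detected by the trigonometric polynomial
  \<open>W(\<tau>) = (\<Prod>p\<in>S. ((1 + cos ((1-d) \<tau> ln p)) / 2)^m)\<close>: away from such \<open>\<tau>\<close> it is at most \<open>\<kappa>^m\<close> with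
  \<open>\<kappa> < 1\<close>, while its mean decays only polynomially in \<open>m\<close>.

  For the second part one shows that \<open>\<zeta>\<^sub>S - 1\<close> is small in mean square with respect to the weight \<open>W\<close>. Without
  weight, \<open>\<zeta>\<close> is approximated in mean square on \<open>Re s > 1/2\<close> by finite Dirichlet polynomials. On a fixed
  Dirichlet polynomial with frequencies \<open>ln n\<close>, \<open>n\<close> free of primes in \<open>S\<close>, the weight acts as its mean, provided
  no difference of two such frequencies, multiplied by 1 or \<open>d\<close>, is a frequency of \<open>W\<close>. For rational \<open>d\<close> this
  is unique factorisation. For irrational \<open>d\<close> it holds for all large \<open>N\<close>: otherwise there are three
  multiplicatively independent rationals with rational powers to the same irrational exponent, which
  contradicts the six exponentials theorem.

  Smallness in mean square gives smallness uniformly on compact sets by Cauchy's formula; in particular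
  \<open>\<zeta>\<close> then has no zeros to the right of \<open>K + i\<tau>\<close> and \<open>K + id\<tau>\<close>.
\<close>

section \<open>Analytic continuation of the zeta function\<close>

lemma norm_nat_powr [simp]: "cmod (of_nat n powr s) = real n powr Re s"
  by (simp add: norm_powr_real_powr)

lemma nat_powr_eq_exp: "n \<ge> 1 \<Longrightarrow> of_nat n powr (z :: complex) = exp (z * of_real (ln (real n)))"
  by (simp add: powr_def Ln_of_nat)

lemma nat_powr_le_1: "n \<ge> 1 \<Longrightarrow> \<sigma> \<ge> 0 \<Longrightarrow> real n powr (-\<sigma>) \<le> 1"
  using powr_mono[of "-\<sigma>" 0 "real n"] by simp

lemma summable_shifted_powr: "a < -1 \<Longrightarrow> summable (\<lambda>n. real (n + X) powr a)"
  by (subst summable_iff_shift) (simp add: summable_real_powr_iff)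

lemma powr_le_two_powr_abs_mult_powr:
  fixes a x u :: real
  assumes "0 < x" "x \<le> u" "u \<le> 2 * x"
  shows "u powr a \<le> 2 powr \<bar>a\<bar> * x powr a"
proof -
  have ratio_bounds: "1 \<le> u / x" "u / x \<le> 2" using assms by (auto simp: field_simps)
  have "(u / x) powr a \<le> (u / x) powr \<bar>a\<bar>" using ratio_bounds by (intro powr_mono) auto
  also have "\<dots> \<le> 2 powr \<bar>a\<bar>" using ratio_bounds by (intro powr_mono2) auto
  finally show ?thesis using assms by (simp add: powr_divide field_simps)
qed

definition powr_taylor_rem :: "nat \<Rightarrow> nat \<Rightarrow> complex \<Rightarrow> complex" where
  "powr_taylor_rem M n a =
     of_nat (Suc n) powr a - (\<Sum>k\<le>M. (a gchoose k) * of_nat n powr (a - of_nat k))"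

lemma has_field_derivative_gchoose_powr:
  fixes a x :: complex
  assumes "x \<notin> \<real>\<^sub>\<le>\<^sub>0"
  shows "((\<lambda>u. fact k * (a gchoose k) * u powr (a - of_nat k)) has_field_derivative
           fact (Suc k) * (a gchoose Suc k) * x powr (a - of_nat (Suc k))) (at x within S)"
proof -
  have "(a - of_nat k) * (a gchoose k) = of_nat (Suc k) * (a gchoose Suc k)"
    using gbinomial_mult_1[of a k] by (simp only: left_diff_distrib add_diff_cancel_left')
  hence "fact k * (a gchoose k) * (a - of_nat k) = fact (Suc k) * (a gchoose Suc k)"
    by (simp add: algebra_simps)
  moreover have "((\<lambda>u. fact k * (a gchoose k) * u powr (a - of_nat k)) has_field_derivative
           fact k * (a gchoose k) * (a - of_nat k) * x powr (a - of_nat (Suc k))) (at x within S)"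
    using assms by (auto intro!: derivative_eq_intros simp: algebra_simps)
  ultimately show ?thesis by (simp only:)
qed

lemma norm_powr_taylor_rem_le:
  assumes "n \<ge> 1"
  shows "cmod (powr_taylor_rem M n a) \<le> real (Suc M) * cmod (a gchoose Suc M)
           * 2 powr \<bar>Re a - real (Suc M)\<bar> * real n powr (Re a - real (Suc M))"
proof -
  let ?S = "closed_segment (of_nat n :: complex) (of_nat (Suc n))"
  let ?B = "fact (Suc M) * cmod (a gchoose Suc M) *
              (2 powr \<bar>Re a - real (Suc M)\<bar> * real n powr (Re a - real (Suc M)))"
  have segment: "\<exists>u. x = of_real u \<and> real n \<le> u \<and> u \<le> real n + 1" if "x \<in> ?S" for x
  proof -
    have "?S = of_real ` closed_segment (real n) (real (Suc n))"
      by (simp flip: closed_segment_of_real)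
    with that show ?thesis by (auto simp: closed_segment_eq_real_ivl)
  qed
  define f where "f = (\<lambda>k u. fact k * (a gchoose k) * u powr (a - of_nat k))"
  have "cmod (f 0 (of_nat (Suc n)) - (\<Sum>k\<le>M. f k (of_nat n) * (of_nat (Suc n) - of_nat n) ^ k / fact k))
          \<le> ?B * cmod (of_nat (Suc n) - of_nat n) ^ Suc M / fact M"
  proof (rule complex_Taylor)
    fix i x assume "x \<in> ?S" "i \<le> M"
    hence "x \<notin> \<real>\<^sub>\<le>\<^sub>0" using segment assms by fastforce
    thus "(f i has_field_derivative f (Suc i) x) (at x within ?S)"
      unfolding f_def by (rule has_field_derivative_gchoose_powr)
  next
    fix x assume "x \<in> ?S"
    then obtain u where x_eq: "x = of_real u" "real n \<le> u" "u \<le> real n + 1" using segment by blast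
    have "cmod (x powr (a - of_nat (Suc M))) = u powr (Re a - real (Suc M))"
      using x_eq assms by (simp add: norm_powr_real_powr)
    also have "\<dots> \<le> 2 powr \<bar>Re a - real (Suc M)\<bar> * real n powr (Re a - real (Suc M))"
      using x_eq assms by (intro powr_le_two_powr_abs_mult_powr) auto
    finally have "fact (Suc M) * cmod (a gchoose Suc M) * cmod (x powr (a - of_nat (Suc M))) \<le> ?B"
      by (intro mult_left_mono mult_nonneg_nonneg) auto
    thus "cmod (f (Suc M) x) \<le> ?B"
      unfolding f_def norm_mult norm_fact .
  qed auto
  also have "\<dots> = real (Suc M) * cmod (a gchoose Suc M)
      * 2 powr \<bar>Re a - real (Suc M)\<bar> * real n powr (Re a - real (Suc M))"
    by simp
  finally show ?thesis by (simp add: f_def powr_taylor_rem_def)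
qed

lemma holomorphic_powr_taylor_rem:
  "n \<ge> 1 \<Longrightarrow> powr_taylor_rem M n holomorphic_on A"
  unfolding powr_taylor_rem_def gbinomial_prod_rev by (intro holomorphic_intros) auto

lemma powr_taylor_rem_locally_dominated:
  assumes "X \<ge> 1" "Re a < real M"
  shows "\<exists>d>0. \<exists>h. cball a d \<subseteq> {b. Re b < real M} \<and> summable h \<and>
           (\<forall>n. \<forall>b\<in>cball a d. cmod (powr_taylor_rem M (n + X) b) \<le> h n)"
proof -
  define d where "d = (real M - Re a) / 2"
  have d_bounds: "d > 0" "Re a + d < real M" using assms by (auto simp: d_def field_simps)
  have Re_le: "Re b \<le> Re a + d" if "b \<in> cball a d" for b
    using that abs_Re_le_cmod[of "b - a"] by (simp add: dist_norm norm_minus_commute)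
  define g where "g = (\<lambda>b::complex. real (Suc M) * cmod (b gchoose Suc M) * 2 powr \<bar>Re b - real (Suc M)\<bar>)"
  have "continuous_on (cball a d) g"
    unfolding g_def gbinomial_prod_rev by (intro continuous_intros) (auto simp del: fact_Suc)
  moreover have "cball a d \<noteq> {}" using d_bounds(1) by simp
  ultimately obtain c where g_le: "\<And>b. b \<in> cball a d \<Longrightarrow> g b \<le> g c"
    using continuous_attains_sup[OF compact_cball] by blast
  define h where "h = (\<lambda>n. g c * real (n + X) powr (Re a + d - real (Suc M)))"
  have "cmod (powr_taylor_rem M (n + X) b) \<le> h n" if b_mem: "b \<in> cball a d" for n b
  proof -
    have "cmod (powr_taylor_rem M (n + X) b) \<le> g b * real (n + X) powr (Re b - real (Suc M))"
      using norm_powr_taylor_rem_le[of "n + X" M b] assms by (simp add: g_def)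
    also have "\<dots> \<le> g b * real (n + X) powr (Re a + d - real (Suc M))"
      using Re_le[OF b_mem] assms by (intro mult_left_mono powr_mono) (auto simp: g_def)
    also have "\<dots> \<le> h n" unfolding h_def using g_le[OF b_mem] by (intro mult_right_mono) auto
    finally show ?thesis .
  qed
  moreover have "summable h"
    unfolding h_def using d_bounds by (intro summable_mult summable_shifted_powr) simp
  moreover have "cball a d \<subseteq> {b. Re b < real M}" using Re_le d_bounds(2) by force
  ultimately show ?thesis using d_bounds(1) by blast
qed

lemma summable_powr_taylor_rem:
  assumes "X \<ge> 1" "Re a < real M"
  shows "summable (\<lambda>n. powr_taylor_rem M (n + X) a)"
proof -
  obtain d h where "d > 0" "summable h"
    and dominated: "\<forall>n. \<forall>b\<in>cball a d. cmod (powr_taylor_rem M (n + X) b) \<le> h n"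
    using powr_taylor_rem_locally_dominated[OF assms] by blast
  hence "\<forall>n. cmod (powr_taylor_rem M (n + X) a) \<le> h n" by simp
  thus ?thesis using \<open>summable h\<close> by (blast intro: summable_comparison_test)
qed

lemma holomorphic_suminf:
  fixes f :: "nat \<Rightarrow> complex \<Rightarrow> complex"
  assumes "open A" "\<And>n. f n holomorphic_on A"
    and "\<And>x. x \<in> A \<Longrightarrow> \<exists>d>0. \<exists>h. cball x d \<subseteq> A \<and> summable h \<and> (\<forall>n. \<forall>y\<in>cball x d. norm (f n y) \<le> h n)"
  shows "(\<lambda>s. \<Sum>n. f n s) holomorphic_on A"
proof (rule holomorphic_uniform_sequence[OF assms(1), where f = "\<lambda>n s. \<Sum>k<n. f k s"])
  show "(\<lambda>s. \<Sum>k<n. f k s) holomorphic_on A" for n by (intro holomorphic_on_sum assms(2))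
next
  fix x assume "x \<in> A"
  from assms(3)[OF this] obtain d h where d_props: "d > 0" "cball x d \<subseteq> A" "summable h"
    and dominated: "\<forall>n. \<forall>y\<in>cball x d. norm (f n y) \<le> h n"
    by (elim exE conjE)
  have "uniform_limit (cball x d) (\<lambda>n s. \<Sum>k<n. f k s) (\<lambda>s. \<Sum>n. f n s) sequentially"
    by (rule Weierstrass_m_test[OF _ d_props(3)]) (use dominated in blast)
  with d_props show "\<exists>d. 0 < d \<and> cball x d \<subseteq> A \<and>
    uniform_limit (cball x d) (\<lambda>n s. \<Sum>k<n. f k s) (\<lambda>s. \<Sum>n. f n s) sequentially"
    by blast
qed

lemma holomorphic_powr_taylor_rem_series:
  assumes "X \<ge> 1"
  shows "(\<lambda>s. \<Sum>n. powr_taylor_rem M (n + X) (1 - s)) holomorphic_on {s. Re s > 1 - real M}"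
proof -
  have "(\<lambda>a. \<Sum>n. powr_taylor_rem M (n + X) a) holomorphic_on {a. Re a < real M}"
    using assms
    by (intro holomorphic_suminf open_halfspace_Re_lt holomorphic_powr_taylor_rem
        powr_taylor_rem_locally_dominated) auto
  hence "(\<lambda>a. \<Sum>n. powr_taylor_rem M (n + X) a) \<circ> (\<lambda>s. 1 - s) holomorphic_on {s. Re s > 1 - real M}"
    by (intro holomorphic_on_compose_gen[where t = "{a. Re a < real M}"] holomorphic_intros) auto
  thus ?thesis by (simp add: o_def)
qed

definition dirichlet_zeta :: "complex \<Rightarrow> complex" where
  "dirichlet_zeta s = (\<Sum>n. 1 / of_nat (Suc n) powr s)"

lemma dirichlet_zeta_sums:
  assumes "Re s > 1"
  shows "(\<lambda>n. of_nat (Suc n) powr (-s)) sums dirichlet_zeta s"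
proof -
  have "summable (\<lambda>n. norm (of_nat (Suc n) powr (-s) :: complex))"
    using assms summable_shifted_powr[of "- Re s" 1] by (simp del: of_nat_Suc)
  hence "summable (\<lambda>n. of_nat (Suc n) powr (-s) :: complex)" by (rule summable_norm_cancel)
  thus ?thesis by (simp add: dirichlet_zeta_def powr_minus_divide summable_sums del: of_nat_Suc)
qed

lemma nat_powr_telescope_sums:
  assumes "Re a < 0"
  shows "(\<lambda>n. of_nat (Suc (n + 1)) powr a - of_nat (n + 1) powr a :: complex) sums -1"
proof -
  have "(\<lambda>n. real (n + 1) powr Re a) \<longlonglongrightarrow> 0"
    using assms filterlim_compose[OF filterlim_real_sequentially filterlim_add_const_nat_at_top[of 1]]
    by (intro tendsto_neg_powr) auto
  hence "(\<lambda>n. norm (of_nat (n + 1) powr a :: complex)) \<longlonglongrightarrow> 0" unfolding norm_nat_powr .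
  from telescope_sums[OF tendsto_norm_zero_cancel[OF this]] show ?thesis by simp
qed

text \<open>
  Summing the binomial expansion of \<open>(n + 1)\<^sup>1\<^sup>-\<^sup>s\<close> at \<open>n\<close> over all \<open>n \<ge> 1\<close> telescopes on the left; solving
  for the linear term expresses \<open>(s - 1) \<zeta>(s)\<close> by its own values further to the right.
\<close>
lemma dirichlet_zeta_recursion:
  assumes "Re s > 1"
  shows "(s - 1) * dirichlet_zeta s =
    1 - (\<Sum>k=1..M. ((1 - s) gchoose k) / of_nat (Suc k) * ((s + of_nat k - 1) * dirichlet_zeta (s + of_nat k)))
      + (\<Sum>n. powr_taylor_rem (Suc M) (n + 1) (1 - s))"
proof -
  define c where "c = (\<lambda>k. (1 - s) gchoose k)"
  define Z where "Z = (\<lambda>k. dirichlet_zeta (s + of_nat k))"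
  have sums_Z: "(\<lambda>n. of_nat (n + 1) powr (1 - s - of_nat (Suc k))) sums Z k" for k
    using dirichlet_zeta_sums[of "s + of_nat k"] assms
      by (simp add: Z_def del: of_nat_Suc) (simp add: algebra_simps)
  have "(\<lambda>n. (of_nat (Suc (n + 1)) powr (1 - s) - of_nat (n + 1) powr (1 - s))
          - (\<Sum>k\<le>M. c (Suc k) * of_nat (n + 1) powr (1 - s - of_nat (Suc k)))) sums
        (- 1 - (\<Sum>k\<le>M. c (Suc k) * Z k))"
    using assms by (intro sums_diff nat_powr_telescope_sums sums_sum sums_mult sums_Z) auto
  moreover have "(of_nat (Suc (n + 1)) powr (1 - s) - of_nat (n + 1) powr (1 - s))
      - (\<Sum>k\<le>M. c (Suc k) * of_nat (n + 1) powr (1 - s - of_nat (Suc k)))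
      = powr_taylor_rem (Suc M) (n + 1) (1 - s)" for n
    by (simp add: powr_taylor_rem_def c_def sum.atMost_Suc_shift del: sum.atMost_Suc of_nat_Suc)
  ultimately have "(\<Sum>n. powr_taylor_rem (Suc M) (n + 1) (1 - s)) = - 1 - (\<Sum>k\<le>M. c (Suc k) * Z k)"
    by (simp only: sums_iff)
  also have "(\<Sum>k\<le>M. c (Suc k) * Z k)
      = (1 - s) * Z 0 - (\<Sum>k=1..M. c k / of_nat (Suc k) * ((s + of_nat k - 1) * Z k))"
  proof -
    have "c (Suc k) = - (c k / of_nat (Suc k) * (s + of_nat k - 1))" for k
      using gbinomial_mult_1[of "1 - s" k] by (simp add: c_def divide_simps del: of_nat_Suc)
        (simp add: algebra_simps)
    moreover have "{..M} = insert 0 {1..M}" by auto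
    ultimately show ?thesis
      by (simp add: c_def sum_negf mult.assoc del: of_nat_Suc) (simp add: algebra_simps)
  qed
  finally show ?thesis by (simp add: Z_def c_def algebra_simps)
qed

lemma dirichlet_zeta_continuation_halfplane:
  "\<exists>E. E holomorphic_on {s. Re s > - real m} \<and> (\<forall>s\<in>{s. Re s > 1}. E s = (s - 1) * dirichlet_zeta s)"
proof (induction m)
  case 0
  have "(\<lambda>s. 1 + (\<Sum>n. powr_taylor_rem 1 (n + 1) (1 - s))) holomorphic_on {s. Re s > - real 0}"
    using holomorphic_powr_taylor_rem_series[of 1 1] by (auto intro!: holomorphic_intros)
  moreover have "1 + (\<Sum>n. powr_taylor_rem 1 (n + 1) (1 - s)) = (s - 1) * dirichlet_zeta s"
    if "Re s > 1" for s
    using dirichlet_zeta_recursion[OF that, of 0] by simp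
  ultimately show ?case by blast
next
  case (Suc m)
  then obtain E where continuation: "E holomorphic_on {s. Re s > - real m}"
    "\<And>s. Re s > 1 \<Longrightarrow> E s = (s - 1) * dirichlet_zeta s" by blast
  let ?A = "{s. Re s > - real (Suc m)}"
  define F where "F = (\<lambda>s. 1 - (\<Sum>k=1..Suc m. ((1 - s) gchoose k) / of_nat (Suc k) * E (s + of_nat k))
                           + (\<Sum>n. powr_taylor_rem (Suc (Suc m)) (n + 1) (1 - s)))"
  have "(\<lambda>s. E (s + of_nat k)) holomorphic_on ?A" if "k \<in> {1..Suc m}" for k
    using holomorphic_on_compose_gen[of "\<lambda>s. s + of_nat k" ?A E, OF _ continuation(1)] that
    by (force simp: o_def intro!: holomorphic_intros)
  moreover have "(\<lambda>s. \<Sum>n. powr_taylor_rem (Suc (Suc m)) (n + 1) (1 - s)) holomorphic_on ?A"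
    by (rule holomorphic_on_subset[OF holomorphic_powr_taylor_rem_series]) auto
  ultimately have "F holomorphic_on ?A"
    unfolding F_def gbinomial_prod_rev by (intro holomorphic_intros) (auto simp del: of_nat_Suc)
  moreover have "F s = (s - 1) * dirichlet_zeta s" if "Re s > 1" for s
  proof -
    have "E (s + of_nat k) = (s + of_nat k - 1) * dirichlet_zeta (s + of_nat k)" for k :: nat
      using that by (intro continuation(2)) simp
    thus ?thesis unfolding F_def dirichlet_zeta_recursion[OF that, of "Suc m"] by (simp only:)
  qed
  ultimately show ?case by blast
qed

lemma holomorphic_extension_UN:
  fixes A :: "nat \<Rightarrow> complex set"
  assumes A_chain: "\<And>m. open (A m)" "\<And>m. connected (A m)" "incseq A" and W_subset: "open W" "W \<noteq> {}" "\<And>m. W \<subseteq> A m"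
    and ext: "\<And>m. \<exists>E. E holomorphic_on A m \<and> (\<forall>z\<in>W. E z = f z)"
  shows "\<exists>E. E holomorphic_on (\<Union>m. A m) \<and> (\<forall>z\<in>W. E z = f z)"
proof -
  obtain E where extension: "\<And>m. E m holomorphic_on A m" "\<And>m z. z \<in> W \<Longrightarrow> E m z = f z"
    using ext by metis
  define F where "F = (\<lambda>z. E (LEAST m. z \<in> A m) z)"
  have F_eq: "F z = E m z" if z_mem: "z \<in> A m" for m z
  proof -
    define k where "k = (LEAST m. z \<in> A m)"
    have least_index: "z \<in> A k" "A k \<subseteq> A m"
      using z_mem LeastI[of "\<lambda>m. z \<in> A m" m] Least_le[of "\<lambda>m. z \<in> A m" m] A_chain(3)
      by (auto simp: k_def incseq_def)
    have "E k z = E m z"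
      by (rule analytic_continuation_open[OF W_subset(1) A_chain(1)[of k] W_subset(2) A_chain(2) W_subset(3)])
        (use extension least_index in \<open>auto intro: holomorphic_on_subset\<close>)
    thus ?thesis by (simp add: F_def k_def)
  qed
  have "F holomorphic_on A m" for m using extension(1)[of m] F_eq holomorphic_transform by metis
  hence "F holomorphic_on (\<Union>m. A m)" using A_chain(1) by (intro holomorphic_on_UN_open) auto
  moreover have "\<forall>z\<in>W. F z = f z" using F_eq extension(2) W_subset(3) by (metis subsetD)
  ultimately show ?thesis by blast
qed

lemma dirichlet_zeta_entire_continuation:
  "\<exists>E. E holomorphic_on UNIV \<and> (\<forall>s\<in>{s. Re s > 1}. E s = (s - 1) * dirichlet_zeta s)"
proof -
  let ?A = "\<lambda>m::nat. {s. Re s > - real m}"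
  have "Complex 2 0 \<in> {s. Re s > 1}" by simp
  hence "{s. Re s > 1} \<noteq> {}" by blast
  hence "\<exists>E. E holomorphic_on (\<Union>m. ?A m) \<and> (\<forall>s\<in>{s. Re s > 1}. E s = (s - 1) * dirichlet_zeta s)"
    by (intro holomorphic_extension_UN dirichlet_zeta_continuation_halfplane)
      (auto simp: open_halfspace_Re_gt connected_halfspace_Re_gt incseq_def)
  moreover have "\<exists>m. s \<in> ?A m" for s
    using reals_Archimedean2[of "- Re s"] by (simp add: minus_less_iff)
  hence "(\<Union>m. ?A m) = UNIV" by blast
  ultimately show ?thesis by metis
qed

lemma holomorphic_eq_if_eq_on_halfplane:
  assumes "f holomorphic_on A" "g holomorphic_on A" "open A" "connected A" "s \<in> A" "w \<in> A" "Re w > 1"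
    and "\<And>s. s \<in> A \<Longrightarrow> Re s > 1 \<Longrightarrow> f s = g s"
  shows "f s = g s"
  by (rule analytic_continuation_open[where s = "A \<inter> {s. Re s > 1}" and s' = A])
    (use assms in \<open>auto intro: open_Int open_halfspace_Re_gt\<close>)

lemma holomorphic_punctured_eq_if_eq_on_halfplane:
  assumes "f holomorphic_on - {1}" "g holomorphic_on - {1}" "\<And>s. Re s > 1 \<Longrightarrow> f s = g s" "s \<noteq> 1"
  shows "f s = g s"
  by (rule holomorphic_eq_if_eq_on_halfplane[where A = "- {1}" and w = 2])
    (use assms in \<open>auto intro: connected_punctured_universe\<close>)

lemma
  shows holomorphic_zeta: "zeta holomorphic_on - {1}"
    and zeta_1: "zeta 1 = 0"
    and zeta_eq_dirichlet_zeta: "Re s > 1 \<Longrightarrow> zeta s = dirichlet_zeta s"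
proof -
  let ?P = "\<lambda>f. f holomorphic_on - {1} \<and> f 1 = 0 \<and> (\<forall>s. Re s > 1 \<longrightarrow> f s = dirichlet_zeta s)"
  obtain E where continuation: "E holomorphic_on UNIV" "\<And>s. Re s > 1 \<Longrightarrow> E s = (s - 1) * dirichlet_zeta s"
    using dirichlet_zeta_entire_continuation by blast
  have "?P (\<lambda>s. E s / (s - 1))"
    using continuation(2) by (auto intro!: holomorphic_intros holomorphic_on_subset[OF continuation(1)])
  moreover have "f = g" if "?P f" "?P g" for f g
    using that holomorphic_punctured_eq_if_eq_on_halfplane[of f g] by (metis ext)
  ultimately have "\<exists>!f. ?P f" by blast
  from theI'[OF this] have "?P zeta" unfolding zeta_def dirichlet_zeta_def .
  thus "zeta holomorphic_on - {1}" "zeta 1 = 0" "Re s > 1 \<Longrightarrow> zeta s = dirichlet_zeta s" by blast+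
qed

lemma zeta_cnj: "zeta (cnj s) = cnj (zeta s)"
proof (cases "s = 1")
  case False
  have "dirichlet_zeta (cnj z) = cnj (dirichlet_zeta z)" if "Re z > 1" for z
  proof -
    have "(\<lambda>n. cnj (of_nat (Suc n) powr (-z))) sums cnj (dirichlet_zeta z)"
      using dirichlet_zeta_sums[OF that] by (simp only: sums_cnj)
    moreover have "cnj (of_nat (Suc n) powr (-z)) = of_nat (Suc n) powr (- cnj z)" for n
      using cnj_powr[of "of_nat (Suc n)" "-z"] by (simp del: of_nat_Suc)
    ultimately show ?thesis using dirichlet_zeta_sums[of "cnj z"] that sums_unique2 by simp
  qed
  hence "(cnj \<circ> zeta \<circ> cnj) z = zeta z" if "Re z > 1" for z
    using that by (simp add: zeta_eq_dirichlet_zeta)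
  moreover have "cnj \<circ> zeta \<circ> cnj holomorphic_on - {1}"
    by (rule holomorphic_on_compose_cnj_cnj) (auto intro: holomorphic_on_subset[OF holomorphic_zeta])
  ultimately have "(cnj \<circ> zeta \<circ> cnj) s = zeta s"
    using holomorphic_punctured_eq_if_eq_on_halfplane[OF _ holomorphic_zeta] False by blast
  thus ?thesis by (metis comp_apply complex_cnj_cnj)
qed (simp add: zeta_1)

lemma powr_taylor_rem_1:
  "powr_taylor_rem 1 n (1 - s) =
     of_nat (Suc n) powr (1 - s) - of_nat n powr (1 - s) - (1 - s) * of_nat n powr (- s)"
  by (simp add: powr_taylor_rem_def)

lemma zeta_euler_summation:
  assumes "Re s > 0" "s \<noteq> 1" "X \<ge> 1"
  shows "zeta s = (\<Sum>n=1..<X. of_nat n powr (-s)) + of_nat X powr (1 - s) / (s - 1)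
           + (\<Sum>n. powr_taylor_rem 1 (n + X) (1 - s)) / (s - 1)"
proof -
  define R where "R = (\<lambda>X. \<Sum>n. powr_taylor_rem 1 (n + X) (1 - s))"
  have R_rec: "R X = powr_taylor_rem 1 X (1 - s) + R (Suc X)" if "X \<ge> 1" for X
    using suminf_split_head[OF summable_powr_taylor_rem[OF that, of "1 - s" 1]] assms(1) by (simp add: R_def)
  have "(s - 1) * zeta s = (s - 1) * (\<Sum>n=1..<X. of_nat n powr (-s)) + of_nat X powr (1 - s) + R X"
    using assms(3)
  proof (induction X rule: dec_induct)
    case base
    have "(s - 1) * zeta s = 1 + (\<Sum>n. powr_taylor_rem 1 (n + 1) (1 - s))"
    proof (rule holomorphic_eq_if_eq_on_halfplane[where A = "{s. Re s > 0} - {1}" and w = 2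
          and f = "\<lambda>s. (s - 1) * zeta s"])
      show "(\<lambda>s. 1 + (\<Sum>n. powr_taylor_rem 1 (n + 1) (1 - s))) holomorphic_on {s. Re s > 0} - {1}"
        using holomorphic_on_subset[OF holomorphic_powr_taylor_rem_series[of 1 1], of "{s. Re s > 0} - {1}"]
        by (auto intro!: holomorphic_intros)
      show "(\<lambda>s. (s - 1) * zeta s) holomorphic_on {s. Re s > 0} - {1}"
        by (intro holomorphic_intros holomorphic_on_subset[OF holomorphic_zeta]) auto
      show "connected ({s. Re s > 0} - {1})"
        by (intro connected_open_delete open_halfspace_Re_gt connected_halfspace_Re_gt) simp
      show "(s - 1) * zeta s = 1 + (\<Sum>n. powr_taylor_rem 1 (n + 1) (1 - s))" if "Re s > 1" for s
        using dirichlet_zeta_recursion[OF that, of 0] zeta_eq_dirichlet_zeta[OF that] by simp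
    qed (use assms in \<open>auto intro: open_halfspace_Re_gt\<close>)
    thus ?case by (simp add: R_def)
  next
    case (step X)
    thus ?case unfolding step.IH R_rec[OF step.hyps(1)] powr_taylor_rem_1
      by (simp add: algebra_simps)
  qed
  hence "zeta s = ((s - 1) * (\<Sum>n=1..<X. of_nat n powr (-s)) + of_nat X powr (1 - s) + R X) / (s - 1)"
    using assms(2) by (metis nonzero_mult_div_cancel_left right_minus_eq)
  thus ?thesis using assms(2) by (simp add: R_def add_divide_distrib)
qed

section \<open>Mean squares of exponential integrals\<close>

lemma norm_add_square_le:
  fixes x y :: "'a :: real_normed_vector"
  shows "(norm (x + y))\<^sup>2 \<le> 2 * (norm x)\<^sup>2 + 2 * (norm y)\<^sup>2"
proof -
  have "(norm (x + y))\<^sup>2 \<le> (norm x + norm y)\<^sup>2" by (intro power_mono norm_triangle_ineq) auto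
  also have "\<dots> \<le> 2 * (norm x)\<^sup>2 + 2 * (norm y)\<^sup>2"
    using sum_squares_bound[of "norm x" "norm y"] by (simp add: power2_sum)
  finally show ?thesis .
qed

lemma integral_subinterval_le:
  fixes f :: "real \<Rightarrow> real"
  assumes "f integrable_on {a..b}" "\<And>x. 0 \<le> f x" "{c..d} \<subseteq> {a..b}"
  shows "f integrable_on {c..d}" "integral {c..d} f \<le> integral {a..b} f"
proof -
  show integrable: "f integrable_on {c..d}" using assms(1,3) by (rule integrable_on_subinterval)
  show "integral {c..d} f \<le> integral {a..b} f"
    using assms(2) by (intro integral_subset_le[OF assms(3) integrable assms(1)] ballI)
qed

abbreviation lborel_on :: "real \<Rightarrow> real \<Rightarrow> real measure" where
  "lborel_on a b \<equiv> restrict_space lborel {a..b}"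

lemma finite_measure_lborel_on: "finite_measure (lborel_on a b)"
  by (intro finite_measureI) (auto simp: space_restrict_space emeasure_restrict_space emeasure_lborel_Icc_eq)

lemma borel_measurable_lborel_on_id: "(\<lambda>t. t) \<in> borel_measurable (lborel_on a b)"
  by (rule measurable_restrict_space1) simp

lemma lborel_on_integral:
  fixes f :: "real \<Rightarrow> 'b::euclidean_space"
  assumes "integrable (lborel_on a b) f"
  shows "f integrable_on {a..b}" "integral\<^sup>L (lborel_on a b) f = integral {a..b} f"
proof -
  have "set_integrable lborel {a..b} f"
    using assms by (simp add: integrable_restrict_space set_integrable_def)
  from set_borel_integral_eq_integral[OF this]
  show "f integrable_on {a..b}" "integral\<^sup>L (lborel_on a b) f = integral {a..b} f"
    by (simp_all add: integral_restrict_space set_lebesgue_integral_def)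
qed

lemma integrable_lborel_on_continuous:
  fixes f :: "real \<Rightarrow> 'b::euclidean_space"
  assumes "continuous_on {a..b} f"
  shows "integrable (lborel_on a b) f"
  using borel_integrable_atLeastAtMost'[OF assms]
  by (simp add: integrable_restrict_space set_integrable_def)

lemma lborel_on_integral_continuous:
  fixes f :: "real \<Rightarrow> 'b::euclidean_space"
  assumes "continuous_on {a..b} f"
  shows "integral\<^sup>L (lborel_on a b) f = integral {a..b} f"
  by (intro lborel_on_integral integrable_lborel_on_continuous assms)

definition parabola_fourier :: "real \<Rightarrow> real \<Rightarrow> complex" where
  "parabola_fourier T \<omega> = integral {-T..T} (\<lambda>t. of_real (T\<^sup>2 - t\<^sup>2) * cis (\<omega> * t))"

lemma parabola_fourier_eq:
  assumes "T > 0" "\<omega> \<noteq> 0"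
  shows "parabola_fourier T \<omega> = of_real (4 * (sin (\<omega> * T) - \<omega> * T * cos (\<omega> * T)) / \<omega> ^ 3)"
proof -
  define c where "c = \<i> * complex_of_real \<omega>"
  have c_powers: "c \<noteq> 0" "c\<^sup>2 = - of_real (\<omega>\<^sup>2)" "c ^ 3 = - \<i> * of_real (\<omega> ^ 3)"
    using assms by (auto simp: c_def power_mult_distrib power3_eq_cube[of \<i>])
  define \<Phi> where "\<Phi> = (\<lambda>z. exp (c * z) * (((of_real T)\<^sup>2 - z\<^sup>2) / c + 2 * z / c\<^sup>2 - 2 / c ^ 3))"
  have "(\<Phi> has_field_derivative (exp (c * z) * ((of_real T)\<^sup>2 - z\<^sup>2))) (at z)" for z
    unfolding \<Phi>_def using c_powers(1)
    by (auto intro!: derivative_eq_intros simp: field_simps power2_eq_square power3_eq_cube)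
  hence "((\<lambda>t. exp (c * of_real t) * ((of_real T)\<^sup>2 - (of_real t)\<^sup>2)) has_integral
           (\<Phi> (of_real T) - \<Phi> (of_real (-T)))) {-T..T}"
    using assms by (intro fundamental_theorem_of_calculus has_vector_derivative_real_field) auto
  moreover have "exp (c * of_real t) = cis (\<omega> * t)" for t
    by (simp add: c_def cis_conv_exp mult_ac)
  ultimately have "parabola_fourier T \<omega> = \<Phi> (of_real T) - \<Phi> (of_real (-T))"
    unfolding parabola_fourier_def by (intro integral_unique) (simp add: mult.commute)
  also have "\<dots> = (cis (\<omega> * T) + cis (- (\<omega> * T))) * (2 * of_real T / c\<^sup>2)
                   - (cis (\<omega> * T) - cis (- (\<omega> * T))) * (2 / c ^ 3)"
    by (simp add: \<Phi>_def c_def cis_conv_exp algebra_simps add_divide_distrib)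
  also have "cis (\<omega> * T) + cis (- (\<omega> * T)) = of_real (2 * cos (\<omega> * T))"
    by (simp add: complex_eq_iff)
  also have "cis (\<omega> * T) - cis (- (\<omega> * T)) = \<i> * of_real (2 * sin (\<omega> * T))"
    by (simp add: complex_eq_iff)
  finally show ?thesis
    using assms unfolding c_powers(2,3) by (simp add: field_simps power2_eq_square power3_eq_cube)
qed

lemma norm_parabola_fourier_le:
  assumes "T > 0"
  shows "cmod (parabola_fourier T \<omega>) \<le> 10 * T ^ 3 / (1 + T\<^sup>2 * \<omega>\<^sup>2)"
proof -
  have trivial_bound: "cmod (parabola_fourier T \<omega>) \<le> 2 * T ^ 3"
  proof -
    have "cmod (of_real (T\<^sup>2 - t\<^sup>2) * cis (\<omega> * t)) \<le> T\<^sup>2" if "t \<in> {-T..T}" for t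
    proof -
      have "t\<^sup>2 \<le> T\<^sup>2" using that by (intro abs_le_square_iff[THEN iffD1]) auto
      thus ?thesis unfolding norm_mult norm_of_real by simp
    qed
    hence "cmod (parabola_fourier T \<omega>) \<le> T\<^sup>2 * (T - (-T))"
      unfolding parabola_fourier_def using assms by (intro integral_bound continuous_intros) auto
    thus ?thesis by (simp add: power2_eq_square power3_eq_cube)
  qed
  have decay: "cmod (parabola_fourier T \<omega>) * \<omega>\<^sup>2 \<le> 8 * T"
  proof (cases "\<omega> = 0")
    case False
    have "\<bar>sin (\<omega> * T) - \<omega> * T * cos (\<omega> * T)\<bar> \<le> \<bar>sin (\<omega> * T)\<bar> + \<bar>\<omega> * T\<bar> * \<bar>cos (\<omega> * T)\<bar>"
      by (simp add: abs_mult[symmetric])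
    also have "\<dots> \<le> \<bar>\<omega> * T\<bar> + \<bar>\<omega> * T\<bar> * 1"
      by (intro add_mono mult_left_mono abs_sin_x_le_abs_x) auto
    finally have "\<bar>sin (\<omega> * T) - \<omega> * T * cos (\<omega> * T)\<bar> \<le> 2 * (\<bar>\<omega>\<bar> * T)"
      using assms by (simp add: abs_mult mult_ac)
    hence "4 * \<bar>sin (\<omega> * T) - \<omega> * T * cos (\<omega> * T)\<bar> / \<bar>\<omega>\<bar> ^ 3 * \<omega>\<^sup>2
             \<le> 4 * (2 * (\<bar>\<omega>\<bar> * T)) / \<bar>\<omega>\<bar> ^ 3 * \<omega>\<^sup>2"
      by (intro mult_right_mono divide_right_mono mult_left_mono) auto
    also have "\<dots> = 8 * T"
      using False by (simp add: power3_eq_cube power2_eq_square)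
    finally show ?thesis
      unfolding parabola_fourier_eq[OF assms False] norm_of_real abs_divide abs_mult power_abs by simp
  qed (use assms in simp)
  have "cmod (parabola_fourier T \<omega>) * (1 + T\<^sup>2 * \<omega>\<^sup>2)
          = cmod (parabola_fourier T \<omega>) + T\<^sup>2 * (cmod (parabola_fourier T \<omega>) * \<omega>\<^sup>2)"
    by (simp add: algebra_simps)
  also have "\<dots> \<le> 2 * T ^ 3 + T\<^sup>2 * (8 * T)"
    using trivial_bound decay by (intro add_mono mult_left_mono) auto
  also have "\<dots> = 10 * T ^ 3" by (simp add: power2_eq_square power3_eq_cube)
  finally show ?thesis by (simp add: pos_le_divide_eq add_pos_nonneg)
qed

definition exp_transform :: "'a measure \<Rightarrow> ('a \<Rightarrow> complex) \<Rightarrow> ('a \<Rightarrow> real) \<Rightarrow> real \<Rightarrow> complex" where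
  "exp_transform M a l t = (\<integral>x. a x * cis (- (l x * t)) \<partial>M)"

locale bounded_exp_transform = finite_measure M for M :: "'a measure" +
  fixes a :: "'a \<Rightarrow> complex" and l :: "'a \<Rightarrow> real" and B :: real
  assumes coeff_measurable [measurable]: "a \<in> borel_measurable M"
    and freq_measurable [measurable]: "l \<in> borel_measurable M"
    and norm_coeff_le: "x \<in> space M \<Longrightarrow> cmod (a x) \<le> B"
begin

lemma integrable_mult_cis: "integrable M (\<lambda>x. a x * cis (- (l x * t)))"
  by (rule integrable_const_bound[where B = B])
    (auto intro!: AE_I2 norm_coeff_le simp: norm_mult cis_conv_exp)

lemma borel_measurable_exp_transform [measurable]:
  "exp_transform M a l \<in> borel_measurable (lborel_on u v)"
proof -
  interpret R: finite_measure "lborel_on u v" by (rule finite_measure_lborel_on)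
  note [measurable] = borel_measurable_lborel_on_id
  show ?thesis unfolding exp_transform_def[abs_def] cis_conv_exp by measurable
qed

lemma norm_exp_transform_le: "cmod (exp_transform M a l t) \<le> B * measure M (space M)"
proof -
  have "cmod (exp_transform M a l t) \<le> (\<integral>x. B \<partial>M)" unfolding exp_transform_def
    by (intro order_trans[OF integral_norm_bound] integral_mono_AE integrable_norm integrable_mult_cis)
      (auto simp: norm_mult intro!: AE_I2 norm_coeff_le)
  thus ?thesis by (simp add: mult.commute)
qed

lemma integrable_mult_exp_transform_square:
  fixes g :: "real \<Rightarrow> real"
  assumes "continuous_on {u..v} g"
  shows "integrable (lborel_on u v) (\<lambda>t. g t * (cmod (exp_transform M a l t))\<^sup>2)"
proof -
  have integrable_g: "integrable (lborel_on u v) g" using assms by (rule integrable_lborel_on_continuous)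
  note [measurable] = borel_measurable_integrable[OF integrable_g]
  show ?thesis
  proof (rule Bochner_Integration.integrable_bound)
    show "integrable (lborel_on u v) (\<lambda>t. g t * (B * measure M (space M))\<^sup>2)"
      using integrable_g by (rule integrable_mult_left)
    show "AE t in lborel_on u v. norm (g t * (cmod (exp_transform M a l t))\<^sup>2)
                                   \<le> norm (g t * (B * measure M (space M))\<^sup>2)"
      using norm_exp_transform_le by (intro AE_I2) (auto simp: abs_mult intro!: mult_left_mono power_mono)
  qed measurable
qed

lemma integrable_parabola_mult_cis:
  assumes "T > 0"
  shows "integrable (M \<Otimes>\<^sub>M lborel_on (-T) T) (\<lambda>(x, t). of_real (T\<^sup>2 - t\<^sup>2) * (a x * cis (- (l x * t))))"
proof -
  interpret R: finite_measure "lborel_on (-T) T" by (rule finite_measure_lborel_on)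
  interpret P: finite_measure "M \<Otimes>\<^sub>M lborel_on (-T) T"
    by (rule finite_measure_pair_measure[OF R.finite_measure_axioms finite_measure_axioms])
  note [measurable] = borel_measurable_lborel_on_id
  show ?thesis
  proof (rule P.integrable_const_bound[where B = "T\<^sup>2 * B"])
    show "AE z in M \<Otimes>\<^sub>M lborel_on (-T) T.
            norm (case z of (x, t) \<Rightarrow> of_real (T\<^sup>2 - t\<^sup>2) * (a x * cis (- (l x * t)))) \<le> T\<^sup>2 * B"
    proof (intro AE_I2)
      fix z assume "z \<in> space (M \<Otimes>\<^sub>M lborel_on (-T) T)"
      then obtain x t where z_split: "z = (x, t)" "x \<in> space M" "t \<in> {-T..T}"
        by (auto simp: space_pair_measure space_restrict_space)
      have "t\<^sup>2 \<le> T\<^sup>2" using z_split(3) by (intro abs_le_square_iff[THEN iffD1]) auto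
      hence "\<bar>T\<^sup>2 - t\<^sup>2\<bar> \<le> T\<^sup>2" by simp
      hence "\<bar>T\<^sup>2 - t\<^sup>2\<bar> * cmod (a x) \<le> T\<^sup>2 * B" using norm_coeff_le[OF z_split(2)] by (intro mult_mono) auto
      thus "norm (case z of (x, t) \<Rightarrow> of_real (T\<^sup>2 - t\<^sup>2) * (a x * cis (- (l x * t)))) \<le> T\<^sup>2 * B"
        by (simp add: z_split(1) norm_mult del: of_real_diff)
    qed
  qed (unfold cis_conv_exp, measurable)
qed

lemma integral_parabola_mult_exp_transform:
  assumes "T > 0"
  shows "(\<integral>t. of_real (T\<^sup>2 - t\<^sup>2) * exp_transform M a l t \<partial>lborel_on (-T) T)
           = (\<integral>x. a x * parabola_fourier T (- l x) \<partial>M)"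
proof -
  interpret R: finite_measure "lborel_on (-T) T" by (rule finite_measure_lborel_on)
  interpret MR: pair_sigma_finite M "lborel_on (-T) T" by unfold_locales
  have inner: "(\<integral>t. of_real (T\<^sup>2 - t\<^sup>2) * (a x * cis (- (l x * t))) \<partial>lborel_on (-T) T)
      = a x * parabola_fourier T (- l x)" for x
  proof -
    have "(\<integral>t. of_real (T\<^sup>2 - t\<^sup>2) * cis (- l x * t) \<partial>lborel_on (-T) T) = parabola_fourier T (- l x)"
      unfolding parabola_fourier_def by (intro lborel_on_integral_continuous continuous_intros)
    thus ?thesis by (simp add: mult.left_commute)
  qed
  have "(\<integral>t. of_real (T\<^sup>2 - t\<^sup>2) * exp_transform M a l t \<partial>lborel_on (-T) T)
      = (\<integral>x. (\<integral>t. of_real (T\<^sup>2 - t\<^sup>2) * (a x * cis (- (l x * t))) \<partial>lborel_on (-T) T) \<partial>M)"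
    using MR.Fubini_integral[OF integrable_parabola_mult_cis[OF assms]] by (simp add: exp_transform_def)
  also have "\<dots> = (\<integral>x. a x * parabola_fourier T (- l x) \<partial>M)" by (simp only: inner)
  finally show ?thesis .
qed

lemma norm_integral_parabola_mult_exp_transform_le:
  assumes "T > 0"
  shows "cmod (\<integral>t. of_real (T\<^sup>2 - t\<^sup>2) * exp_transform M a l t \<partial>lborel_on (-T) T)
           \<le> (\<integral>x. cmod (a x) * (10 * T ^ 3 / (1 + T\<^sup>2 * (l x)\<^sup>2)) \<partial>M)"
proof -
  have pos: "1 + T\<^sup>2 * u\<^sup>2 > 0" for u by (simp add: add_pos_nonneg)
  have bound: "10 * T ^ 3 / (1 + T\<^sup>2 * u\<^sup>2) \<le> 10 * T ^ 3" for u
    using assms pos[of u] by (simp add: divide_le_eq mult_le_cancel_left1)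
  have nonneg: "0 \<le> 10 * T ^ 3 / (1 + T\<^sup>2 * u\<^sup>2)" for u
    using assms pos[of u] by (intro divide_nonneg_pos) auto
  have "norm (cmod (a x) * (10 * T ^ 3 / (1 + T\<^sup>2 * (l x)\<^sup>2))) \<le> B * (10 * T ^ 3)" if "x \<in> space M" for x
    unfolding real_norm_def abs_mult abs_of_nonneg[OF nonneg] abs_norm_cancel
    using norm_coeff_le[OF that] bound nonneg by (intro mult_mono) (auto intro: order_trans[OF norm_ge_zero])
  hence "integrable M (\<lambda>x. cmod (a x) * (10 * T ^ 3 / (1 + T\<^sup>2 * (l x)\<^sup>2)))"
    by (intro integrable_const_bound[where B = "B * (10 * T ^ 3)"] AE_I2) measurable
  hence "(\<integral>x. cmod (a x * parabola_fourier T (- l x)) \<partial>M)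
      \<le> (\<integral>x. cmod (a x) * (10 * T ^ 3 / (1 + T\<^sup>2 * (l x)\<^sup>2)) \<partial>M)"
    using norm_parabola_fourier_le[OF assms, of "- l _"] nonneg
    by (intro integral_mono') (auto simp: norm_mult simp del: times_divide_eq_right intro!: mult_left_mono)
  thus ?thesis
    unfolding integral_parabola_mult_exp_transform[OF assms] by (rule order_trans[OF integral_norm_bound])
qed

lemma bounded_exp_transform_square:
  "bounded_exp_transform (M \<Otimes>\<^sub>M M) (\<lambda>z. a (fst z) * cnj (a (snd z))) (\<lambda>z. l (fst z) - l (snd z)) (B * B)"
proof -
  have [measurable]: "(\<lambda>x. cnj (a x)) \<in> borel_measurable M"
    by (intro measurable_compose[OF coeff_measurable] borel_measurable_continuous_onI continuous_intros)
  have "cmod (a (fst z) * cnj (a (snd z))) \<le> B * B" if "z \<in> space (M \<Otimes>\<^sub>M M)" for z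
    using that norm_coeff_le[of "fst z"] norm_coeff_le[of "snd z"] order_trans[OF norm_ge_zero]
    by (auto simp: space_pair_measure norm_mult intro!: mult_mono)
  thus ?thesis
    by (intro bounded_exp_transform.intro bounded_exp_transform_axioms.intro
        finite_measure_pair_measure[OF finite_measure_axioms finite_measure_axioms]) auto
qed

lemma norm_exp_transform_square:
  "of_real ((cmod (exp_transform M a l t))\<^sup>2) =
     exp_transform (M \<Otimes>\<^sub>M M) (\<lambda>z. a (fst z) * cnj (a (snd z))) (\<lambda>z. l (fst z) - l (snd z)) t"
proof -
  interpret MM: pair_sigma_finite M M by unfold_locales
  interpret sq: bounded_exp_transform "M \<Otimes>\<^sub>M M" "\<lambda>z. a (fst z) * cnj (a (snd z))"
    "\<lambda>z. l (fst z) - l (snd z)" "B * B"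
    by (rule bounded_exp_transform_square)
  have "cnj (exp_transform M a l t) = (\<integral>y. cnj (a y) * cis (l y * t) \<partial>M)"
    unfolding exp_transform_def
    using Bochner_Integration.integral_cnj[of M "\<lambda>x. a x * cis (- (l x * t))", symmetric]
    by (simp only: complex_cnj_mult cis_cnj minus_minus)
  hence "of_real ((cmod (exp_transform M a l t))\<^sup>2)
      = (\<integral>x. (\<integral>y. (a x * cis (- (l x * t))) * (cnj (a y) * cis (l y * t)) \<partial>M) \<partial>M)"
    unfolding complex_norm_square exp_transform_def
    by (simp only: integral_mult_right_zero integral_mult_left_zero)
  also have "\<dots> = (\<integral>x. (\<integral>y. (\<lambda>z. a (fst z) * cnj (a (snd z)) * cis (- ((l (fst z) - l (snd z)) * t))) (x, y) \<partial>M) \<partial>M)"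
    by (simp add: mult_ac cis_mult ring_distribs)
  also have "\<dots> = exp_transform (M \<Otimes>\<^sub>M M) (\<lambda>z. a (fst z) * cnj (a (snd z))) (\<lambda>z. l (fst z) - l (snd z)) t"
    unfolding exp_transform_def by (rule MM.integral_fst'[OF sq.integrable_mult_cis])
  finally show ?thesis .
qed

end

lemma integral_mult_symmetric_kernel_le:
  fixes v :: "'a \<Rightarrow> real" and k :: "'a \<Rightarrow> 'a \<Rightarrow> real"
  assumes finite_M: "finite_measure M" and [measurable]: "v \<in> borel_measurable M"
    "case_prod k \<in> borel_measurable (M \<Otimes>\<^sub>M M)"
    and v_bounds: "\<And>x. x \<in> space M \<Longrightarrow> 0 \<le> v x \<and> v x \<le> B"
    and kernel_props: "\<And>x y. 0 \<le> k x y \<and> k x y \<le> C" "\<And>x y. k x y = k y x"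
    and row: "\<And>x. x \<in> space M \<Longrightarrow> (\<integral>y. k x y \<partial>M) \<le> \<kappa>"
  shows "integrable (M \<Otimes>\<^sub>M M) (\<lambda>z. v (fst z) * k (fst z) (snd z))"
    and "integrable (M \<Otimes>\<^sub>M M) (\<lambda>z. v (snd z) * k (fst z) (snd z))"
    and "(\<integral>z. v (fst z) * k (fst z) (snd z) \<partial>(M \<Otimes>\<^sub>M M)) \<le> \<kappa> * (\<integral>x. v x \<partial>M)"
    and "(\<integral>z. v (snd z) * k (fst z) (snd z) \<partial>(M \<Otimes>\<^sub>M M)) \<le> \<kappa> * (\<integral>x. v x \<partial>M)"
proof -
  interpret M: finite_measure M by fact
  interpret MM: pair_sigma_finite M M by unfold_locales
  interpret P: finite_measure "M \<Otimes>\<^sub>M M" by (rule finite_measure_pair_measure[OF finite_M finite_M])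
  let ?f = "\<lambda>z. v (fst z) * k (fst z) (snd z)"
  show int: "integrable (M \<Otimes>\<^sub>M M) ?f"
  proof (rule P.integrable_const_bound[where B = "B * C"])
    have "norm (v x * k x y) \<le> B * C" if "x \<in> space M" for x y
      using v_bounds[OF that] kernel_props(1)[of x y] by (auto simp: abs_mult intro!: mult_mono)
    thus "AE z in M \<Otimes>\<^sub>M M. norm (?f z) \<le> B * C"
      by (intro AE_I2) (auto simp: space_pair_measure)
    show "?f \<in> borel_measurable (M \<Otimes>\<^sub>M M)"
      using assms(3) by (simp add: case_prod_beta')
  qed
  show "integrable (M \<Otimes>\<^sub>M M) (\<lambda>z. v (snd z) * k (fst z) (snd z))"
    using MM.integrable_product_swap[OF int] by (simp add: case_prod_beta' kernel_props(2))
  have "(\<integral>z. ?f z \<partial>(M \<Otimes>\<^sub>M M)) = (\<integral>x. v x * (\<integral>y. k x y \<partial>M) \<partial>M)"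
    using MM.integral_fst'[OF int] by simp
  also have "\<dots> \<le> (\<integral>x. v x * \<kappa> \<partial>M)"
  proof (rule integral_mono_AE)
    show "integrable M (\<lambda>x. v x * (\<integral>y. k x y \<partial>M))" using MM.integrable_fst'[OF int] by simp
    show "integrable M (\<lambda>x. v x * \<kappa>)"
      using v_bounds by (intro integrable_mult_left M.integrable_const_bound[where B = B] AE_I2) auto
  qed (intro AE_I2 mult_left_mono row, use v_bounds in auto)
  finally show fst_bound: "(\<integral>z. ?f z \<partial>(M \<Otimes>\<^sub>M M)) \<le> \<kappa> * (\<integral>x. v x \<partial>M)" by (simp add: mult.commute)
  show "(\<integral>z. v (snd z) * k (fst z) (snd z) \<partial>(M \<Otimes>\<^sub>M M)) \<le> \<kappa> * (\<integral>x. v x \<partial>M)"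
    using fst_bound MM.integral_product_swap[OF borel_measurable_integrable[OF int]]
    by (simp add: case_prod_beta' kernel_props(2))
qed

lemma schur_test:
  fixes u :: "'a \<Rightarrow> real" and k :: "'a \<Rightarrow> 'a \<Rightarrow> real"
  assumes finite_M: "finite_measure M" and [measurable]: "u \<in> borel_measurable M"
    "case_prod k \<in> borel_measurable (M \<Otimes>\<^sub>M M)"
    and u_bounds: "\<And>x. x \<in> space M \<Longrightarrow> 0 \<le> u x \<and> u x \<le> B"
    and kernel_props: "\<And>x y. 0 \<le> k x y \<and> k x y \<le> C" "\<And>x y. k x y = k y x"
    and row: "\<And>x. x \<in> space M \<Longrightarrow> (\<integral>y. k x y \<partial>M) \<le> \<kappa>"
  shows "(\<integral>z. u (fst z) * u (snd z) * k (fst z) (snd z) \<partial>(M \<Otimes>\<^sub>M M)) \<le> \<kappa> * (\<integral>x. (u x)\<^sup>2 \<partial>M)"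
proof -
  let ?v = "\<lambda>x. (u x)\<^sup>2"
  have "?v \<in> borel_measurable M" by measurable
  moreover have "0 \<le> ?v x \<and> ?v x \<le> B\<^sup>2" if "x \<in> space M" for x
    using u_bounds[OF that] by (auto intro: power_mono)
  ultimately have kernel: "integrable (M \<Otimes>\<^sub>M M) (\<lambda>z. ?v (fst z) * k (fst z) (snd z))"
    "integrable (M \<Otimes>\<^sub>M M) (\<lambda>z. ?v (snd z) * k (fst z) (snd z))"
    "(\<integral>z. ?v (fst z) * k (fst z) (snd z) \<partial>(M \<Otimes>\<^sub>M M)) \<le> \<kappa> * (\<integral>x. ?v x \<partial>M)"
    "(\<integral>z. ?v (snd z) * k (fst z) (snd z) \<partial>(M \<Otimes>\<^sub>M M)) \<le> \<kappa> * (\<integral>x. ?v x \<partial>M)"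
    using integral_mult_symmetric_kernel_le[OF finite_M _ assms(3) _ kernel_props row] by blast+
  have "(\<integral>z. u (fst z) * u (snd z) * k (fst z) (snd z) \<partial>(M \<Otimes>\<^sub>M M))
      \<le> (\<integral>z. ?v (fst z) * k (fst z) (snd z) / 2 + ?v (snd z) * k (fst z) (snd z) / 2 \<partial>(M \<Otimes>\<^sub>M M))"
  proof (rule integral_mono')
    fix z :: "'a \<times> 'a"
    have "u (fst z) * u (snd z) * k (fst z) (snd z)
        \<le> (?v (fst z) / 2 + ?v (snd z) / 2) * k (fst z) (snd z)"
      using sum_squares_bound[of "u (fst z)" "u (snd z)"] kernel_props(1) by (intro mult_right_mono) auto
    thus "u (fst z) * u (snd z) * k (fst z) (snd z)
        \<le> ?v (fst z) * k (fst z) (snd z) / 2 + ?v (snd z) * k (fst z) (snd z) / 2"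
      by (simp add: algebra_simps)
  qed (use kernel kernel_props(1) in auto)
  thus ?thesis using kernel by simp
qed

context bounded_exp_transform
begin

lemma mean_square_integrable: "(\<lambda>t. (cmod (exp_transform M a l t))\<^sup>2) integrable_on {u..v}"
  using lborel_on_integral(1)[OF integrable_mult_exp_transform_square[of u v "\<lambda>_. 1"]] by simp

lemma parabola_mean_square_le:
  assumes T_pos: "T > 0"
    and row: "\<And>x. x \<in> space M \<Longrightarrow> (\<integral>y. 1 / (1 + T\<^sup>2 * (l x - l y)\<^sup>2) \<partial>M) \<le> \<kappa>"
  shows "integral {-T..T} (\<lambda>t. (T\<^sup>2 - t\<^sup>2) * (cmod (exp_transform M a l t))\<^sup>2)
           \<le> 10 * T ^ 3 * (\<kappa> * (\<integral>x. (cmod (a x))\<^sup>2 \<partial>M))"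
proof -
  interpret sq: bounded_exp_transform "M \<Otimes>\<^sub>M M" "\<lambda>z. a (fst z) * cnj (a (snd z))"
    "\<lambda>z. l (fst z) - l (snd z)" "B * B"
    by (rule bounded_exp_transform_square)
  have pos: "1 + T\<^sup>2 * u\<^sup>2 > 0" for u by (simp add: add_pos_nonneg)
  let ?S = "\<lambda>t. exp_transform (M \<Otimes>\<^sub>M M) (\<lambda>z. a (fst z) * cnj (a (snd z))) (\<lambda>z. l (fst z) - l (snd z)) t"
  have "integral {-T..T} (\<lambda>t. (T\<^sup>2 - t\<^sup>2) * (cmod (exp_transform M a l t))\<^sup>2)
      = (\<integral>t. (T\<^sup>2 - t\<^sup>2) * (cmod (exp_transform M a l t))\<^sup>2 \<partial>lborel_on (-T) T)"
    by (intro lborel_on_integral(2)[symmetric] integrable_mult_exp_transform_square continuous_intros)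
  also have "\<dots> \<le> cmod (of_real \<dots>)" by (simp only: norm_of_real abs_ge_self)
  also have "\<dots> = cmod (\<integral>t. of_real (T\<^sup>2 - t\<^sup>2) * ?S t \<partial>lborel_on (-T) T)"
    by (simp only: integral_complex_of_real[symmetric] of_real_mult norm_exp_transform_square)
  also have "\<dots> \<le> (\<integral>z. cmod (a (fst z) * cnj (a (snd z)))
      * (10 * T ^ 3 / (1 + T\<^sup>2 * (l (fst z) - l (snd z))\<^sup>2)) \<partial>(M \<Otimes>\<^sub>M M))"
    by (rule sq.norm_integral_parabola_mult_exp_transform_le[OF T_pos])
  also have "\<dots> = 10 * T ^ 3 * (\<integral>z. cmod (a (fst z)) * cmod (a (snd z))
      * (1 / (1 + T\<^sup>2 * (l (fst z) - l (snd z))\<^sup>2)) \<partial>(M \<Otimes>\<^sub>M M))"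
    by (subst integral_mult_right_zero[symmetric]) (simp add: norm_mult mult_ac)
  also have "\<dots> \<le> 10 * T ^ 3 * (\<kappa> * (\<integral>x. (cmod (a x))\<^sup>2 \<partial>M))"
  proof (intro mult_left_mono schur_test[where B = B and C = 1, OF finite_measure_axioms _ _ _ _ _ row])
    show "0 \<le> 1 / (1 + T\<^sup>2 * (l x - l y)\<^sup>2) \<and> 1 / (1 + T\<^sup>2 * (l x - l y)\<^sup>2) \<le> 1" for x y
      using pos[of "l x - l y"] by (simp add: divide_le_eq)
  qed (use T_pos in \<open>auto simp: power2_commute norm_coeff_le\<close>)
  finally show ?thesis .
qed

text \<open>
  The weight \<open>4 T\<^sup>2 - t\<^sup>2\<close> dominates \<open>3 T\<^sup>2\<close> on \<open>[-T, T]\<close> and its Fourier transform decays quadratically. The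
  measure is kept general so that both Dirichlet polynomials and Fourier integrals are covered.
\<close>
lemma mean_square_le:
  assumes T_pos: "T > 0"
    and row: "\<And>x. x \<in> space M \<Longrightarrow> (\<integral>y. 1 / (1 + T\<^sup>2 * (l x - l y)\<^sup>2) \<partial>M) \<le> \<kappa>"
  shows "integral {-T..T} (\<lambda>t. (cmod (exp_transform M a l t))\<^sup>2) \<le> 80 / 3 * T * \<kappa> * (\<integral>x. (cmod (a x))\<^sup>2 \<partial>M)"
proof -
  let ?f = "\<lambda>t. (cmod (exp_transform M a l t))\<^sup>2"
  have row_double: "(\<integral>y. 1 / (1 + (2 * T)\<^sup>2 * (l x - l y)\<^sup>2) \<partial>M) \<le> \<kappa>" if "x \<in> space M" for x
  proof -
    have pos: "1 + T\<^sup>2 * u\<^sup>2 > 0" for u by (simp add: add_pos_nonneg)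
    have "integrable M (\<lambda>y. 1 / (1 + T\<^sup>2 * (l x - l y)\<^sup>2))"
      using pos by (intro integrable_const_bound[where B = 1] AE_I2) (auto simp: divide_le_eq)
    hence "(\<integral>y. 1 / (1 + (2 * T)\<^sup>2 * (l x - l y)\<^sup>2) \<partial>M) \<le> (\<integral>y. 1 / (1 + T\<^sup>2 * (l x - l y)\<^sup>2) \<partial>M)"
      using pos by (intro integral_mono' frac_le) (auto simp: power_mult_distrib intro: less_imp_le)
    thus ?thesis using row[OF that] by linarith
  qed
  have "3 * T\<^sup>2 * integral {-T..T} ?f = integral {-T..T} (\<lambda>t. 3 * T\<^sup>2 * ?f t)" by simp
  also have "\<dots> \<le> integral {-T..T} (\<lambda>t. ((2 * T)\<^sup>2 - t\<^sup>2) * ?f t)"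
  proof (intro integral_le lborel_on_integral(1)[OF integrable_mult_exp_transform_square])
    fix t assume "t \<in> {-T..T}"
    hence "t\<^sup>2 \<le> T\<^sup>2" by (intro abs_le_square_iff[THEN iffD1]) auto
    thus "3 * T\<^sup>2 * ?f t \<le> ((2 * T)\<^sup>2 - t\<^sup>2) * ?f t" by (intro mult_right_mono) auto
  qed (auto intro!: continuous_intros)
  also have "\<dots> \<le> integral {-(2 * T)..2 * T} (\<lambda>t. ((2 * T)\<^sup>2 - t\<^sup>2) * ?f t)"
  proof (intro integral_subset_le lborel_on_integral(1)[OF integrable_mult_exp_transform_square] ballI)
    fix t assume "t \<in> {-(2 * T)..2 * T}"
    hence "t\<^sup>2 \<le> (2 * T)\<^sup>2" by (intro abs_le_square_iff[THEN iffD1]) auto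
    thus "0 \<le> ((2 * T)\<^sup>2 - t\<^sup>2) * ?f t" by (intro mult_nonneg_nonneg) auto
  qed (use T_pos in \<open>auto intro!: continuous_intros\<close>)
  also have "\<dots> \<le> 10 * (2 * T) ^ 3 * (\<kappa> * (\<integral>x. (cmod (a x))\<^sup>2 \<partial>M))"
    using T_pos row_double by (intro parabola_mean_square_le) auto
  also have "\<dots> = 3 * T\<^sup>2 * (80 / 3 * T * \<kappa> * (\<integral>x. (cmod (a x))\<^sup>2 \<partial>M))"
    by (simp add: power2_eq_square power3_eq_cube)
  finally show ?thesis using T_pos by (simp add: mult_le_cancel_left)
qed

end

section \<open>The mean square of the zeta function\<close>

definition powr_tail :: "real \<Rightarrow> nat \<Rightarrow> real" where
  "powr_tail a N = (\<Sum>n. real (n + N) powr (-a))"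

lemma powr_tail_nonneg: "a > 1 \<Longrightarrow> powr_tail a N \<ge> 0"
  unfolding powr_tail_def by (intro suminf_nonneg summable_shifted_powr) auto

lemma powr_tail_tendsto_0:
  assumes "a > 1"
  shows "powr_tail a \<longlonglongrightarrow> 0"
proof (rule LIMSEQ_I)
  fix r :: real assume "r > 0"
  moreover have "summable (\<lambda>n. real n powr (-a))" using assms by (simp add: summable_real_powr_iff)
  ultimately obtain M where "\<And>n. n \<ge> M \<Longrightarrow> norm (\<Sum>i. real (i + n) powr (-a)) < r"
    using suminf_exist_split by blast
  thus "\<exists>M. \<forall>n\<ge>M. norm (powr_tail a n - 0) < r" unfolding powr_tail_def by auto
qed

lemma exp_transform_count_space:
  "finite A \<Longrightarrow> exp_transform (count_space A) a l t = (\<Sum>n\<in>A. a n * cis (- (l n * t)))"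
  by (simp add: exp_transform_def lebesgue_integral_count_space_finite)

lemma sum_inverse_one_plus_square_le: "(\<Sum>j=1..J. 1 / (1 + (real j)\<^sup>2)) \<le> 2"
proof (cases "J \<ge> 1")
  case True
  hence "(\<Sum>j=1..J. 1 / (1 + (real j)\<^sup>2)) \<le> 2 - 1 / real J"
  proof (induction J rule: dec_induct)
    case (step n)
    have "1 / (1 + (real (Suc n))\<^sup>2) \<le> 1 / (real n * real (Suc n))"
      using step.hyps
      by (intro divide_left_mono) (auto simp: power2_eq_square algebra_simps intro!: add_pos_nonneg mult_pos_pos)
    also have "\<dots> = 1 / real n - 1 / real (Suc n)" using step.hyps by (simp add: field_simps)
    finally show ?case using step.IH by simp
  qed simp
  moreover have "1 / real J \<ge> 0" by simp
  ultimately show ?thesis by linarith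
qed simp

lemma sum_inverse_one_plus_distance_square_le:
  fixes n :: nat
  assumes "finite A"
  shows "(\<Sum>m\<in>A. 1 / (1 + (real n - real m)\<^sup>2)) \<le> 5"
proof -
  let ?f = "\<lambda>m. 1 / (1 + (real n - real m)\<^sup>2)"
  obtain J where A_subset: "A \<subseteq> {..n + J}"
    using finite_nat_set_iff_bounded_le assms by (meson atMost_iff subsetI trans_le_add2)
  have "sum ?f A \<le> sum ?f {..n + J}" using A_subset by (intro sum_mono2) auto
  also have "{..n + J} = {..<n} \<union> {n} \<union> {n<..n + J}" by auto
  also have "sum ?f \<dots> = sum ?f {..<n} + 1 + sum ?f {n<..n + J}"
    by (subst sum.union_disjoint; force)+
  also have "sum ?f {..<n} = (\<Sum>j=1..n. 1 / (1 + (real j)\<^sup>2))"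
    by (rule sum.reindex_bij_witness[of _ "\<lambda>j. n - j" "\<lambda>m. n - m"]) (auto simp: of_nat_diff)
  also have "sum ?f {n<..n + J} = (\<Sum>j=1..J. 1 / (1 + (real j)\<^sup>2))"
    by (rule sum.reindex_bij_witness[of _ "\<lambda>j. n + j" "\<lambda>m. m - n"])
      (auto simp: of_nat_diff power2_commute)
  finally show ?thesis
    using sum_inverse_one_plus_square_le[of n] sum_inverse_one_plus_square_le[of J] by linarith
qed

lemma abs_diff_le_mult_abs_ln_diff:
  fixes x y X :: real
  assumes "0 < x" "0 < y" "x \<le> X" "y \<le> X"
  shows "\<bar>x - y\<bar> \<le> X * \<bar>ln x - ln y\<bar>"
  using assms
proof (induction x y rule: linorder_wlog)
  case (le x y)
  have "ln x - ln y \<le> (x - y) / y" using le by (intro ln_diff_le) auto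
  hence "y - x \<le> y * (ln y - ln x)" using le by (simp add: field_simps)
  also have "\<dots> \<le> X * (ln y - ln x)" using le by (intro mult_right_mono) auto
  finally show ?case using le by (simp add: abs_if)
next
  case (sym x y)
  thus ?case by (simp add: abs_minus_commute)
qed

lemma dirichlet_polynomial_mean_square:
  assumes "X \<ge> 1" "A \<subseteq> {1..X}"
  shows "integral {- real X..real X} (\<lambda>t. (cmod (\<Sum>n\<in>A. b n * cis (- (ln (real n) * t))))\<^sup>2)
           \<le> 400 / 3 * real X * (\<Sum>n\<in>A. (cmod (b n))\<^sup>2)"
proof -
  have finite_A: "finite A" using assms(2) finite_subset by blast
  interpret bounded_exp_transform "count_space A" b "\<lambda>n. ln (real n)" "\<Sum>n\<in>A. cmod (b n)"
    using finite_A member_le_sum[of _ A "\<lambda>n. cmod (b n)"]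
    by (intro bounded_exp_transform.intro bounded_exp_transform_axioms.intro finite_measure_count_space) auto
  have "(\<integral>m. 1 / (1 + (real X)\<^sup>2 * (ln (real n) - ln (real m))\<^sup>2) \<partial>count_space A) \<le> 5" if n_mem: "n \<in> A" for n
  proof -
    have "(\<integral>m. 1 / (1 + (real X)\<^sup>2 * (ln (real n) - ln (real m))\<^sup>2) \<partial>count_space A)
        \<le> (\<Sum>m\<in>A. 1 / (1 + (real n - real m)\<^sup>2))"
      unfolding lebesgue_integral_count_space_finite[OF finite_A]
    proof (rule sum_mono)
      fix m assume "m \<in> A"
      hence "\<bar>real n - real m\<bar> \<le> real X * \<bar>ln (real n) - ln (real m)\<bar>"
        using n_mem assms by (intro abs_diff_le_mult_abs_ln_diff) auto
      hence "\<bar>real n - real m\<bar>\<^sup>2 \<le> (real X * \<bar>ln (real n) - ln (real m)\<bar>)\<^sup>2" by (intro power_mono) auto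
      thus "1 / (1 + (real X)\<^sup>2 * (ln (real n) - ln (real m))\<^sup>2) \<le> 1 / (1 + (real n - real m)\<^sup>2)"
        by (intro divide_left_mono mult_pos_pos add_pos_nonneg) (auto simp: power_mult_distrib)
    qed
    also have "\<dots> \<le> 5" by (rule sum_inverse_one_plus_distance_square_le[OF finite_A])
    finally show ?thesis .
  qed
  from mean_square_le[OF _ this] show ?thesis
    using assms(1) by (simp add: exp_transform_count_space[OF finite_A]
      lebesgue_integral_count_space_finite[OF finite_A])
qed

text \<open>
  In the variable \<open>x = ln u\<close> the remainder of Euler summation is a Fourier integral of a sawtooth function,
  so that \<open>mean_square_le\<close> applies; the pointwise bound of this remainder would be too weak.
\<close>
definition sawtooth :: "real \<Rightarrow> real" where "sawtooth x = 1 - frac (exp x)"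

definition sawtooth_transform :: "nat \<Rightarrow> nat \<Rightarrow> complex \<Rightarrow> complex" where
  "sawtooth_transform X Z s =
     integral {ln (real X)..ln (real Z)} (\<lambda>x. of_real (sawtooth x) * exp (- s * of_real x))"

lemma sawtooth_bounds: "0 \<le> sawtooth x" "sawtooth x \<le> 1"
  using frac_lt_1[of "exp x"] frac_ge_0[of "exp x"] by (auto simp: sawtooth_def)

lemma borel_measurable_sawtooth [measurable]: "sawtooth \<in> borel_measurable borel"
  unfolding sawtooth_def[abs_def] frac_def by measurable

lemma sawtooth_eq:
  assumes "n \<ge> 1" "ln (real n) \<le> x" "x < ln (real (Suc n))"
  shows "sawtooth x = real (Suc n) - exp x"
proof -
  have "exp (ln (real n)) \<le> exp x" "exp x < exp (ln (real (Suc n)))"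
    using assms(2,3) by (simp_all only: exp_le_cancel_iff exp_less_cancel_iff)
  hence "\<lfloor>exp x\<rfloor> = int n" using assms(1) by (intro floor_unique) auto
  thus ?thesis by (simp add: sawtooth_def frac_def)
qed

lemma has_integral_linear_minus_exp_mult_exp:
  fixes c s :: complex and a b :: real
  assumes "s \<noteq> 1" "a \<le> b"
  defines "\<Phi> \<equiv> \<lambda>x::real. - (c * exp (- s * of_real x)) - s * exp ((1 - s) * of_real x) / (1 - s)"
  shows "((\<lambda>x. s * ((c - exp (of_real x)) * exp (- s * of_real x))) has_integral (\<Phi> b - \<Phi> a)) {a..b}"
proof -
  let ?\<Phi> = "\<lambda>z. - (c * exp (- s * z)) - s * exp ((1 - s) * z) / (1 - s)"
  have "(?\<Phi> has_field_derivative (s * ((c - exp z) * exp (- s * z)))) (at z)" for z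
  proof -
    have "(?\<Phi> has_field_derivative
        (- (c * (exp (- s * z) * (- s))) - s * (exp ((1 - s) * z) * (1 - s)) / (1 - s))) (at z)"
      by (auto intro!: derivative_eq_intros)
    also have "(1 - s) * z = z + - s * z" by (simp add: algebra_simps)
    also have "exp (z + - s * z) = exp z * exp (- s * z)" by (rule exp_add)
    also have "- (c * (exp (- s * z) * (- s))) - s * (exp z * exp (- s * z) * (1 - s)) / (1 - s)
        = s * ((c - exp z) * exp (- s * z))"
      using assms(1) by simp (simp add: algebra_simps)
    finally show ?thesis .
  qed
  thus ?thesis unfolding \<Phi>_def using assms(2)
    by (intro fundamental_theorem_of_calculus has_vector_derivative_real_field) auto
qed

lemma powr_taylor_rem_1_has_integral:
  assumes "n \<ge> 1" "s \<noteq> 1"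
  shows "((\<lambda>x. s * (of_real (sawtooth x) * exp (- s * of_real x))) has_integral
            (powr_taylor_rem 1 n (1 - s) / (s - 1))) {ln (real n)..ln (real (Suc n))}"
proof -
  let ?a = "ln (real n)" and ?b = "ln (real (Suc n))"
  define \<Phi> where "\<Phi> = (\<lambda>x::real. - (of_nat (Suc n) * exp (- s * of_real x))
    - s * exp ((1 - s) * of_real x) / (1 - s))"
  have "((\<lambda>x. s * ((of_nat (Suc n) - exp (of_real x)) * exp (- s * of_real x))) has_integral (\<Phi> ?b - \<Phi> ?a))
    {?a..?b}"
    unfolding \<Phi>_def using assms by (intro has_integral_linear_minus_exp_mult_exp) auto
  hence "((\<lambda>x. s * (of_real (sawtooth x) * exp (- s * of_real x))) has_integral (\<Phi> ?b - \<Phi> ?a)) {?a..?b}"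
  proof (rule has_integral_spike_finite[of "{?b}", rotated -1])
    fix x assume "x \<in> {?a..?b} - {?b}"
    hence "sawtooth x = real (Suc n) - exp x" using assms by (intro sawtooth_eq) auto
    thus "s * (of_real (sawtooth x) * exp (- s * of_real x))
        = s * ((of_nat (Suc n) - exp (of_real x)) * exp (- s * of_real x))"
      by (simp add: exp_of_real)
  qed simp
  also have "\<Phi> ?b - \<Phi> ?a = powr_taylor_rem 1 n (1 - s) / (s - 1)"
  proof -
    define p q r :: complex where "p = of_nat (Suc n) powr (1 - s)" and "q = of_nat n powr (1 - s)"
      and "r = of_nat n powr (- s)"
    have "of_nat (Suc n) * of_nat (Suc n) powr (- s) = p"
      using powr_add[of "of_nat (Suc n) :: complex" 1 "- s"] by (simp add: p_def powr_one' del: of_nat_Suc)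
    moreover have "1 \<le> Suc n" by simp
    ultimately have "\<Phi> ?b = - p - s * p / (1 - s)"
      unfolding \<Phi>_def by (simp only: nat_powr_eq_exp[symmetric] p_def)
    moreover have "of_nat n * r = q"
      using assms powr_add[of "of_nat n :: complex" 1 "- s"] by (simp add: q_def r_def)
    hence "\<Phi> ?a = - (q + r) - s * q / (1 - s)"
      unfolding \<Phi>_def nat_powr_eq_exp[OF assms(1), symmetric] by (simp add: q_def r_def algebra_simps)
    moreover have "(- p - s * p / (1 - s)) - (- (q + r) - s * q / (1 - s)) = (p - q - (1 - s) * r) / (s - 1)"
      using assms by (simp add: divide_simps) algebra
    ultimately show ?thesis unfolding powr_taylor_rem_1 p_def q_def r_def by (simp only:)
  qed
  finally show ?thesis .
qed

lemma sum_powr_taylor_rem_1_eq: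
  assumes "X \<ge> 1" "s \<noteq> 1" "X \<le> Z"
  shows "(\<Sum>n=X..<Z. powr_taylor_rem 1 n (1 - s)) / (s - 1) = s * sawtooth_transform X Z s"
proof -
  have "((\<lambda>x. s * (of_real (sawtooth x) * exp (- s * of_real x))) has_integral
      ((\<Sum>n=X..<Z. powr_taylor_rem 1 n (1 - s)) / (s - 1))) {ln (real X)..ln (real Z)}"
    using assms(3)
  proof (induction Z rule: dec_induct)
    case base
    show ?case using has_integral_refl(2)[of _ "ln (real X)"] by simp
  next
    case (step Z)
    have "((\<lambda>x. s * (of_real (sawtooth x) * exp (- s * of_real x))) has_integral
        ((\<Sum>n=X..<Z. powr_taylor_rem 1 n (1 - s)) / (s - 1) + powr_taylor_rem 1 Z (1 - s) / (s - 1)))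
        {ln (real X)..ln (real (Suc Z))}"
      using step assms by (intro has_integral_combine[OF _ _ step.IH powr_taylor_rem_1_has_integral]) auto
    thus ?case using step.hyps by (simp add: add_divide_distrib)
  qed
  from integral_unique[OF this] show ?thesis by (simp add: sawtooth_transform_def)
qed

lemma integral_inverse_one_plus_square_le:
  fixes T x a b :: real
  assumes "T > 0" "a \<le> b"
  shows "integral {a..b} (\<lambda>y. 1 / (1 + T\<^sup>2 * (x - y)\<^sup>2)) \<le> 4 / T"
proof -
  have "((\<lambda>y. arctan (T * (y - x)) / T) has_vector_derivative 1 / (1 + T\<^sup>2 * (x - y)\<^sup>2)) (at y within {a..b})" for y
  proof -
    have "((\<lambda>y. arctan (T * (y - x)) / T) has_field_derivative
        (inverse (1 + (T * (y - x))\<^sup>2) * T / T)) (at y within {a..b})"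
      by (auto intro!: derivative_eq_intros)
    thus ?thesis using assms
      by (simp add: has_real_derivative_iff_has_vector_derivative power_mult_distrib inverse_eq_divide
        power2_commute)
  qed
  hence "integral {a..b} (\<lambda>y. 1 / (1 + T\<^sup>2 * (x - y)\<^sup>2)) = arctan (T * (b - x)) / T - arctan (T * (a - x)) / T"
    using assms by (intro integral_unique fundamental_theorem_of_calculus) auto
  also have "\<dots> \<le> 4 / T"
    using arctan_ubound[of "T * (b - x)"] arctan_lbound[of "T * (a - x)"] pi_less_4 assms
    by (simp add: divide_right_mono flip: diff_divide_distrib)
  finally show ?thesis .
qed

lemma integral_exp_neg_le:
  fixes a b c :: real
  assumes "c > 0" "a \<le> b"
  shows "integral {a..b} (\<lambda>x. exp (- c * x)) \<le> exp (- c * a) / c"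
proof -
  have "((\<lambda>x. - exp (- c * x) / c) has_vector_derivative exp (- c * x)) (at x within {a..b})" for x
    using assms by (auto intro!: derivative_eq_intros simp flip: has_real_derivative_iff_has_vector_derivative)
  hence "integral {a..b} (\<lambda>x. exp (- c * x)) = - exp (- c * b) / c - (- exp (- c * a) / c)"
    using assms(2) by (intro integral_unique fundamental_theorem_of_calculus) auto
  also have "\<dots> \<le> exp (- c * a) / c" using assms(1) by simp
  finally show ?thesis .
qed

definition sawtooth_coeff :: "real \<Rightarrow> real \<Rightarrow> complex" where
  "sawtooth_coeff \<sigma> x = of_real (sawtooth x * exp (- \<sigma> * x))"

lemma norm_sawtooth_coeff_le: "cmod (sawtooth_coeff \<sigma> x) \<le> exp (- \<sigma> * x)"
  using sawtooth_bounds[of x] by (simp add: sawtooth_coeff_def norm_mult mult_left_le_one_le)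

lemma bounded_exp_transform_sawtooth_coeff:
  assumes "0 \<le> a" "0 \<le> \<sigma>"
  shows "bounded_exp_transform (lborel_on a b) (sawtooth_coeff \<sigma>) (\<lambda>x. x) 1"
proof (intro bounded_exp_transform.intro bounded_exp_transform_axioms.intro finite_measure_lborel_on)
  note [measurable] = borel_measurable_lborel_on_id
  have [measurable]: "sawtooth \<in> borel_measurable (lborel_on a b)"
    by (rule measurable_restrict_space1) simp
  show "sawtooth_coeff \<sigma> \<in> borel_measurable (lborel_on a b)"
    unfolding sawtooth_coeff_def[abs_def] by measurable
  fix x assume "x \<in> space (lborel_on a b)"
  hence "0 \<le> \<sigma> * x" using assms by (auto simp: space_restrict_space)
  thus "cmod (sawtooth_coeff \<sigma> x) \<le> 1" using norm_sawtooth_coeff_le[of \<sigma> x] by (auto intro: order_trans)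
qed (rule borel_measurable_lborel_on_id)

lemma exp_transform_sawtooth_coeff:
  assumes "1 \<le> X" "0 \<le> \<sigma>"
  shows "exp_transform (lborel_on (ln (real X)) (ln (real Z))) (sawtooth_coeff \<sigma>) (\<lambda>x. x) t
           = sawtooth_transform X Z (Complex \<sigma> t)"
proof -
  interpret bounded_exp_transform "lborel_on (ln (real X)) (ln (real Z))" "sawtooth_coeff \<sigma>" "\<lambda>x. x" 1
    using assms by (intro bounded_exp_transform_sawtooth_coeff) auto
  have "- Complex \<sigma> t * of_real x = of_real (- \<sigma> * x) + \<i> * of_real (- (x * t))" for x
    by (simp add: complex_eq_iff)
  hence "exp (- Complex \<sigma> t * of_real x) = of_real (exp (- \<sigma> * x)) * cis (- (x * t))" for x
    by (simp only: exp_add cis_conv_exp exp_of_real)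
  hence "sawtooth_coeff \<sigma> x * cis (- (x * t)) = of_real (sawtooth x) * exp (- Complex \<sigma> t * of_real x)" for x
    by (simp add: sawtooth_coeff_def)
  thus ?thesis unfolding exp_transform_def sawtooth_transform_def
    using lborel_on_integral(2)[OF integrable_mult_cis, of t] by (simp only:)
qed

lemma integral_sawtooth_coeff_square_le:
  assumes "\<sigma> \<ge> 1 / 2" "a \<le> b"
  shows "(\<integral>x. (cmod (sawtooth_coeff \<sigma> x))\<^sup>2 \<partial>lborel_on a b) \<le> exp (- (2 * \<sigma>) * a)"
proof -
  have "(\<integral>x. (cmod (sawtooth_coeff \<sigma> x))\<^sup>2 \<partial>lborel_on a b) \<le> (\<integral>x. exp (- (2 * \<sigma>) * x) \<partial>lborel_on a b)"
  proof (rule integral_mono')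
    fix x
    have "(cmod (sawtooth_coeff \<sigma> x))\<^sup>2 \<le> (exp (- \<sigma> * x))\<^sup>2"
      using norm_sawtooth_coeff_le by (intro power_mono) auto
    thus "(cmod (sawtooth_coeff \<sigma> x))\<^sup>2 \<le> exp (- (2 * \<sigma>) * x)"
      by (simp add: power2_eq_square algebra_simps flip: exp_add)
  qed (auto intro!: integrable_lborel_on_continuous continuous_intros)
  also have "\<dots> = integral {a..b} (\<lambda>x. exp (- (2 * \<sigma>) * x))"
    by (intro lborel_on_integral_continuous continuous_intros)
  also have "\<dots> \<le> exp (- (2 * \<sigma>) * a) / (2 * \<sigma>)" using assms by (intro integral_exp_neg_le) auto
  also have "\<dots> \<le> exp (- (2 * \<sigma>) * a)" using assms by (simp add: divide_le_eq)
  finally show ?thesis .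
qed

lemma sawtooth_transform_mean_square:
  fixes X Z :: nat
  assumes "X \<ge> 1" "Z \<ge> X" "\<sigma> \<ge> 1 / 2"
  shows "(\<lambda>t. (cmod (sawtooth_transform X Z (Complex \<sigma> t)))\<^sup>2) integrable_on {- real X..real X}"
    and "integral {- real X..real X} (\<lambda>t. (cmod (sawtooth_transform X Z (Complex \<sigma> t)))\<^sup>2)
           \<le> 320 / 3 * real X powr (-(2 * \<sigma>))"
proof -
  let ?a = "ln (real X)" and ?b = "ln (real Z)"
  have X_bounds: "real X > 0" "0 \<le> ?a" "?a \<le> ?b" using assms by auto
  interpret bounded_exp_transform "lborel_on ?a ?b" "sawtooth_coeff \<sigma>" "\<lambda>x. x" 1
    using X_bounds assms by (intro bounded_exp_transform_sawtooth_coeff) auto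
  have transform: "exp_transform (lborel_on ?a ?b) (sawtooth_coeff \<sigma>) (\<lambda>x. x) t
      = sawtooth_transform X Z (Complex \<sigma> t)" for t
    using assms by (intro exp_transform_sawtooth_coeff) auto
  show "(\<lambda>t. (cmod (sawtooth_transform X Z (Complex \<sigma> t)))\<^sup>2) integrable_on {- real X..real X}"
    using mean_square_integrable unfolding transform .
  have "(\<integral>y. 1 / (1 + (real X)\<^sup>2 * (x - y)\<^sup>2) \<partial>lborel_on ?a ?b) \<le> 4 / real X" for x
  proof -
    have "continuous_on {?a..?b} (\<lambda>y. 1 / (1 + (real X)\<^sup>2 * (x - y)\<^sup>2))"
      by (intro continuous_intros) (auto simp: add_nonneg_eq_0_iff)
    thus ?thesis using integral_inverse_one_plus_square_le[OF X_bounds(1,3)] lborel_on_integral_continuous by metis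
  qed
  from mean_square_le[OF X_bounds(1) this]
  have "integral {- real X..real X} (\<lambda>t. (cmod (sawtooth_transform X Z (Complex \<sigma> t)))\<^sup>2)
      \<le> 80 / 3 * real X * (4 / real X) * (\<integral>x. (cmod (sawtooth_coeff \<sigma> x))\<^sup>2 \<partial>lborel_on ?a ?b)"
    unfolding transform by blast
  also have "\<dots> \<le> 320 / 3 * exp (- (2 * \<sigma>) * ?a)"
    using integral_sawtooth_coeff_square_le[OF assms(3) X_bounds(3)] X_bounds(1) by simp
  also have "exp (- (2 * \<sigma>) * ?a) = real X powr (-(2 * \<sigma>))" using X_bounds(1) by (simp add: powr_def)
  finally show "integral {- real X..real X} (\<lambda>t. (cmod (sawtooth_transform X Z (Complex \<sigma> t)))\<^sup>2)
      \<le> 320 / 3 * real X powr (-(2 * \<sigma>))" .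
qed

lemma zeta_minus_dirichlet_polynomial_eq:
  assumes "Re s > 0" "s \<noteq> 1" "1 \<le> Y" "Y \<le> X" "X \<le> Z"
  shows "zeta s - (\<Sum>n=1..<Y. of_nat n powr (-s)) =
    ((\<Sum>n=Y..<X. of_nat n powr (-s)) + of_nat X powr (1 - s) / (s - 1))
      + (s * sawtooth_transform X Z s + (\<Sum>n. powr_taylor_rem 1 (n + Z) (1 - s)) / (s - 1))"
proof -
  have "(\<Sum>n. powr_taylor_rem 1 (n + X) (1 - s))
      = (\<Sum>n. powr_taylor_rem 1 (n + (Z - X) + X) (1 - s)) + (\<Sum>n<Z-X. powr_taylor_rem 1 (n + X) (1 - s))"
    using assms by (intro suminf_split_initial_segment summable_powr_taylor_rem) auto
  also have "(\<Sum>n<Z-X. powr_taylor_rem 1 (n + X) (1 - s)) = (\<Sum>n=X..<Z. powr_taylor_rem 1 n (1 - s))"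
    by (rule sum.reindex_bij_witness[of _ "\<lambda>n. n - X" "\<lambda>n. n + X"]) auto
  finally have "(\<Sum>n. powr_taylor_rem 1 (n + X) (1 - s)) / (s - 1)
      = (\<Sum>n. powr_taylor_rem 1 (n + Z) (1 - s)) / (s - 1) + s * sawtooth_transform X Z s"
    using assms sum_powr_taylor_rem_1_eq[of X s Z] by (simp add: add_divide_distrib)
  moreover have "(\<Sum>n=1..<X. of_nat n powr (-s)) = (\<Sum>n=1..<Y. of_nat n powr (-s)) + (\<Sum>n=Y..<X. of_nat n powr (-s))"
    using assms by (simp add: sum.atLeastLessThan_concat)
  ultimately show ?thesis using zeta_euler_summation[of s X] assms by simp
qed

lemma norm_powr_taylor_rem_tail_le:
  assumes "0 < \<sigma>0" "\<sigma>0 \<le> Re s" "Re s \<le> 3" "s \<noteq> 1" "Z \<ge> 1"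
  shows "cmod ((\<Sum>n. powr_taylor_rem 1 (n + Z) (1 - s)) / (s - 1))
           \<le> 16 * cmod s * powr_tail (\<sigma>0 + 1) Z"
proof -
  let ?C = "cmod (s - 1) * (16 * cmod s)"
  have powr_summable: "summable (\<lambda>n. real (n + Z) powr (- (\<sigma>0 + 1)))"
    using assms by (intro summable_shifted_powr) auto
  have "cmod (powr_taylor_rem 1 (n + Z) (1 - s)) \<le> ?C * real (n + Z) powr (- (\<sigma>0 + 1))" for n
  proof -
    have norm_choose: "real (Suc 1) * cmod ((1 - s) gchoose Suc 1) = cmod (s - 1) * cmod s"
      by (simp add: gbinomial_prod_rev numeral_2_eq_2 norm_mult norm_divide norm_minus_commute)
    have "2 powr \<bar>Re (1 - s) - real (Suc 1)\<bar> \<le> (2::real) powr 4" using assms by (intro powr_mono) auto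
    moreover have "real (n + Z) powr (Re (1 - s) - real (Suc 1)) \<le> real (n + Z) powr (- (\<sigma>0 + 1))"
      using assms by (intro powr_mono) auto
    ultimately have "cmod (s - 1) * cmod s * 2 powr \<bar>Re (1 - s) - real (Suc 1)\<bar>
          * real (n + Z) powr (Re (1 - s) - real (Suc 1))
        \<le> cmod (s - 1) * cmod s * 2 powr 4 * real (n + Z) powr (- (\<sigma>0 + 1))"
      by (intro mult_mono mult_left_mono) auto
    thus ?thesis
      using norm_powr_taylor_rem_le[of "n + Z" 1 "1 - s", unfolded norm_choose] assms by (simp add: mult_ac)
  qed
  hence "cmod (\<Sum>n. powr_taylor_rem 1 (n + Z) (1 - s)) \<le> (\<Sum>n. ?C * real (n + Z) powr (- (\<sigma>0 + 1)))"
    using powr_summable by (intro norm_suminf_le summable_mult)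
  also have "\<dots> = ?C * powr_tail (\<sigma>0 + 1) Z"
    unfolding powr_tail_def by (rule suminf_mult[OF powr_summable])
  finally show ?thesis using assms by (simp add: norm_divide divide_le_eq mult_ac)
qed

lemma norm_zeta_minus_dirichlet_polynomial_square_le:
  fixes \<sigma>0 \<sigma> t :: real and X Y Z :: nat
  defines "s \<equiv> Complex \<sigma> t"
  assumes \<sigma>_bounds: "0 < \<sigma>0" "\<sigma>0 \<le> \<sigma>" "\<sigma> \<le> 3" and order_XYZ: "1 \<le> Y" "Y \<le> X" "X \<le> Z"
    and t_bounds: "1 \<le> t" "t \<le> real X"
    and tail: "powr_tail (\<sigma>0 + 1) Z \<le> 1 / (64 * (real X)\<^sup>2)"
  shows "(cmod (zeta s - (\<Sum>n=1..<Y. of_nat n powr (-s))))\<^sup>2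
    \<le> 4 * (cmod (\<Sum>n=Y..<X. of_nat n powr (-s)))\<^sup>2 + 4 * real X powr (2 - 2 * \<sigma>0) * (1 / t\<^sup>2)
      + 64 * (real X)\<^sup>2 * (cmod (sawtooth_transform X Z s))\<^sup>2 + 4 * (1 / (real X)\<^sup>2)"
proof -
  define A B J R where "A = (\<Sum>n=Y..<X. of_nat n powr (-s) :: complex)"
    and "B = of_nat X powr (1 - s) / (s - 1)" and "J = sawtooth_transform X Z s"
    and "R = (\<Sum>n. powr_taylor_rem 1 (n + Z) (1 - s)) / (s - 1)"
  have X_ge_1: "real X \<ge> 1" using order_XYZ by simp
  have s_props: "Re s > 0" "s \<noteq> 1" using \<sigma>_bounds t_bounds by (auto simp: s_def complex_eq_iff)
  have norm_s: "cmod s \<le> 4 * real X" "t \<le> cmod (s - 1)"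
    using cmod_le[of s] abs_Im_le_cmod[of "s - 1"] \<sigma>_bounds t_bounds X_ge_1 by (auto simp: s_def)
  have "cmod B = real X powr (1 - \<sigma>) / cmod (s - 1)" by (simp add: B_def s_def norm_divide)
  also have "\<dots> \<le> real X powr (1 - \<sigma>0) / t" using norm_s t_bounds X_ge_1 \<sigma>_bounds by (intro frac_le powr_mono) auto
  finally have "(cmod B)\<^sup>2 \<le> (real X powr (1 - \<sigma>0) / t)\<^sup>2" by (intro power_mono) auto
  also have "\<dots> = real X powr (2 - 2 * \<sigma>0) * (1 / t\<^sup>2)"
    by (simp add: power_divide power2_eq_square[of "real X powr (1 - \<sigma>0)"] flip: powr_add)
  finally have B_le: "(cmod B)\<^sup>2 \<le> real X powr (2 - 2 * \<sigma>0) * (1 / t\<^sup>2)" .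
  have "(cmod (s * J))\<^sup>2 = (cmod s)\<^sup>2 * (cmod J)\<^sup>2" by (simp add: norm_mult power_mult_distrib)
  also have "\<dots> \<le> (4 * real X)\<^sup>2 * (cmod J)\<^sup>2" using norm_s by (intro mult_right_mono power_mono) auto
  finally have J_le: "(cmod (s * J))\<^sup>2 \<le> 16 * (real X)\<^sup>2 * (cmod J)\<^sup>2" by (simp add: power_mult_distrib)
  have "cmod R \<le> 16 * cmod s * powr_tail (\<sigma>0 + 1) Z"
    unfolding R_def using s_props \<sigma>_bounds order_XYZ by (intro norm_powr_taylor_rem_tail_le) (auto simp: s_def)
  also have "\<dots> \<le> 16 * (4 * real X) * (1 / (64 * (real X)\<^sup>2))"
    using norm_s \<sigma>_bounds by (intro mult_mono tail powr_tail_nonneg) auto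
  also have "\<dots> = 1 / real X" using X_ge_1 by (simp add: power2_eq_square)
  finally have "(cmod R)\<^sup>2 \<le> (1 / real X)\<^sup>2" by (intro power_mono) auto
  hence R_le: "(cmod R)\<^sup>2 \<le> 1 / (real X)\<^sup>2" by (simp add: power_divide)
  have "zeta s - (\<Sum>n=1..<Y. of_nat n powr (-s)) = (A + B) + (s * J + R)"
    unfolding A_def B_def J_def R_def by (rule zeta_minus_dirichlet_polynomial_eq[OF s_props order_XYZ])
  thus ?thesis
    using norm_add_square_le[of "A + B" "s * J + R"] norm_add_square_le[of A B]
      norm_add_square_le[of "s * J" R] B_le J_le R_le
    by (simp add: A_def[symmetric] J_def[symmetric])
qed

lemma continuous_on_zeta_vertical: "0 < a \<Longrightarrow> continuous_on {a..b} (\<lambda>t. zeta (Complex \<sigma> t))"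
  unfolding Complex_eq
  by (intro continuous_intros continuous_on_compose2[OF holomorphic_on_imp_continuous_on[OF holomorphic_zeta]])
    (auto simp: complex_eq_iff)

lemma continuous_on_nat_powr_vertical:
  "n \<ge> 1 \<Longrightarrow> continuous_on A (\<lambda>t. of_nat n powr (- Complex \<sigma> t) :: complex)"
  unfolding Complex_eq by (simp only: nat_powr_eq_exp) (intro continuous_intros)

lemma nat_powr_vertical:
  "n \<ge> 1 \<Longrightarrow> of_nat n powr (- Complex \<sigma> t) = of_real (real n powr (-\<sigma>)) * cis (- (ln (real n) * t))"
  by (simp add: nat_powr_eq_exp powr_def cis_conv_exp Complex_eq algebra_simps flip: exp_of_real exp_add)

lemma has_integral_inverse_square:
  fixes a b :: real
  assumes "0 < a" "a \<le> b"
  shows "((\<lambda>t. 1 / t\<^sup>2) has_integral (1 / a - 1 / b)) {a..b}"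
proof -
  have "((\<lambda>t. - (1 / t)) has_vector_derivative 1 / t\<^sup>2) (at t within {a..b})" if "t \<in> {a..b}" for t
    using assms that unfolding has_real_derivative_iff_has_vector_derivative[symmetric]
    by (auto intro!: derivative_eq_intros simp: power2_eq_square)
  from fundamental_theorem_of_calculus[OF assms(2) this] show ?thesis by simp
qed

lemma dirichlet_polynomial_vertical_mean_square:
  fixes \<sigma>0 \<sigma> :: real and X Y :: nat
  assumes "\<sigma>0 \<le> \<sigma>" "1 \<le> Y" "1 \<le> X"
  defines "A \<equiv> \<lambda>t. (cmod (\<Sum>n=Y..<X. of_nat n powr (- Complex \<sigma> t)))\<^sup>2"
  shows "A integrable_on {1..real X}"
    and "integral {1..real X} A \<le> 400 / 3 * real X * (\<Sum>n=Y..<X. real n powr (-(2 * \<sigma>0)))"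
proof -
  have "A integrable_on {- real X..real X}" unfolding A_def using assms
    by (intro integrable_continuous_interval continuous_intros continuous_on_nat_powr_vertical) auto
  from integral_subinterval_le[OF this, of 1 "real X"]
  have A_props: "A integrable_on {1..real X}" "integral {1..real X} A \<le> integral {- real X..real X} A"
    by (auto simp: A_def)
  show "A integrable_on {1..real X}" by (rule A_props(1))
  have "X \<ge> 1" "{Y..<X} \<subseteq> {1..X}" using assms by auto
  hence "integral {1..real X} A \<le> 400 / 3 * real X * (\<Sum>n=Y..<X. (cmod (of_real (real n powr (-\<sigma>)) :: complex))\<^sup>2)"
    using A_props(2) dirichlet_polynomial_mean_square[of X "{Y..<X}" "\<lambda>n. of_real (real n powr (-\<sigma>))"] assms
    by (simp add: A_def nat_powr_vertical)
  also have "\<dots> \<le> 400 / 3 * real X * (\<Sum>n=Y..<X. real n powr (-(2 * \<sigma>0)))"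
    using assms(1-3)
    by (intro mult_left_mono sum_mono) (auto simp: power2_eq_square simp flip: powr_add intro!: powr_mono)
  finally show "integral {1..real X} A \<le> 400 / 3 * real X * (\<Sum>n=Y..<X. real n powr (-(2 * \<sigma>0)))" .
qed

lemma sawtooth_transform_one_sided_mean_square:
  fixes \<sigma>0 \<sigma> :: real and X Z :: nat
  assumes "1 / 2 \<le> \<sigma>0" "\<sigma>0 \<le> \<sigma>" "1 \<le> X" "X \<le> Z"
  defines "J \<equiv> \<lambda>t. (cmod (sawtooth_transform X Z (Complex \<sigma> t)))\<^sup>2"
  shows "J integrable_on {1..real X}"
    and "(real X)\<^sup>2 * integral {1..real X} J \<le> 320 / 3 * real X powr (2 - 2 * \<sigma>0)"
proof -
  have J_props: "J integrable_on {1..real X}" "integral {1..real X} J \<le> 320 / 3 * real X powr (-(2 * \<sigma>))"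
    using integral_subinterval_le[of J "- real X" "real X" 1 "real X"]
      sawtooth_transform_mean_square[of X Z \<sigma>] assms
    by (auto simp: J_def)
  show "J integrable_on {1..real X}" by (rule J_props(1))
  have "(real X)\<^sup>2 * integral {1..real X} J \<le> 320 / 3 * real X powr (2 - 2 * \<sigma>)"
    using mult_left_mono[OF J_props(2), of "(real X)\<^sup>2"] assms(3) by (simp add: powr_diff powr_minus field_simps)
  also have "\<dots> \<le> 320 / 3 * real X powr (2 - 2 * \<sigma>0)"
    using assms(2,3) by (intro mult_left_mono powr_mono) auto
  finally show "(real X)\<^sup>2 * integral {1..real X} J \<le> 320 / 3 * real X powr (2 - 2 * \<sigma>0)" .
qed

lemma zeta_minus_dirichlet_polynomial_integral_le:
  fixes \<sigma>0 \<sigma> :: real and X Y Z :: nat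
  assumes \<sigma>_bounds: "1 / 2 \<le> \<sigma>0" "\<sigma>0 < 1" "\<sigma>0 \<le> \<sigma>" "\<sigma> \<le> 3" and order_YX: "1 \<le> Y" "Y \<le> X"
    and Z_bounds: "X \<le> Z" "powr_tail (\<sigma>0 + 1) Z \<le> 1 / (64 * (real X)\<^sup>2)"
  shows "integral {1..real X} (\<lambda>t. (cmod (zeta (Complex \<sigma> t) - (\<Sum>n=1..<Y. of_nat n powr (- Complex \<sigma> t))))\<^sup>2)
    \<le> 4 * integral {1..real X} (\<lambda>t. (cmod (\<Sum>n=Y..<X. of_nat n powr (- Complex \<sigma> t)))\<^sup>2)
      + 4 * real X powr (2 - 2 * \<sigma>0)
      + 64 * (real X)\<^sup>2 * integral {1..real X} (\<lambda>t. (cmod (sawtooth_transform X Z (Complex \<sigma> t)))\<^sup>2) + 4"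
proof -
  let ?f = "\<lambda>t. (cmod (zeta (Complex \<sigma> t) - (\<Sum>n=1..<Y. of_nat n powr (- Complex \<sigma> t))))\<^sup>2"
  define P where "P = real X powr (2 - 2 * \<sigma>0)"
  define A J where "A = (\<lambda>t. (cmod (\<Sum>n=Y..<X. of_nat n powr (- Complex \<sigma> t)))\<^sup>2)"
    and "J = (\<lambda>t. (cmod (sawtooth_transform X Z (Complex \<sigma> t)))\<^sup>2)"
  have X_ge_1: "real X \<ge> 1" using order_YX by simp
  have integrable_A: "A integrable_on {1..real X}"
    unfolding A_def using dirichlet_polynomial_vertical_mean_square(1)[of \<sigma>0 \<sigma> Y X] \<sigma>_bounds order_YX by auto
  have integrable_J: "J integrable_on {1..real X}"
    unfolding J_def using sawtooth_transform_one_sided_mean_square(1)[of \<sigma>0 \<sigma> X Z] \<sigma>_bounds order_YX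
      Z_bounds by auto
  have "integral {1..real X} ?f \<le> 4 * integral {1..real X} A + 4 * P * (1 / 1 - 1 / real X)
      + 64 * (real X)\<^sup>2 * integral {1..real X} J + (real X - 1) * (4 * (1 / (real X)\<^sup>2))"
  proof (rule has_integral_le[OF integrable_integral])
    show "?f integrable_on {1..real X}"
      by (intro integrable_continuous_interval continuous_intros continuous_on_zeta_vertical
          continuous_on_nat_powr_vertical) auto
    show "((\<lambda>t. 4 * A t + 4 * P * (1 / t\<^sup>2) + 64 * (real X)\<^sup>2 * J t + 4 * (1 / (real X)\<^sup>2)) has_integral
        (4 * integral {1..real X} A + 4 * P * (1 / 1 - 1 / real X) + 64 * (real X)\<^sup>2 * integral {1..real X} J
        + (real X - 1) * (4 * (1 / (real X)\<^sup>2)))) {1..real X}"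
      using has_integral_const_real[of "4 * (1 / (real X)\<^sup>2)" 1 "real X"] X_ge_1
      by (intro has_integral_add has_integral_mult_right integrable_integral integrable_A integrable_J
        has_integral_inverse_square) auto
  qed (use norm_zeta_minus_dirichlet_polynomial_square_le[of \<sigma>0 \<sigma> Y X Z] \<sigma>_bounds order_YX Z_bounds
    in \<open>auto simp: A_def J_def P_def\<close>)
  moreover have "4 * P * (1 / 1 - 1 / real X) \<le> 4 * P * 1" by (intro mult_left_mono) (auto simp: P_def)
  moreover have "real X - 1 \<le> (real X)\<^sup>2" using self_le_power[OF X_ge_1, of 2] by linarith
  hence "(real X - 1) * (4 * (1 / (real X)\<^sup>2)) \<le> 4" using X_ge_1 by (simp add: divide_le_eq)
  ultimately show ?thesis unfolding A_def J_def P_def by linarith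
qed

lemma zeta_mean_square:
  fixes \<sigma>0 \<sigma> :: real and X Y :: nat
  assumes \<sigma>_bounds: "1 / 2 \<le> \<sigma>0" "\<sigma>0 < 1" "\<sigma>0 \<le> \<sigma>" "\<sigma> \<le> 3" and order_YX: "1 \<le> Y" "Y \<le> X"
  shows "integral {1..real X} (\<lambda>t. (cmod (zeta (Complex \<sigma> t) - (\<Sum>n=1..<Y. of_nat n powr (- Complex \<sigma> t))))\<^sup>2)
           \<le> 8000 * (real X * (\<Sum>n=Y..<X. real n powr (-(2 * \<sigma>0))) + real X powr (2 - 2 * \<sigma>0))"
proof -
  define P where "P = real X powr (2 - 2 * \<sigma>0)"
  define \<Sigma> where "\<Sigma> = (\<Sum>n=Y..<X. real n powr (-(2 * \<sigma>0)))"
  have X_ge_1: "real X \<ge> 1" using order_YX by simp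
  have P_ge_1: "P \<ge> 1" unfolding P_def using X_ge_1 \<sigma>_bounds by (intro ge_one_powr_ge_zero) auto
  have "\<forall>\<^sub>F Z in sequentially. X \<le> Z \<and> powr_tail (\<sigma>0 + 1) Z < 1 / (64 * (real X)\<^sup>2)"
    using powr_tail_tendsto_0[of "\<sigma>0 + 1"] X_ge_1 \<sigma>_bounds
    by (intro eventually_conj eventually_ge_at_top order_tendstoD) auto
  from eventually_happens'[OF sequentially_bot this]
  obtain Z where Z_bounds: "X \<le> Z" "powr_tail (\<sigma>0 + 1) Z \<le> 1 / (64 * (real X)\<^sup>2)"
    by (elim exE conjE) (blast intro: less_imp_le)
  have "integral {1..real X} (\<lambda>t. (cmod (\<Sum>n=Y..<X. of_nat n powr (- Complex \<sigma> t)))\<^sup>2) \<le> 400 / 3 * (real X * \<Sigma>)"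
    unfolding \<Sigma>_def using dirichlet_polynomial_vertical_mean_square(2)[of \<sigma>0 \<sigma> Y X] \<sigma>_bounds order_YX by auto
  moreover have "64 * (real X)\<^sup>2 * integral {1..real X} (\<lambda>t. (cmod (sawtooth_transform X Z (Complex \<sigma> t)))\<^sup>2)
      \<le> 64 * (320 / 3 * P)"
    unfolding P_def mult.assoc using sawtooth_transform_one_sided_mean_square(2)[of \<sigma>0 \<sigma> X Z] \<sigma>_bounds
      order_YX Z_bounds
    by (intro mult_left_mono) auto
  moreover have "real X * \<Sigma> \<ge> 0" unfolding \<Sigma>_def by (intro mult_nonneg_nonneg sum_nonneg) auto
  ultimately show ?thesis
    using zeta_minus_dirichlet_polynomial_integral_le[OF \<sigma>_bounds order_YX Z_bounds] P_ge_1
      unfolding P_def \<Sigma>_def distrib_left by linarith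
qed

section \<open>A rational case of the six exponentials theorem\<close>

lemma exists_derivative_zeros:
  fixes f f' :: "real \<Rightarrow> real"
  assumes "finite Z" "\<And>x. (f has_real_derivative f' x) (at x)" "\<And>z. z \<in> Z \<Longrightarrow> f z = 0"
  shows "\<exists>Z'. finite Z' \<and> card Z \<le> Suc (card Z') \<and> (\<forall>z\<in>Z'. f' z = 0)"
proof -
  have "\<exists>Z'. finite Z' \<and> card Z \<le> Suc (card Z') \<and> (\<forall>z\<in>Z'. f' z = 0 \<and> (\<exists>a\<in>Z. z < a))"
    using assms(1,3)
  proof (induction Z rule: finite_linorder_max_induct)
    case (insert b A)
    show ?case
    proof (cases "A = {}")
      case False
      from insert obtain Z' where derivative_zeros: "finite Z'" "card A \<le> Suc (card Z')"
        "\<And>z. z \<in> Z' \<Longrightarrow> f' z = 0 \<and> (\<exists>a\<in>A. z < a)" by auto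
      have Max: "Max A \<in> A" using insert.hyps(1) False by (rule Max_in)
      then obtain z where mean_value_point: "Max A < z" "z < b" "f b - f (Max A) = (b - Max A) * f' z"
        using MVT2[of "Max A" b f f'] insert.hyps(2) assms(2) by auto
      have "f' z = 0" using mean_value_point insert.prems Max by auto
      moreover have "z \<notin> Z'"
        using derivative_zeros(3)[of z] mean_value_point(1) Max_ge[OF insert.hyps(1)] by force
      moreover have "\<exists>a\<in>insert b A. w < a" if "w \<in> Z'" for w using derivative_zeros(3)[OF that] by blast
      ultimately show ?thesis
        using derivative_zeros mean_value_point insert.hyps by (intro exI[of _ "insert z Z'"]) auto
    qed (intro exI[of _ "{}"], simp)
  qed (intro exI[of _ "{}"], simp)
  thus ?thesis by blast
qed

lemma real_exponential_sum_eq_0: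
  fixes c l :: "'a \<Rightarrow> real"
  assumes "finite I" "inj_on l I" "finite Z" "card I \<le> card Z"
    and "\<And>x. x \<in> Z \<Longrightarrow> (\<Sum>p\<in>I. c p * exp (l p * x)) = 0"
  shows "\<forall>p\<in>I. c p = 0"
  using assms
proof (induction I arbitrary: c l Z rule: finite_induct)
  case (insert q I)
  define g where "g = (\<lambda>x. c q + (\<Sum>p\<in>I. c p * exp ((l p - l q) * x)))"
  have "g x = exp (- l q * x) * (\<Sum>p\<in>insert q I. c p * exp (l p * x))" for x
  proof -
    have "exp (- l q * x) * exp (l p * x) = exp ((l p - l q) * x)" for p
      by (simp add: algebra_simps flip: exp_add)
    thus ?thesis using insert.hyps
      by (simp add: g_def distrib_left sum_distrib_left mult.left_commute)
  qed
  hence g_eq_0: "g x = 0" if "x \<in> Z" for x using insert.prems(4)[OF that] by simp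
  have "(g has_real_derivative (\<Sum>p\<in>I. c p * (l p - l q) * exp ((l p - l q) * x))) (at x)" for x
    unfolding g_def by (auto intro!: derivative_eq_intros sum.cong)
  from exists_derivative_zeros[OF insert.prems(2) this g_eq_0]
  obtain Z' where derivative_zeros: "finite Z'" "card Z \<le> Suc (card Z')"
    "\<And>x. x \<in> Z' \<Longrightarrow> (\<Sum>p\<in>I. c p * (l p - l q) * exp ((l p - l q) * x)) = 0" by blast
  have "\<forall>p\<in>I. c p * (l p - l q) = 0"
  proof (rule insert.IH)
    show "inj_on (\<lambda>p. l p - l q) I" using insert.prems(1) by (auto simp: inj_on_def)
    show "card I \<le> card Z'" using derivative_zeros(2) insert.prems(3) insert.hyps by simp
  qed (use derivative_zeros in auto)
  hence other_coeffs_eq_0: "c p = 0" if "p \<in> I" for p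
    using that insert.hyps insert.prems(1) by (auto simp: inj_on_def)
  have "Z \<noteq> {}" using insert.prems(2,3) insert.hyps by auto
  then obtain x where "x \<in> Z" by blast
  hence "c q = 0" using g_eq_0[of x] other_coeffs_eq_0 by (simp add: g_def)
  thus ?case using other_coeffs_eq_0 by blast
qed simp

lemma entire_factor_zeros:
  fixes f :: "complex \<Rightarrow> complex"
  assumes "finite Z" "f holomorphic_on UNIV" "\<And>z. z \<in> Z \<Longrightarrow> f z = 0"
  shows "\<exists>g. g holomorphic_on UNIV \<and> (\<forall>z. f z = g z * (\<Prod>a\<in>Z. z - a))"
  using assms(1,3)
proof (induction Z rule: finite_induct)
  case empty
  show ?case using assms(2) by (intro exI[of _ f]) simp
next
  case (insert a Z)
  then obtain g where g_props: "g holomorphic_on UNIV" "\<forall>z. f z = g z * (\<Prod>a\<in>Z. z - a)" by auto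
  have "f a = 0" using insert.prems by simp
  moreover have "(\<Prod>b\<in>Z. a - b) \<noteq> 0" using insert.hyps by (auto simp: prod_zero_iff)
  ultimately have g_at_zero: "g a = 0" using g_props(2) by (metis mult_eq_0_iff)
  define h where "h = (\<lambda>z. if z = a then deriv g a else (g z - g a) / (z - a))"
  have "h holomorphic_on UNIV" unfolding h_def by (rule pole_lemma_open[OF g_props(1)]) simp
  moreover have "g z = h z * (z - a)" for z using g_at_zero by (simp add: h_def)
  ultimately show ?case using g_props(2) insert.hyps by (intro exI[of _ h]) (auto simp: mult_ac)
qed

lemma schwarz_lemma_many_zeros:
  fixes f :: "complex \<Rightarrow> complex"
  assumes "finite Z" "f holomorphic_on UNIV" "\<And>z. z \<in> Z \<Longrightarrow> f z = 0"
    and radii: "0 < r" "r < R" "\<And>z. z \<in> Z \<Longrightarrow> cmod z \<le> r" and w_le: "cmod w \<le> r"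
    and f_le: "\<And>z. cmod z = R \<Longrightarrow> cmod (f z) \<le> B"
  shows "cmod (f w) \<le> B * (2 * r / (R - r)) ^ card Z"
proof -
  obtain g where g_props: "g holomorphic_on UNIV" "\<And>z. f z = g z * (\<Prod>a\<in>Z. z - a)"
    using entire_factor_zeros[OF assms(1-3)] by auto
  have "cmod (g z) \<le> B / (R - r) ^ card Z" if norm_z: "cmod z = R" for z
  proof -
    have "(R - r) ^ card Z = (\<Prod>a\<in>Z. R - r)" by simp
    also have "\<dots> \<le> (\<Prod>a\<in>Z. cmod (z - a))"
    proof (intro prod_mono conjI)
      fix a assume "a \<in> Z"
      thus "R - r \<le> cmod (z - a)" using radii(3)[of a] norm_z norm_triangle_ineq2[of z a] by linarith
    qed (use radii in auto)
    finally have "cmod (g z) * (R - r) ^ card Z \<le> cmod (g z) * (\<Prod>a\<in>Z. cmod (z - a))"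
      by (intro mult_left_mono) auto
    also have "\<dots> = cmod (f z)" by (simp add: g_props(2) norm_mult prod_norm)
    also have "\<dots> \<le> B" using f_le norm_z by simp
    finally show ?thesis using radii by (simp add: pos_le_divide_eq)
  qed
  hence g_le: "cmod (g z) \<le> B / (R - r) ^ card Z" if "z \<in> frontier (cball 0 R)" for z
    using that radii by (simp add: frontier_cball)
  have "cmod (g w) \<le> B / (R - r) ^ card Z"
  proof (rule maximum_modulus_frontier[of g "cball 0 R", OF _ _ _ g_le])
    show "g holomorphic_on interior (cball 0 R)" using g_props(1) by (rule holomorphic_on_subset) simp
    show "continuous_on (closure (cball 0 R)) g"
      using g_props(1) by (blast intro: holomorphic_on_imp_continuous_on holomorphic_on_subset)
  qed (use w_le radii in auto)
  moreover have "(\<Prod>a\<in>Z. cmod (w - a)) \<le> (\<Prod>a\<in>Z. 2 * r)"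
  proof (intro prod_mono conjI)
    fix a assume "a \<in> Z"
    thus "cmod (w - a) \<le> 2 * r" using radii(3)[of a] w_le norm_triangle_ineq4[of w a] by linarith
  qed auto
  ultimately have "cmod (g w) * (\<Prod>a\<in>Z. cmod (w - a)) \<le> B / (R - r) ^ card Z * (2 * r) ^ card Z"
    by (intro mult_mono prod_nonneg) (auto intro: order_trans[OF norm_ge_zero])
  thus ?thesis by (simp add: g_props(2) norm_mult prod_norm power_divide)
qed

lemma siegel_pigeonhole:
  fixes \<alpha> :: "'i \<Rightarrow> 'k \<Rightarrow> nat"
  assumes fin: "finite I" "finite K" and card: "card I > 2 * card K" "card I \<ge> 2" and H_ge_1: "H \<ge> 1"
    and entries_le: "\<forall>i\<in>I. \<forall>k\<in>K. \<alpha> i k \<le> H"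
  shows "\<exists>c\<in>PiE I (\<lambda>_. {..<card I * H}). \<exists>c'\<in>PiE I (\<lambda>_. {..<card I * H}).
           c \<noteq> c' \<and> (\<forall>k\<in>K. (\<Sum>i\<in>I. c i * \<alpha> i k) = (\<Sum>i\<in>I. c' i * \<alpha> i k))"
proof -
  define C where "C = card I * H"
  have C_ge_2: "C \<ge> 2" using mult_le_mono[OF card(2) H_ge_1] by (simp add: C_def)
  define A where "A = PiE I (\<lambda>_. {..<C})"
  define f where "f = (\<lambda>c. \<lambda>k\<in>K. \<Sum>i\<in>I. c i * \<alpha> i k)"
  have "(\<Sum>i\<in>I. c i * \<alpha> i k) < C ^ 2" if "c \<in> A" "k \<in> K" for c k
  proof -
    have "(\<Sum>i\<in>I. c i * \<alpha> i k) \<le> (\<Sum>i\<in>I. (C - 1) * H)"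
    proof (intro sum_mono mult_mono)
      fix i assume "i \<in> I"
      hence "c i < C" "\<alpha> i k \<le> H" using that entries_le by (auto simp: A_def)
      thus "c i \<le> C - 1" "\<alpha> i k \<le> H" by simp_all
    qed auto
    also have "\<dots> = (C - 1) * C" by (simp add: C_def)
    also have "\<dots> < C ^ 2" using C_ge_2 by (simp add: power2_eq_square)
    finally show ?thesis .
  qed
  hence "f ` A \<subseteq> PiE K (\<lambda>_. {..<C ^ 2})" by (auto simp: f_def)
  moreover have "finite (PiE K (\<lambda>_. {..<C ^ 2}))" using fin by (intro finite_PiE) auto
  ultimately have "card (f ` A) \<le> card (PiE K (\<lambda>_. {..<C ^ 2}))" by (rule card_mono[rotated])
  also have "\<dots> = C ^ (2 * card K)" using fin by (simp add: card_PiE power_mult)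
  also have "\<dots> < C ^ card I" using C_ge_2 card by (intro power_strict_increasing) auto
  also have "\<dots> = card A" using fin by (simp add: A_def card_PiE)
  finally have "\<not> inj_on f A" using pigeonhole by blast
  then obtain c c' where collision: "c \<in> A" "c' \<in> A" "c \<noteq> c'" "f c = f c'" unfolding inj_on_def by blast
  have "(\<Sum>i\<in>I. c i * \<alpha> i k) = (\<Sum>i\<in>I. c' i * \<alpha> i k)" if "k \<in> K" for k
    using fun_cong[OF collision(4), of k] that by (simp add: f_def)
  thus ?thesis using collision(1-3) unfolding A_def C_def by blast
qed

lemma siegel_lemma:
  fixes \<alpha> :: "'i \<Rightarrow> 'k \<Rightarrow> nat"
  assumes "finite I" "finite K" "card I > 2 * card K" "card I \<ge> 2" "H \<ge> 1" "\<forall>i\<in>I. \<forall>k\<in>K. \<alpha> i k \<le> H"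
  shows "\<exists>c :: 'i \<Rightarrow> int. (\<exists>i\<in>I. c i \<noteq> 0) \<and> (\<forall>i\<in>I. \<bar>c i\<bar> \<le> int (card I * H)) \<and>
           (\<forall>k\<in>K. (\<Sum>i\<in>I. c i * int (\<alpha> i k)) = 0)"
proof -
  obtain c c' where collision: "c \<in> PiE I (\<lambda>_. {..<card I * H})" "c' \<in> PiE I (\<lambda>_. {..<card I * H})" "c \<noteq> c'"
    and same_image: "\<forall>k\<in>K. (\<Sum>i\<in>I. c i * \<alpha> i k) = (\<Sum>i\<in>I. c' i * \<alpha> i k)"
    using siegel_pigeonhole[OF assms] by blast
  define e where "e = (\<lambda>i. int (c i) - int (c' i))"
  have "\<exists>i\<in>I. c i \<noteq> c' i" using collision PiE_ext[of c I _ c'] by blast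
  hence "\<exists>i\<in>I. e i \<noteq> 0" by (simp add: e_def)
  moreover have "\<bar>e i\<bar> \<le> int (card I * H)" if "i \<in> I" for i
  proof -
    have "c i < card I * H" "c' i < card I * H" using collision that by auto
    thus ?thesis unfolding e_def by linarith
  qed
  moreover have "(\<Sum>i\<in>I. e i * int (\<alpha> i k)) = 0" if "k \<in> K" for k
  proof -
    have "int (\<Sum>i\<in>I. c i * \<alpha> i k) = int (\<Sum>i\<in>I. c' i * \<alpha> i k)" using same_image that by simp
    thus ?thesis by (simp add: e_def left_diff_distrib sum_subtractf)
  qed
  ultimately show ?thesis by (intro exI[of _ e]) blast
qed

definition exp_sum :: "'a set \<Rightarrow> ('a \<Rightarrow> int) \<Rightarrow> ('a \<Rightarrow> real) \<Rightarrow> complex \<Rightarrow> complex" where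
  "exp_sum I c l w = (\<Sum>p\<in>I. of_int (c p) * exp (of_real (l p) * w))"

lemma holomorphic_exp_sum: "exp_sum I c l holomorphic_on A"
  unfolding exp_sum_def[abs_def] by (intro holomorphic_intros)

lemma exp_sum_of_real:
  "exp_sum I c l (of_real u) = of_real (\<Sum>p\<in>I. of_int (c p) * exp (l p * u))"
  unfolding exp_sum_def of_real_sum of_real_mult of_real_of_int_eq exp_of_real[symmetric] by simp

lemma norm_exp_sum_le:
  assumes "\<And>p. p \<in> I \<Longrightarrow> \<bar>real_of_int (c p)\<bar> \<le> H" "\<And>p. p \<in> I \<Longrightarrow> \<bar>l p\<bar> \<le> \<Lambda>" "cmod w \<le> R"
  shows "cmod (exp_sum I c l w) \<le> real (card I) * (H * exp (\<Lambda> * R))"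
proof -
  have "cmod (of_int (c p) * exp (of_real (l p) * w)) \<le> H * exp (\<Lambda> * R)" if p_mem: "p \<in> I" for p
  proof -
    have "Re (of_real (l p) * w) \<le> \<bar>l p\<bar> * cmod w"
      using complex_Re_le_cmod[of "of_real (l p) * w"] by (simp add: norm_mult)
    also have "\<dots> \<le> \<Lambda> * R" using assms(2)[OF p_mem] assms(3) by (intro mult_mono) auto
    finally have "cmod (exp (of_real (l p) * w)) \<le> exp (\<Lambda> * R)" by (simp only: norm_exp_eq_Re exp_le_cancel_iff)
    thus ?thesis using assms(1)[OF p_mem] unfolding norm_mult by (intro mult_mono) auto
  qed
  from sum_norm_le[of I, OF this] show ?thesis unfolding exp_sum_def by simp
qed

lemma mult_exp_sum_eq_of_int:
  assumes "\<And>p. p \<in> I \<Longrightarrow> real (\<alpha> p) = \<delta> * exp (l p * u)"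
  shows "of_real \<delta> * exp_sum I c l (of_real u) = of_int (\<Sum>p\<in>I. c p * int (\<alpha> p))"
proof -
  have "\<delta> * (\<Sum>p\<in>I. of_int (c p) * exp (l p * u)) = (\<Sum>p\<in>I. of_int (c p) * real (\<alpha> p))"
    unfolding sum_distrib_left using assms by (intro sum.cong) auto
  hence "complex_of_real (\<delta> * (\<Sum>p\<in>I. of_int (c p) * exp (l p * u))) = of_real (\<Sum>p\<in>I. of_int (c p) * real (\<alpha> p))"
    by (rule arg_cong)
  thus ?thesis unfolding exp_sum_of_real by simp
qed

lemma exp_sum_lower_bound:
  assumes "\<And>p. p \<in> I \<Longrightarrow> real (\<alpha> p) = \<delta> * exp (l p * u)" "\<delta> > 0" "exp_sum I c l (of_real u) \<noteq> 0"
  shows "1 \<le> \<delta> * cmod (exp_sum I c l (of_real u))"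
proof -
  define s where "s = (\<Sum>p\<in>I. c p * int (\<alpha> p))"
  have integer_multiple: "of_real \<delta> * exp_sum I c l (of_real u) = of_int s"
    unfolding s_def by (rule mult_exp_sum_eq_of_int[OF assms(1)])
  hence "s \<noteq> 0" using assms(2,3) by auto
  hence "1 \<le> \<bar>real_of_int s\<bar>" by linarith
  also have "\<dots> = cmod (of_real \<delta> * exp_sum I c l (of_real u))" unfolding integer_multiple norm_of_int ..
  finally show ?thesis using assms(2) by (simp add: norm_mult)
qed

lemma exists_vanishing_exp_sum:
  fixes \<alpha> :: "'i \<Rightarrow> 'k \<Rightarrow> nat" and z :: "'k \<Rightarrow> real"
  assumes "finite I" "finite K" "card I > 2 * card K" "card I \<ge> 2" "H \<ge> 1" "\<delta> > 0"
    and "\<And>i k. i \<in> I \<Longrightarrow> k \<in> K \<Longrightarrow> \<alpha> i k \<le> H \<and> real (\<alpha> i k) = \<delta> * exp (l i * z k)"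
  shows "\<exists>c. (\<exists>i\<in>I. c i \<noteq> 0) \<and> (\<forall>i\<in>I. \<bar>real_of_int (c i)\<bar> \<le> real (card I) * real H) \<and>
           (\<forall>k\<in>K. exp_sum I c l (of_real (z k)) = 0)"
proof -
  have "\<forall>i\<in>I. \<forall>k\<in>K. \<alpha> i k \<le> H" using assms(7) by blast
  from siegel_lemma[OF assms(1-5) this]
  obtain c :: "'i \<Rightarrow> int" where c_props: "\<exists>i\<in>I. c i \<noteq> 0" "\<forall>i\<in>I. \<bar>c i\<bar> \<le> int (card I * H)"
    "\<forall>k\<in>K. (\<Sum>i\<in>I. c i * int (\<alpha> i k)) = 0"
    by (elim exE conjE)
  have "\<bar>real_of_int (c i)\<bar> \<le> real (card I) * real H" if "i \<in> I" for i
  proof -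
    have "\<bar>c i\<bar> \<le> int (card I * H)" using c_props(2) that by blast
    hence "real_of_int \<bar>c i\<bar> \<le> real_of_int (int (card I * H))" by (rule of_int_le_iff[THEN iffD2])
    thus ?thesis by simp
  qed
  moreover have "exp_sum I c l (of_real (z k)) = 0" if "k \<in> K" for k
  proof -
    have "of_real \<delta> * exp_sum I c l (of_real (z k)) = of_int (\<Sum>i\<in>I. c i * int (\<alpha> i k))"
      using assms(7) that by (intro mult_exp_sum_eq_of_int) auto
    thus ?thesis using c_props(3) that assms(6) by simp
  qed
  ultimately show ?thesis using c_props(1) by blast
qed

lemma positive_rationals_common_denominator:
  fixes q :: "'a \<Rightarrow> real"
  assumes "finite S" "\<forall>i\<in>S. q i \<in> \<rat> \<and> q i > 0"
  shows "\<exists>D A. D > (0::nat) \<and> (\<forall>i\<in>S. q i = real (A i :: nat) / real D)"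
  using assms
proof (induction S rule: finite_induct)
  case (insert j S)
  then obtain D A where common_denominator: "D > (0::nat)" "\<forall>i\<in>S. q i = real (A i :: nat) / real D" by auto
  have "q j \<in> \<rat>" "q j > 0" using insert.prems by auto
  then obtain m n :: nat where q_eq: "n \<noteq> 0" "q j = real m / real n" by (elim Rats_abs_nat_div_natE) auto
  have "q i = real (if i = j then m * D else A i * n) / real (D * n)" if "i \<in> insert j S" for i
    using that common_denominator q_eq by auto
  thus ?case using common_denominator(1) q_eq(1)
    by (intro exI[of _ "D * n"] exI[of _ "\<lambda>i. if i = j then m * D else A i * n"]) auto
qed (intro exI[of _ 1], simp)

lemma rational_monomials_common_denominator:
  fixes q :: "'a \<Rightarrow> real"
  assumes "finite S" "\<forall>j\<in>S. q j \<in> \<rat> \<and> q j > 0"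
  shows "\<exists>D Q :: nat. 0 < D \<and> D \<le> Q \<and> (\<forall>e M. (\<forall>j\<in>S. e j \<le> M) \<longrightarrow>
           (\<exists>A::nat. A \<le> Q ^ (card S * M) \<and> real A = real D ^ (card S * M) * (\<Prod>j\<in>S. q j ^ e j)))"
proof -
  obtain D a where D_pos: "D > (0::nat)" and q_eq: "\<forall>j\<in>S. q j = real (a j :: nat) / real D"
    using positive_rationals_common_denominator[OF assms] by (elim exE conjE)
  define Q where "Q = D + (\<Sum>j\<in>S. a j)"
  have Q_bounds: "D \<le> Q" "\<And>j. j \<in> S \<Longrightarrow> a j \<le> Q"
    using assms(1) by (auto simp: Q_def intro!: trans_le_add2 member_le_sum)
  have "\<exists>A::nat. A \<le> Q ^ (card S * M) \<and> real A = real D ^ (card S * M) * (\<Prod>j\<in>S. q j ^ e j)"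
    if exponent_le: "\<forall>j\<in>S. e j \<le> M" for e M
  proof (intro exI conjI)
    let ?A = "\<Prod>j\<in>S. a j ^ e j * D ^ (M - e j)"
    have "?A \<le> (\<Prod>j\<in>S. Q ^ e j * Q ^ (M - e j))"
      using Q_bounds by (intro prod_mono conjI mult_mono power_mono) auto
    also have "\<dots> = (\<Prod>j\<in>S. Q ^ M)" using exponent_le by (intro prod.cong) (auto simp flip: power_add)
    finally show "?A \<le> Q ^ (card S * M)" by (simp add: mult.commute flip: power_mult)
    have "real (a j ^ e j * D ^ (M - e j)) = real D ^ M * q j ^ e j" if "j \<in> S" for j
    proof -
      have "real D ^ M = real D ^ e j * real D ^ (M - e j)" using exponent_le that by (simp flip: power_add)
      thus ?thesis using D_pos by (simp add: bspec[OF q_eq that] power_divide)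
    qed
    hence "real ?A = (\<Prod>j\<in>S. real D ^ M * q j ^ e j)" unfolding of_nat_prod by (intro prod.cong) auto
    thus "real ?A = real D ^ (card S * M) * (\<Prod>j\<in>S. q j ^ e j)"
      by (simp add: prod.distrib mult.commute flip: power_mult)
  qed
  thus ?thesis using D_pos Q_bounds(1) by blast
qed

definition lattice_box :: "nat \<Rightarrow> (nat \<Rightarrow> nat) set" where
  "lattice_box n = PiE {..<3} (\<lambda>_. {..<n})"

definition lattice_point :: "(nat \<Rightarrow> real) \<Rightarrow> (nat \<Rightarrow> nat) \<Rightarrow> real" where
  "lattice_point x k = (\<Sum>i<3. real (k i) * x i)"

definition lattice_freq :: "real \<Rightarrow> nat \<times> nat \<Rightarrow> real" where
  "lattice_freq \<gamma> p = real (fst p) + real (snd p) * \<gamma>"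

lemma finite_lattice_box: "finite (lattice_box n)"
  unfolding lattice_box_def by (intro finite_PiE) auto

lemma card_lattice_box: "card (lattice_box n) = n ^ 3"
  by (simp add: lattice_box_def card_PiE)

lemma lattice_box_less: "k \<in> lattice_box n \<Longrightarrow> i < 3 \<Longrightarrow> k i < n"
  by (auto simp: lattice_box_def)

lemma abs_lattice_point_le:
  assumes "k \<in> lattice_box n"
  shows "\<bar>lattice_point x k\<bar> \<le> real n * (\<Sum>i<3. \<bar>x i\<bar>)"
proof -
  have "\<bar>lattice_point x k\<bar> \<le> (\<Sum>i<3. \<bar>real (k i) * x i\<bar>)" unfolding lattice_point_def by (rule sum_abs)
  also have "\<dots> \<le> (\<Sum>i<3. real n * \<bar>x i\<bar>)"
    using lattice_box_less[OF assms, THEN less_imp_le]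
    by (intro sum_mono) (auto simp: abs_mult intro!: mult_right_mono)
  finally show ?thesis by (simp add: sum_distrib_left)
qed

lemma abs_lattice_freq_le:
  assumes "p \<in> {..<L} \<times> {..<L}"
  shows "\<bar>lattice_freq \<gamma> p\<bar> \<le> real L * (1 + \<bar>\<gamma>\<bar>)"
proof -
  have "\<bar>lattice_freq \<gamma> p\<bar> \<le> real (fst p) + real (snd p) * \<bar>\<gamma>\<bar>"
    unfolding lattice_freq_def by (rule order_trans[OF abs_triangle_ineq]) (simp add: abs_mult)
  also have "\<dots> \<le> real L + real L * \<bar>\<gamma>\<bar>" using assms by (intro add_mono mult_right_mono) auto
  finally show ?thesis by (simp add: algebra_simps)
qed

definition lattice_denominator :: "real \<Rightarrow> (nat \<Rightarrow> real) \<Rightarrow> nat \<Rightarrow> nat \<Rightarrow> bool" where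
  "lattice_denominator \<gamma> x D Q \<longleftrightarrow> 0 < D \<and> D \<le> Q \<and>
     (\<forall>L n. \<forall>p\<in>{..<L} \<times> {..<L}. \<forall>k\<in>lattice_box n. \<exists>A::nat. A \<le> Q ^ (6 * (L * n)) \<and>
        real A = real D ^ (6 * (L * n)) * exp (lattice_freq \<gamma> p * lattice_point x k))"

lemma exists_lattice_denominator:
  assumes "\<forall>i<3. exp (x i) \<in> \<rat> \<and> exp (\<gamma> * x i) \<in> \<rat>"
  shows "\<exists>D Q. lattice_denominator \<gamma> x D Q"
proof -
  define S :: "(nat \<times> nat) set" where "S = {..<3} \<times> {..<2}"
  define q where "q = (\<lambda>j::nat \<times> nat. exp ((if snd j = 0 then 1 else \<gamma>) * x (fst j)))"
  have "finite S" "card S = 6" by (auto simp: S_def)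
  moreover have "\<forall>j\<in>S. q j \<in> \<rat> \<and> q j > 0" using assms by (auto simp: S_def q_def)
  ultimately obtain D Q :: nat where D_bounds: "0 < D" "D \<le> Q" and monomials: "\<And>e M. (\<forall>j\<in>S. e j \<le> M) \<Longrightarrow>
      \<exists>A::nat. A \<le> Q ^ (6 * M) \<and> real A = real D ^ (6 * M) * (\<Prod>j\<in>S. q j ^ e j)"
    using rational_monomials_common_denominator[of S q] by auto
  have "\<exists>A::nat. A \<le> Q ^ (6 * (L * n)) \<and>
        real A = real D ^ (6 * (L * n)) * exp (lattice_freq \<gamma> p * lattice_point x k)"
    if p_mem: "p \<in> {..<L} \<times> {..<L}" and k_mem: "k \<in> lattice_box n" for L n p k
  proof -
    define e where "e = (\<lambda>j::nat \<times> nat. (if snd j = 0 then fst p else snd p) * k (fst j))"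
    have "\<forall>j\<in>S. e j \<le> L * n"
      using p_mem lattice_box_less[OF k_mem, THEN less_imp_le] by (auto simp: S_def e_def intro!: mult_le_mono)
    moreover have "(\<Prod>j\<in>S. q j ^ e j) = exp (lattice_freq \<gamma> p * lattice_point x k)"
    proof -
      have "(\<Prod>j\<in>S. q j ^ e j) = exp (\<Sum>j\<in>S. real (e j) * ((if snd j = 0 then 1 else \<gamma>) * x (fst j)))"
        by (simp add: S_def q_def exp_sum exp_of_nat_mult)
      also have "(\<Sum>j\<in>S. real (e j) * ((if snd j = 0 then 1 else \<gamma>) * x (fst j)))
          = (\<Sum>i<3. lattice_freq \<gamma> p * (real (k i) * x i))"
        unfolding S_def sum.cartesian_product' lattice_freq_def e_def
        by (simp add: numeral_2_eq_2 algebra_simps)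
      finally show ?thesis by (simp add: lattice_point_def sum_distrib_left)
    qed
    ultimately show ?thesis using monomials[of e "L * n"] by simp
  qed
  thus ?thesis using D_bounds unfolding lattice_denominator_def by blast
qed

abbreviation lattice_exp_sum :: "nat \<Rightarrow> (nat \<times> nat \<Rightarrow> int) \<Rightarrow> real \<Rightarrow> complex \<Rightarrow> complex" where
  "lattice_exp_sum L c \<gamma> \<equiv> exp_sum ({..<L} \<times> {..<L}) c (lattice_freq \<gamma>)"

lemma exists_vanishing_lattice_exp_sum:
  assumes "lattice_denominator \<gamma> x D Q" "L\<^sup>2 > 2 * N ^ 3" "L \<ge> 2"
  shows "\<exists>c. (\<exists>p\<in>{..<L} \<times> {..<L}. c p \<noteq> 0) \<and>
           (\<forall>p\<in>{..<L} \<times> {..<L}. \<bar>real_of_int (c p)\<bar> \<le> real L ^ 2 * real Q ^ (6 * (L * N))) \<and>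
           (\<forall>k\<in>lattice_box N. lattice_exp_sum L c \<gamma> (of_real (lattice_point x k)) = 0)"
proof -
  let ?I = "{..<L} \<times> {..<L}"
  have D_bounds: "0 < D" "D \<le> Q" and "\<forall>p\<in>?I. \<forall>k\<in>lattice_box N. \<exists>A::nat. A \<le> Q ^ (6 * (L * N)) \<and>
      real A = real D ^ (6 * (L * N)) * exp (lattice_freq \<gamma> p * lattice_point x k)"
    using assms(1) unfolding lattice_denominator_def by blast+
  then obtain \<alpha> where \<alpha>_props: "\<And>p k. p \<in> ?I \<Longrightarrow> k \<in> lattice_box N \<Longrightarrow> \<alpha> p k \<le> Q ^ (6 * (L * N)) \<and>
      real (\<alpha> p k) = real D ^ (6 * (L * N)) * exp (lattice_freq \<gamma> p * lattice_point x k)" by metis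
  have "\<exists>c. (\<exists>p\<in>?I. c p \<noteq> 0) \<and>
      (\<forall>p\<in>?I. \<bar>real_of_int (c p)\<bar> \<le> real (card ?I) * real (Q ^ (6 * (L * N)))) \<and>
      (\<forall>k\<in>lattice_box N. lattice_exp_sum L c \<gamma> (of_real (lattice_point x k)) = 0)"
  proof (rule exists_vanishing_exp_sum[where \<delta> = "real D ^ (6 * (L * N))" and \<alpha> = \<alpha>])
    show "card ?I > 2 * card (lattice_box N)"
      using assms(2) by (simp add: card_lattice_box power2_eq_square)
    show "card ?I \<ge> 2" using mult_le_mono[OF assms(3,3)] by simp
  qed (use \<alpha>_props D_bounds in \<open>simp_all add: finite_lattice_box\<close>)
  thus ?thesis by (simp add: power2_eq_square)
qed

lemma lattice_exp_sum_nonzero: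
  assumes "\<exists>p\<in>{..<L} \<times> {..<L}. c p \<noteq> 0" "L\<^sup>2 \<le> n ^ 3"
    and "inj_on (lattice_freq \<gamma>) ({..<L} \<times> {..<L})" "inj_on (lattice_point x) (lattice_box n)"
  shows "\<exists>k\<in>lattice_box n. lattice_exp_sum L c \<gamma> (of_real (lattice_point x k)) \<noteq> 0"
proof (rule ccontr)
  assume "\<not> ?thesis"
  hence "lattice_exp_sum L c \<gamma> (of_real u) = 0" if "u \<in> lattice_point x ` lattice_box n" for u
    using that by blast
  hence "(\<Sum>p\<in>{..<L} \<times> {..<L}. of_int (c p) * exp (lattice_freq \<gamma> p * u)) = 0"
    if "u \<in> lattice_point x ` lattice_box n" for u
    using that unfolding exp_sum_of_real of_real_eq_0_iff .
  moreover have "card ({..<L} \<times> {..<L}) \<le> card (lattice_point x ` lattice_box n)"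
    using assms(2,4) by (simp add: card_image card_lattice_box power2_eq_square)
  ultimately have "\<forall>p\<in>{..<L} \<times> {..<L}. real_of_int (c p) = 0"
    using assms(3) finite_lattice_box by (intro real_exponential_sum_eq_0) auto
  thus False using assms(1) by simp
qed

lemma lattice_exp_sum_lower_bound:
  assumes "lattice_denominator \<gamma> x D Q" "k \<in> lattice_box n"
    and "lattice_exp_sum L c \<gamma> (of_real (lattice_point x k)) \<noteq> 0"
  shows "1 \<le> real Q ^ (6 * (L * n)) * cmod (lattice_exp_sum L c \<gamma> (of_real (lattice_point x k)))"
proof -
  have D_bounds: "0 < D" "D \<le> Q" and "\<forall>p\<in>{..<L} \<times> {..<L}. \<exists>A::nat.
      real A = real D ^ (6 * (L * n)) * exp (lattice_freq \<gamma> p * lattice_point x k)"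
    using assms(1,2) unfolding lattice_denominator_def by blast+
  then obtain \<alpha> :: "nat \<times> nat \<Rightarrow> nat" where "\<And>p. p \<in> {..<L} \<times> {..<L} \<Longrightarrow>
      real (\<alpha> p) = real D ^ (6 * (L * n)) * exp (lattice_freq \<gamma> p * lattice_point x k)" by metis
  hence "1 \<le> real D ^ (6 * (L * n)) * cmod (lattice_exp_sum L c \<gamma> (of_real (lattice_point x k)))"
    using D_bounds assms(3) by (intro exp_sum_lower_bound[of _ \<alpha>]) auto
  also have "\<dots> \<le> real Q ^ (6 * (L * n)) * cmod (lattice_exp_sum L c \<gamma> (of_real (lattice_point x k)))"
    using D_bounds by (intro mult_right_mono power_mono) auto
  finally show ?thesis .
qed

lemma lattice_exp_sum_upper_bound:
  fixes x :: "nat \<Rightarrow> real"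
  assumes coeff_le: "\<forall>p\<in>{..<L} \<times> {..<L}. \<bar>real_of_int (c p)\<bar> \<le> H"
    and zeros: "\<forall>k\<in>lattice_box N. lattice_exp_sum L c \<gamma> (of_real (lattice_point x k)) = 0"
    and inj: "inj_on (lattice_point x) (lattice_box n)" and n_bounds: "N \<le> n" "1 \<le> n" and k_mem: "k \<in> lattice_box n"
  shows "cmod (lattice_exp_sum L c \<gamma> (of_real (lattice_point x k)))
    \<le> real L ^ 2 * (H * exp (real L * (1 + \<bar>\<gamma>\<bar>) * (7 * (real n * (1 + (\<Sum>i<3. \<bar>x i\<bar>)))))) * (1 / 3) ^ (N ^ 3)"
proof -
  define z where "z = (\<lambda>k. complex_of_real (lattice_point x k))"
  define r where "r = real n * (1 + (\<Sum>i<3. \<bar>x i\<bar>))"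
  define B where "B = real L ^ 2 * (H * exp (real L * (1 + \<bar>\<gamma>\<bar>) * (7 * r)))"
  have "0 < 1 + (\<Sum>i<3. \<bar>x i\<bar>)" by (intro add_pos_nonneg sum_nonneg) auto
  hence r_pos: "0 < r" unfolding r_def using n_bounds by (intro mult_pos_pos) auto
  have z_le: "cmod (z k) \<le> r" if "k \<in> lattice_box n" for k
    using abs_lattice_point_le[OF that, of x] by (simp add: z_def r_def distrib_left)
  have subset: "lattice_box N \<subseteq> lattice_box n" unfolding lattice_box_def using n_bounds by (intro PiE_mono) auto
  hence "inj_on z (lattice_box N)" using inj by (auto simp: z_def inj_on_def)
  hence card: "card (z ` lattice_box N) = N ^ 3" by (simp add: card_image card_lattice_box)
  have circle_le: "cmod (lattice_exp_sum L c \<gamma> w) \<le> B" if "cmod w = 7 * r" for w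
    using norm_exp_sum_le[of "{..<L} \<times> {..<L}" c H "lattice_freq \<gamma>" "real L * (1 + \<bar>\<gamma>\<bar>)" w "7 * r"]
      coeff_le that abs_lattice_freq_le by (simp add: B_def power2_eq_square)
  have "cmod (lattice_exp_sum L c \<gamma> (z k)) \<le> B * (2 * r / (7 * r - r)) ^ card (z ` lattice_box N)"
  proof (rule schwarz_lemma_many_zeros[OF _ _ _ r_pos _ _ _ circle_le])
    show "lattice_exp_sum L c \<gamma> w = 0" if "w \<in> z ` lattice_box N" for w
      using that zeros by (auto simp: z_def)
  qed (use r_pos z_le k_mem subset in \<open>auto simp: holomorphic_exp_sum finite_lattice_box\<close>)
  also have "2 * r / (7 * r - r) = 1 / 3" using r_pos by simp
  also note card
  finally show ?thesis unfolding z_def B_def r_def .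
qed

lemma lattice_exp_sum_growth:
  fixes x :: "nat \<Rightarrow> real"
  assumes denom: "lattice_denominator \<gamma> x D Q"
    and sizes: "2 * N ^ 3 < L\<^sup>2" "L\<^sup>2 \<le> n ^ 3" "2 \<le> L" "1 \<le> n" "N \<le> n"
    and inj: "inj_on (lattice_freq \<gamma>) ({..<L} \<times> {..<L})" "inj_on (lattice_point x) (lattice_box n)"
  shows "3 ^ (N ^ 3) \<le> real Q ^ (12 * (L * n)) * real L ^ 4
           * exp (real L * (1 + \<bar>\<gamma>\<bar>) * (7 * (real n * (1 + (\<Sum>i<3. \<bar>x i\<bar>)))))"
proof -
  define E where "E = exp (real L * (1 + \<bar>\<gamma>\<bar>) * (7 * (real n * (1 + (\<Sum>i<3. \<bar>x i\<bar>)))))"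
  obtain c where c_props: "\<exists>p\<in>{..<L} \<times> {..<L}. c p \<noteq> 0"
    "\<forall>p\<in>{..<L} \<times> {..<L}. \<bar>real_of_int (c p)\<bar> \<le> real L ^ 2 * real Q ^ (6 * (L * N))"
    and zeros: "\<forall>k\<in>lattice_box N. lattice_exp_sum L c \<gamma> (of_real (lattice_point x k)) = 0"
    using exists_vanishing_lattice_exp_sum[OF denom sizes(1,3)] by (elim exE conjE)
  obtain k where k_props: "k \<in> lattice_box n" "lattice_exp_sum L c \<gamma> (of_real (lattice_point x k)) \<noteq> 0"
    using lattice_exp_sum_nonzero[OF c_props(1) sizes(2) inj] by blast
  have "1 \<le> real Q ^ (6 * (L * n)) * cmod (lattice_exp_sum L c \<gamma> (of_real (lattice_point x k)))"
    by (rule lattice_exp_sum_lower_bound[OF denom k_props])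
  also have "\<dots> \<le> real Q ^ (6 * (L * n))
      * (real L ^ 2 * (real L ^ 2 * real Q ^ (6 * (L * N)) * E) * (1 / 3) ^ (N ^ 3))"
    unfolding E_def
    using lattice_exp_sum_upper_bound[OF c_props(2) zeros inj(2) sizes(5,4) k_props(1)]
      by (intro mult_left_mono) auto
  finally have "3 ^ (N ^ 3) \<le> real Q ^ (6 * (L * n)) * (real L ^ 4 * real Q ^ (6 * (L * N)) * E)"
    by (simp add: power_divide field_simps power2_eq_square power4_eq_xxxx)
  also have "\<dots> \<le> real Q ^ (6 * (L * n)) * (real L ^ 4 * real Q ^ (6 * (L * n)) * E)"
  proof (intro mult_left_mono mult_right_mono power_increasing)
    show "1 \<le> real Q" using denom by (simp add: lattice_denominator_def)
  qed (use sizes in \<open>auto simp: E_def\<close>)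
  also have "\<dots> = real Q ^ (12 * (L * n)) * real L ^ 4 * E"
  proof -
    have "real Q ^ (12 * (L * n)) = real Q ^ (6 * (L * n)) * real Q ^ (6 * (L * n))" by (simp flip: power_add)
    thus ?thesis by (simp only: mult_ac)
  qed
  finally show ?thesis unfolding E_def .
qed

text \<open>
  An exponential sum with frequencies \<open>a + b \<gamma>\<close>, \<open>a, b < L = 5 m\<^sup>3\<close>, and small integer coefficients is made to
  vanish at the \<open>8 m\<^sup>6\<close> lattice points with coordinates below \<open>2 m\<^sup>2\<close>. It has fewer than \<open>L\<^sup>2 \<le> 27 m\<^sup>6\<close> real
  zeros, so it does not vanish at some lattice point with coordinates below \<open>3 m\<^sup>2\<close>. Its value there is
  rational with bounded denominator, yet tiny by the Schwarz lemma.
\<close>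
lemma lattice_injective_imp_bounded:
  assumes denom: "lattice_denominator \<gamma> x D Q" and m_ge_1: "m \<ge> 1"
    and inj: "inj_on (lattice_freq \<gamma>) ({..<5 * m ^ 3} \<times> {..<5 * m ^ 3})"
      "inj_on (lattice_point x) (lattice_box (3 * m\<^sup>2))"
  shows "8 * real m \<le> 15 * (12 * ln (real Q) + 4 + 7 * (1 + \<bar>\<gamma>\<bar>) * (1 + (\<Sum>i<3. \<bar>x i\<bar>)))"
proof -
  define L N n where "L = 5 * m ^ 3" and "N = 2 * m\<^sup>2" and "n = 3 * m\<^sup>2"
  define X where "X = 1 + (\<Sum>i<3. \<bar>x i\<bar>)"
  have powers: "L\<^sup>2 = 25 * m ^ 6" "N ^ 3 = 8 * m ^ 6" "n ^ 3 = 27 * m ^ 6" "real L * real n = 15 * real m ^ 5"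
    by (simp_all add: L_def N_def n_def power_mult_distrib flip: power_mult power_add)
  have "m ^ 6 \<ge> 1" "m ^ 3 \<ge> 1" "m\<^sup>2 \<ge> 1" using m_ge_1 by simp_all
  hence sizes: "2 * N ^ 3 < L\<^sup>2" "L\<^sup>2 \<le> n ^ 3" "2 \<le> L" "1 \<le> n" "N \<le> n"
    unfolding powers unfolding L_def n_def N_def by linarith+
  have Q_bounds: "real Q \<ge> 1" using denom by (simp add: lattice_denominator_def)
  have "exp (real (N ^ 3)) = exp 1 ^ (N ^ 3)" by (simp flip: exp_of_nat_mult)
  also have "\<dots> \<le> 3 ^ (N ^ 3)" using exp_le by (intro power_mono) auto
  also have "\<dots> \<le> real Q ^ (12 * (L * n)) * real L ^ 4 * exp (real L * (1 + \<bar>\<gamma>\<bar>) * (7 * (real n * X)))"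
    unfolding X_def by (rule lattice_exp_sum_growth[OF denom sizes]) (use inj in \<open>simp_all add: L_def n_def\<close>)
  also have "real L ^ 4 \<le> exp (4 * (real L * real n))"
  proof -
    have "real L ^ 4 \<le> exp (real L) ^ 4"
      using exp_ge_add_one_self[of "real L"] by (intro power_mono) linarith+
    also have "\<dots> = exp (4 * real L)" by (simp flip: exp_of_nat_mult)
    also have "\<dots> \<le> exp (4 * (real L * real n))" using sizes by (simp add: mult_le_cancel_left1)
    finally show ?thesis .
  qed
  also have "real Q ^ (12 * (L * n)) = exp (real (12 * (L * n)) * ln (real Q))"
    using Q_bounds by (subst exp_of_nat_mult) simp
  finally have "exp (real (N ^ 3)) \<le> exp ((12 * ln (real Q) + 4 + 7 * (1 + \<bar>\<gamma>\<bar>) * X) * (real L * real n))"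
    using Q_bounds by (simp add: algebra_simps flip: exp_add)
  hence "real m ^ 5 * (8 * real m) \<le> real m ^ 5 * (15 * (12 * ln (real Q) + 4 + 7 * (1 + \<bar>\<gamma>\<bar>) * X))"
    unfolding powers by (simp add: eval_nat_numeral mult_ac)
  thus ?thesis using m_ge_1 by (simp add: X_def mult_le_cancel_left)
qed

lemma inj_lattice_freq:
  assumes "\<gamma> \<notin> \<rat>"
  shows "inj (lattice_freq \<gamma>)"
proof (rule injI)
  fix p q assume same_freq: "lattice_freq \<gamma> p = lattice_freq \<gamma> q"
  have "snd p = snd q"
  proof (rule ccontr)
    assume "snd p \<noteq> snd q"
    hence "\<gamma> = (real (fst q) - real (fst p)) / (real (snd p) - real (snd q))"
      using same_freq by (simp add: lattice_freq_def field_simps)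
    also have "\<dots> \<in> \<rat>" by simp
    finally show False using assms by contradiction
  qed
  with same_freq show "p = q" by (auto simp: lattice_freq_def prod_eq_iff)
qed

lemma inj_on_lattice_point:
  assumes "\<And>k :: nat \<Rightarrow> int. (\<Sum>i<3. of_int (k i) * x i) = 0 \<Longrightarrow> \<forall>i<3. k i = 0"
  shows "inj_on (lattice_point x) (lattice_box n)"
proof (rule inj_onI)
  fix k l assume same_point: "k \<in> lattice_box n" "l \<in> lattice_box n" "lattice_point x k = lattice_point x l"
  have "(\<Sum>i<3. of_int (int (k i) - int (l i)) * x i) = 0"
    using same_point(3) by (simp add: lattice_point_def left_diff_distrib sum_subtractf)
  from assms[OF this] have "\<forall>i<3. k i = l i" by auto
  thus "k = l" using same_point unfolding lattice_box_def by (intro PiE_ext) auto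
qed

lemma six_exponentials_rational:
  fixes \<gamma> :: real and x :: "nat \<Rightarrow> real"
  assumes indep: "\<And>k :: nat \<Rightarrow> int. (\<Sum>i<3. of_int (k i) * x i) = 0 \<Longrightarrow> \<forall>i<3. k i = 0"
    and rat: "\<forall>i<3. exp (x i) \<in> \<rat> \<and> exp (\<gamma> * x i) \<in> \<rat>"
  shows "\<gamma> \<in> \<rat>"
proof (rule ccontr)
  assume irrational: "\<gamma> \<notin> \<rat>"
  obtain D Q where denom: "lattice_denominator \<gamma> x D Q" using exists_lattice_denominator[OF rat] by blast
  define C where "C = 15 * (12 * ln (real Q) + 4 + 7 * (1 + \<bar>\<gamma>\<bar>) * (1 + (\<Sum>i<3. \<bar>x i\<bar>)))"
  define m where "m = nat \<lceil>C\<rceil> + 1"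
  have "8 * real m \<le> C"
    unfolding C_def using inj_lattice_freq[OF irrational] inj_on_lattice_point[OF indep]
    by (intro lattice_injective_imp_bounded[OF denom]) (auto simp: m_def intro: inj_on_subset)
  moreover have "real m > C" "real m > 0" unfolding m_def by linarith+
  ultimately show False by linarith
qed

section \<open>Independence of logarithms of coprime rationals\<close>

definition log_rationals :: "nat set \<Rightarrow> real set" where
  "log_rationals A = {ln (real a) - ln (real b) | a b. 0 < a \<and> 0 < b \<and> prime_factors a \<union> prime_factors b \<subseteq> A}"

lemma log_rationalsI:
  "0 < a \<Longrightarrow> 0 < b \<Longrightarrow> prime_factors a \<subseteq> A \<Longrightarrow> prime_factors b \<subseteq> A \<Longrightarrow> ln (real a) - ln (real b) \<in> log_rationals A"
  unfolding log_rationals_def by blast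

lemma log_rationalsE:
  assumes "x \<in> log_rationals A"
  obtains a b where "0 < a" "0 < b" "prime_factors a \<subseteq> A" "prime_factors b \<subseteq> A" "x = ln (real a) - ln (real b)"
  using assms unfolding log_rationals_def by blast

lemma log_rationals_mono: "A \<subseteq> B \<Longrightarrow> log_rationals A \<subseteq> log_rationals B"
  unfolding log_rationals_def by blast

lemma log_rationals_0: "0 \<in> log_rationals A"
  using log_rationalsI[of 1 1 A] by simp

lemma log_rationals_uminus: "x \<in> log_rationals A \<Longrightarrow> - x \<in> log_rationals A"
  by (elim log_rationalsE) (simp add: log_rationalsI)

lemma log_rationals_add:
  assumes "x \<in> log_rationals A" "y \<in> log_rationals A"
  shows "x + y \<in> log_rationals A"
proof -
  obtain a b where x_repr: "0 < a" "0 < b" "prime_factors a \<subseteq> A" "prime_factors b \<subseteq> A"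
    "x = ln (real a) - ln (real b)"
    using assms(1) by (rule log_rationalsE)
  obtain c d where y_repr: "0 < c" "0 < d" "prime_factors c \<subseteq> A" "prime_factors d \<subseteq> A"
    "y = ln (real c) - ln (real d)"
    using assms(2) by (rule log_rationalsE)
  have "x + y = ln (real (a * c)) - ln (real (b * d))" using x_repr y_repr by (simp add: ln_mult)
  also have "\<dots> \<in> log_rationals A" using x_repr y_repr by (intro log_rationalsI) (auto simp: prime_factors_product)
  finally show ?thesis .
qed

lemma log_rationals_sum: "(\<And>i. i \<in> I \<Longrightarrow> x i \<in> log_rationals A) \<Longrightarrow> (\<Sum>i\<in>I. x i) \<in> log_rationals A"
  by (induction I rule: infinite_finite_induct) (auto intro: log_rationals_0 log_rationals_add)

lemma log_rationals_of_int_mult: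
  assumes "x \<in> log_rationals A"
  shows "of_int k * x \<in> log_rationals A"
proof -
  have multiple: "real n * y \<in> log_rationals A" if "y \<in> log_rationals A" for n y
    using that by (induction n) (auto simp: distrib_right intro: log_rationals_0 log_rationals_add)
  show ?thesis
    using multiple[OF assms] multiple[OF log_rationals_uminus[OF assms]] by (cases k rule: int_cases2) auto
qed

lemma exp_log_rationals: "x \<in> log_rationals A \<Longrightarrow> exp x \<in> \<rat>"
  by (elim log_rationalsE) (simp add: exp_diff)

lemma log_rationals_finite_support:
  assumes "x \<in> log_rationals A"
  shows "\<exists>B\<subseteq>A. finite B \<and> x \<in> log_rationals B"
proof -
  obtain a b where "0 < a" "0 < b" "prime_factors a \<subseteq> A" "prime_factors b \<subseteq> A" "x = ln (real a) - ln (real b)"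
    using assms by (rule log_rationalsE)
  thus ?thesis by (intro exI[of _ "prime_factors a \<union> prime_factors b"]) (auto intro: log_rationalsI)
qed

lemma coprime_if_disjoint_prime_factors:
  fixes a b :: nat
  assumes "a > 0" "b > 0" "prime_factors a \<inter> prime_factors b = {}"
  shows "coprime a b"
proof (rule ccontr)
  assume "\<not> coprime a b"
  then obtain q where "prime q" "q dvd gcd a b"
    using prime_factor_nat by (metis coprime_iff_gcd_eq_1)
  thus False using assms by (auto simp: prime_factors_dvd)
qed

lemma log_rationals_disjoint:
  assumes "x \<in> log_rationals A" "x \<in> log_rationals B" "A \<inter> B = {}"
  shows "x = 0"
proof -
  obtain a b where A_repr: "0 < a" "0 < b" "prime_factors a \<subseteq> A" "prime_factors b \<subseteq> A"
    "x = ln (real a) - ln (real b)"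
    using assms(1) by (rule log_rationalsE)
  obtain c d where B_repr: "0 < c" "0 < d" "prime_factors c \<subseteq> B" "prime_factors d \<subseteq> B"
    "x = ln (real c) - ln (real d)"
    using assms(2) by (rule log_rationalsE)
  have "ln (real (a * d)) = ln (real (c * b))" using A_repr B_repr by (simp add: ln_mult)
  hence "real (a * d) = real (c * b)" using A_repr B_repr by (subst (asm) ln_inj_iff) auto
  hence cross_mult: "a * d = c * b" by (simp only: of_nat_eq_iff)
  have "coprime a c" "coprime b d"
    using A_repr B_repr assms(3) by (intro coprime_if_disjoint_prime_factors; blast)+
  hence "a dvd b" "b dvd a"
    using cross_mult by (metis coprime_dvd_mult_right_iff dvd_triv_left, metis coprime_dvd_mult_left_iff
      dvd_triv_right)
  hence "a = b" by (rule dvd_antisym)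
  thus ?thesis using A_repr by simp
qed

lemma log_rationals_independent:
  fixes k :: "'i \<Rightarrow> int"
  assumes "finite I" "\<And>i. i \<in> I \<Longrightarrow> x i \<in> log_rationals (A i)" "disjoint_family_on A I"
    and "(\<Sum>i\<in>I. of_int (k i) * x i) = 0" "i \<in> I" "x i \<noteq> 0"
  shows "k i = 0"
proof -
  have "of_int (k i) * x i \<in> log_rationals (A i)" using assms by (intro log_rationals_of_int_mult) auto
  moreover have "of_int (k i) * x i = - (\<Sum>j\<in>I - {i}. of_int (k j) * x j)"
    using assms(1,4,5) by (simp add: sum.remove)
  moreover have "x j \<in> log_rationals (\<Union>j\<in>I - {i}. A j)" if "j \<in> I - {i}" for j
    using that assms(2)[of j] log_rationals_mono[of "A j" "\<Union>j\<in>I - {i}. A j"] by blast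
  hence "- (\<Sum>j\<in>I - {i}. of_int (k j) * x j) \<in> log_rationals (\<Union>j\<in>I - {i}. A j)"
    by (intro log_rationals_uminus log_rationals_sum log_rationals_of_int_mult)
  moreover have "A i \<inter> (\<Union>j\<in>I - {i}. A j) = {}" using assms(3,5) by (auto simp: disjoint_family_on_def)
  ultimately have "of_int (k i) * x i = 0" using log_rationals_disjoint by metis
  thus ?thesis using assms(6) by simp
qed

lemma exists_log_rationals_above_irrational_multiple_eq_0:
  fixes \<beta> :: real
  assumes "\<beta> \<notin> \<rat>"
  shows "\<exists>N. \<forall>x\<in>log_rationals {N<..}. x / \<beta> \<in> log_rationals UNIV \<longrightarrow> x = 0"
proof (rule ccontr)
  assume counterexamples: "\<not> ?thesis"
  have "\<exists>x M. x \<noteq> 0 \<and> x / \<beta> \<in> log_rationals UNIV \<and> N \<le> M \<and> x \<in> log_rationals {N<..M}" for N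
  proof -
    obtain x where x_props: "x \<in> log_rationals {N<..}" "x / \<beta> \<in> log_rationals UNIV" "x \<noteq> 0"
      using counterexamples by blast
    from log_rationals_finite_support[OF x_props(1)]
    obtain B where B_props: "B \<subseteq> {N<..}" "finite B" "x \<in> log_rationals B" by blast
    obtain M where "\<forall>n\<in>B. n \<le> M" using B_props(2) finite_nat_set_iff_bounded_le by blast
    hence "B \<subseteq> {N<..max N M}" using B_props(1) by (auto simp: subset_eq)
    hence "x \<in> log_rationals {N<..max N M}" using B_props(3) log_rationals_mono by blast
    thus ?thesis using x_props(2,3) by (intro exI[of _ x] exI[of _ "max N M"]) simp
  qed
  then obtain y M where y_props: "\<And>N. y N \<noteq> 0" "\<And>N. y N / \<beta> \<in> log_rationals UNIV"
    and M_props: "\<And>N. N \<le> M N" "\<And>N. y N \<in> log_rationals {N<..M N}" by metis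
  define n where "n = (\<lambda>i. (M ^^ i) 0)"
  define A where "A = (\<lambda>i. {n i<..n (Suc i)})"
  have "n i \<le> n (Suc i)" for i using M_props(1) by (simp add: n_def)
  hence n_mono: "i \<le> j \<Longrightarrow> n i \<le> n j" for i j by (rule lift_Suc_mono_le)
  have "A i \<inter> A j = {}" if "i < j" for i j using n_mono[of "Suc i" j] that by (auto simp: A_def)
  hence "disjoint_family_on A {..<3}"
    unfolding disjoint_family_on_def by (metis inf_commute linorder_neqE_nat)
  moreover have "y (n i) \<in> log_rationals (A i)" for i using M_props(2)[of "n i"] by (simp add: A_def n_def)
  ultimately have "\<forall>i<3. k i = 0" if "(\<Sum>i<3. of_int (k i) * y (n i)) = 0" for k :: "nat \<Rightarrow> int"
    using that y_props(1) log_rationals_independent[of "{..<3}" "\<lambda>i. y (n i)" A k] by auto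
  moreover have "\<forall>i<3. exp (y (n i)) \<in> \<rat> \<and> exp (1 / \<beta> * y (n i)) \<in> \<rat>"
    using exp_log_rationals[OF M_props(2)] exp_log_rationals[OF y_props(2)] by auto
  ultimately have "1 / \<beta> \<in> \<rat>" by (intro six_exponentials_rational[where x = "\<lambda>i. y (n i)"])
  from Rats_divide[OF Rats_1 this] show False using assms by simp
qed

definition log_nonresonant :: "nat \<Rightarrow> real \<Rightarrow> bool" where
  "log_nonresonant N \<beta> \<longleftrightarrow> (\<forall>x\<in>log_rationals {..N}. \<beta> * x \<in> log_rationals {N<..} \<longrightarrow> \<beta> * x = 0)"

lemma eventually_log_nonresonant:
  fixes \<beta> :: real
  shows "\<forall>\<^sub>F N in sequentially. log_nonresonant N \<beta>"
proof (cases "\<beta> \<in> \<rat>")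
  case True
  then obtain a b :: int where \<beta>_quotient: "b > 0" "\<beta> = of_int a / of_int b" by (rule Rats_cases')
  have "\<beta> * x = 0" if "x \<in> log_rationals {..N}" "\<beta> * x \<in> log_rationals {N<..}" for N x
  proof -
    have "of_int b * (\<beta> * x) = of_int a * x" using \<beta>_quotient by simp
    moreover have "{..N} \<inter> {N<..} = {}" by auto
    ultimately have "of_int b * (\<beta> * x) = 0"
      using log_rationals_of_int_mult[OF that(1), of a] log_rationals_of_int_mult[OF that(2), of b]
        log_rationals_disjoint by metis
    thus ?thesis using \<beta>_quotient(1) by simp
  qed
  thus ?thesis by (simp add: log_nonresonant_def)
next
  case False
  then obtain N0 where threshold: "\<forall>x\<in>log_rationals {N0<..}. x / \<beta> \<in> log_rationals UNIV \<longrightarrow> x = 0"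
    using exists_log_rationals_above_irrational_multiple_eq_0 by blast
  have "\<beta> \<noteq> 0" using False by auto
  show ?thesis
    unfolding log_nonresonant_def using eventually_ge_at_top[of N0]
  proof (eventually_elim, intro ballI impI)
    fix N x assume "N0 \<le> N" and x_mem: "x \<in> log_rationals {..N}" "\<beta> * x \<in> log_rationals {N<..}"
    hence "\<beta> * x \<in> log_rationals {N0<..}" using log_rationals_mono[of "{N<..}" "{N0<..}"] by auto
    moreover have "\<beta> * x / \<beta> \<in> log_rationals UNIV"
      using x_mem(1) \<open>\<beta> \<noteq> 0\<close> log_rationals_mono[of "{..N}" UNIV] by auto
    ultimately show "\<beta> * x = 0" using threshold by blast
  qed
qed

section \<open>Removing finitely many Euler factors\<close>

abbreviation primes_upto :: "nat \<Rightarrow> nat set" where "primes_upto N \<equiv> {p. prime p \<and> p \<le> N}"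

definition euler_factor :: "nat set \<Rightarrow> complex \<Rightarrow> complex" where
  "euler_factor S s = (\<Prod>p\<in>S. 1 - of_nat p powr (-s))"

definition sieved_zeta :: "nat set \<Rightarrow> complex \<Rightarrow> complex" where
  "sieved_zeta S s = zeta s * euler_factor S s"

definition sieved_below :: "nat set \<Rightarrow> real \<Rightarrow> nat set" where
  "sieved_below S Y = {n. n \<ge> 1 \<and> real n < Y \<and> (\<forall>p\<in>S. \<not> p dvd n)}"

definition sieved_sum :: "nat set \<Rightarrow> real \<Rightarrow> complex \<Rightarrow> complex" where
  "sieved_sum S Y s = (\<Sum>n\<in>sieved_below S Y. of_nat n powr (-s))"

definition sieve_error :: "nat set \<Rightarrow> real \<Rightarrow> complex \<Rightarrow> complex" where
  "sieve_error S Y s = sieved_zeta S s - sieved_sum S Y s"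

lemma holomorphic_nat_powr: "n \<ge> 1 \<Longrightarrow> (\<lambda>s. of_nat n powr (-s)) holomorphic_on A"
  by (intro holomorphic_intros) auto

lemma holomorphic_sieved_zeta:
  assumes "\<forall>p\<in>S. prime p"
  shows "sieved_zeta S holomorphic_on - {1}"
  unfolding sieved_zeta_def[abs_def] euler_factor_def
  by (intro holomorphic_intros holomorphic_zeta holomorphic_nat_powr) (use assms prime_ge_1_nat in auto)

lemma holomorphic_sieve_error:
  assumes "\<forall>p\<in>S. prime p"
  shows "sieve_error S Y holomorphic_on - {1}"
  unfolding sieve_error_def[abs_def] sieved_sum_def
  by (intro holomorphic_intros holomorphic_sieved_zeta holomorphic_nat_powr assms) (auto simp: sieved_below_def)

lemma continuous_on_sieve_error_vertical:
  assumes "\<forall>p\<in>S. prime p" "0 < a"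
  shows "continuous_on {a..b} (\<lambda>t. sieve_error S Y (Complex \<sigma> t))"
  unfolding Complex_eq using assms
  by (intro continuous_on_compose2[OF holomorphic_on_imp_continuous_on[OF holomorphic_sieve_error]]
    continuous_intros)
    (auto simp: complex_eq_iff)

lemma norm_sieve_error_cnj: "cmod (sieve_error S Y (cnj s)) = cmod (sieve_error S Y s)"
proof -
  have powr: "of_nat n powr (- cnj s) = cnj (of_nat n powr (-s))" for n
    using cnj_powr[of "of_nat n" "-s"] by simp
  have "sieve_error S Y (cnj s) = cnj (sieve_error S Y s)"
    by (simp add: sieve_error_def sieved_zeta_def euler_factor_def sieved_sum_def powr zeta_cnj)
  thus ?thesis by simp
qed

lemma finite_sieved_below: "finite (sieved_below S Y)"
proof (rule finite_subset)
  show "sieved_below S Y \<subseteq> {..nat \<lceil>Y\<rceil>}" by (auto simp: sieved_below_def le_nat_iff) linarith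
qed simp

lemma sieved_below_empty: "sieved_below {} Y = {1..<nat \<lceil>Y\<rceil>}"
  by (auto simp: sieved_below_def) linarith+

lemma sieved_below_eq_Un:
  assumes new_prime: "prime p" "p \<notin> S" and primes_S: "\<forall>q\<in>S. prime q"
  shows "sieved_below S Y = sieved_below (insert p S) Y \<union> (\<lambda>m. p * m) ` sieved_below S (Y / real p)"
proof (intro equalityI subsetI)
  have p_ge_1: "p \<ge> 1" using prime_ge_1_nat[OF new_prime(1)] .
  have dvd_iff: "q dvd p * m \<longleftrightarrow> q dvd m" if "q \<in> S" for q m
    using that primes_S new_prime primes_dvd_imp_eq[of q p] by (auto simp: prime_dvd_mult_iff)
  fix n
  {
    assume n_mem: "n \<in> sieved_below S Y"
    show "n \<in> sieved_below (insert p S) Y \<union> (\<lambda>m. p * m) ` sieved_below S (Y / real p)"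
    proof (cases "p dvd n")
      case True
      then obtain m where n_eq: "n = p * m" by blast
      have "m \<ge> 1" using n_mem n_eq by (cases m) (auto simp: sieved_below_def)
      hence "m \<in> sieved_below S (Y / real p)"
        using n_mem n_eq p_ge_1 dvd_iff by (auto simp: sieved_below_def field_simps)
      thus ?thesis using n_eq by blast
    next
      case False
      thus ?thesis using n_mem by (auto simp: sieved_below_def)
    qed
  next
    assume "n \<in> sieved_below (insert p S) Y \<union> (\<lambda>m. p * m) ` sieved_below S (Y / real p)"
    thus "n \<in> sieved_below S Y" using p_ge_1 dvd_iff by (auto simp: sieved_below_def field_simps)
  }
qed

lemma of_nat_mult_powr:
  assumes "m \<ge> 1" "n \<ge> 1"
  shows "of_nat (m * n) powr (z::complex) = of_nat m powr z * of_nat n powr z"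
proof -
  have "m * n \<ge> 1" using assms by simp
  thus ?thesis using assms by (simp only: nat_powr_eq_exp) (simp add: ln_mult distrib_left exp_add)
qed

lemma sieved_sum_insert:
  assumes "prime p" "p \<notin> S" "\<forall>q\<in>S. prime q"
  shows "sieved_sum (insert p S) Y s = sieved_sum S Y s - of_nat p powr (-s) * sieved_sum S (Y / real p) s"
proof -
  let ?B = "(\<lambda>m. p * m) ` sieved_below S (Y / real p)"
  have p_ge_1: "p \<ge> 1" using prime_ge_1_nat[OF assms(1)] .
  hence inj: "inj_on (\<lambda>m. p * m) (sieved_below S (Y / real p))" by (auto simp: inj_on_def)
  have "sieved_sum S Y s = sieved_sum (insert p S) Y s + (\<Sum>n\<in>?B. of_nat n powr (-s))"
    unfolding sieved_sum_def sieved_below_eq_Un[OF assms, of Y]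
    by (intro sum.union_disjoint finite_imageI finite_sieved_below) (auto simp: sieved_below_def)
  also have "(\<Sum>n\<in>?B. of_nat n powr (-s)) = (\<Sum>m\<in>sieved_below S (Y / real p). of_nat (p * m) powr (-s))"
    by (subst sum.reindex[OF inj]) (simp only: o_def)
  also have "\<dots> = of_nat p powr (-s) * sieved_sum S (Y / real p) s"
    unfolding sieved_sum_def sum_distrib_left
    using p_ge_1 by (intro sum.cong refl of_nat_mult_powr) (auto simp: sieved_below_def)
  finally show ?thesis by simp
qed

lemma sieve_error_insert:
  assumes "prime p" "p \<notin> S" "\<forall>q\<in>S. prime q" "finite S"
  shows "sieve_error (insert p S) Y s = sieve_error S Y s - of_nat p powr (-s) * sieve_error S (Y / real p) s"
  using assms unfolding sieve_error_def sieved_sum_insert[OF assms(1-3)] sieved_zeta_def euler_factor_def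
  by (simp add: algebra_simps)

lemma sum_powr_le_powr_tail:
  assumes "finite A" "A \<subseteq> {N..}" "a > 1"
  shows "(\<Sum>n\<in>A. real n powr (-a)) \<le> powr_tail a N"
proof -
  have "(\<Sum>n\<in>A. real n powr (-a)) = (\<Sum>i\<in>(\<lambda>n. n - N) ` A. real (i + N) powr (-a))"
    using assms(2) by (intro sum.reindex_bij_witness[of _ "\<lambda>i. i + N" "\<lambda>n. n - N"]) auto
  also have "\<dots> \<le> powr_tail a N"
    unfolding powr_tail_def using assms by (intro sum_le_suminf summable_shifted_powr) auto
  finally show ?thesis .
qed

lemma filterlim_nat_ceiling: "filterlim (\<lambda>Y::real. nat \<lceil>Y\<rceil>) sequentially at_top"
  unfolding filterlim_at_top
proof
  fix Z :: nat
  show "\<forall>\<^sub>F Y in at_top. Z \<le> nat \<lceil>Y::real\<rceil>"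
    using eventually_ge_at_top[of "real Z"] by eventually_elim linarith
qed

lemma zeta_sieve_error_integral_le:
  fixes T Y :: real
  assumes \<sigma>_bounds: "1 / 2 < \<sigma>0" "\<sigma>0 < 1" "\<sigma>0 \<le> \<sigma>" "\<sigma> \<le> 3" and Y_pos: "Y > 0"
    and T_bounds: "1 \<le> T" "real (nat \<lceil>Y\<rceil>) \<le> T"
  shows "integral {1..T} (\<lambda>t. (cmod (sieve_error {} Y (Complex \<sigma> t)))\<^sup>2)
           \<le> 16000 * T * (powr_tail (2 * \<sigma>0) (nat \<lceil>Y\<rceil>) + (2 * T) powr (1 - 2 * \<sigma>0))"
proof -
  let ?E = "\<lambda>t. (cmod (sieve_error {} Y (Complex \<sigma> t)))\<^sup>2"
  define y X where "y = nat \<lceil>Y\<rceil>" and "X = nat \<lceil>T\<rceil>"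
  have y_ge_1: "y \<ge> 1" using Y_pos unfolding y_def by linarith
  have X_bounds: "T \<le> real X" "real X \<le> 2 * T" "y \<le> X" using T_bounds unfolding X_def y_def by linarith+
  have "?E integrable_on {1..real X}"
    by (intro integrable_continuous_interval continuous_intros continuous_on_sieve_error_vertical) auto
  hence "integral {1..T} ?E \<le> integral {1..real X} ?E"
    by (rule integral_subinterval_le(2)) (use X_bounds in auto)
  also have "\<dots> \<le> 8000 * (real X * (\<Sum>n=y..<X. real n powr (-(2 * \<sigma>0))) + real X powr (2 - 2 * \<sigma>0))"
    using zeta_mean_square[of \<sigma>0 \<sigma> y X] \<sigma>_bounds y_ge_1 X_bounds
    by (simp add: sieve_error_def sieved_zeta_def euler_factor_def sieved_sum_def sieved_below_empty y_def)
  also have "\<dots> \<le> 8000 * (2 * T * powr_tail (2 * \<sigma>0) y + 2 * T * (2 * T) powr (1 - 2 * \<sigma>0))"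
  proof (intro mult_left_mono add_mono mult_mono)
    show "(\<Sum>n=y..<X. real n powr (-(2 * \<sigma>0))) \<le> powr_tail (2 * \<sigma>0) y"
      using \<sigma>_bounds by (intro sum_powr_le_powr_tail) auto
    have "real X powr (2 - 2 * \<sigma>0) \<le> (2 * T) powr (2 - 2 * \<sigma>0)" using X_bounds \<sigma>_bounds by (intro powr_mono2) auto
    also have "\<dots> = 2 * T * (2 * T) powr (1 - 2 * \<sigma>0)"
      using T_bounds powr_add[of "2 * T" 1 "1 - 2 * \<sigma>0"] by simp
    finally show "real X powr (2 - 2 * \<sigma>0) \<le> 2 * T * (2 * T) powr (1 - 2 * \<sigma>0)" .
  qed (use X_bounds T_bounds in \<open>auto intro: sum_nonneg\<close>)
  finally show ?thesis by (simp add: y_def algebra_simps)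
qed

lemma zeta_sieve_error_mean_square:
  assumes \<sigma>0_bounds: "1 / 2 < \<sigma>0" "\<sigma>0 < 1" and "\<eta> > 0"
  shows "\<forall>\<^sub>F Y in at_top. \<forall>\<^sub>F T in at_top. \<forall>\<sigma>\<in>{\<sigma>0..3}.
           integral {1..T} (\<lambda>t. (cmod (sieve_error {} Y (Complex \<sigma> t)))\<^sup>2) \<le> \<eta> * T"
proof -
  have tolerance_pos: "\<eta> / 32000 > 0" using assms by simp
  have "((\<lambda>T. (2 * T) powr (1 - 2 * \<sigma>0)) \<longlongrightarrow> 0) at_top"
    using \<sigma>0_bounds by (intro tendsto_neg_powr filterlim_tendsto_pos_mult_at_top[of _ 2] filterlim_ident) auto
  hence powr_small: "\<forall>\<^sub>F T in at_top. (2 * T) powr (1 - 2 * \<sigma>0) < \<eta> / 32000"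
    using tolerance_pos by (rule order_tendstoD)
  have "((\<lambda>Y::real. powr_tail (2 * \<sigma>0) (nat \<lceil>Y\<rceil>)) \<longlongrightarrow> 0) at_top"
    using \<sigma>0_bounds by (intro filterlim_compose[OF powr_tail_tendsto_0 filterlim_nat_ceiling]) auto
  hence "\<forall>\<^sub>F Y::real in at_top. powr_tail (2 * \<sigma>0) (nat \<lceil>Y\<rceil>) < \<eta> / 32000"
    using tolerance_pos by (rule order_tendstoD)
  thus ?thesis using eventually_gt_at_top[of 0]
  proof eventually_elim
    case (elim Y)
    show ?case using powr_small eventually_ge_at_top[of 1] eventually_ge_at_top[of "real (nat \<lceil>Y\<rceil>)"]
    proof (eventually_elim, intro ballI)
      fix T \<sigma>
      assume T_bounds: "(2 * T) powr (1 - 2 * \<sigma>0) < \<eta> / 32000" "1 \<le> T" "real (nat \<lceil>Y\<rceil>) \<le> T"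
        and \<sigma>_mem: "\<sigma> \<in> {\<sigma>0..3}"
      have "integral {1..T} (\<lambda>t. (cmod (sieve_error {} Y (Complex \<sigma> t)))\<^sup>2)
          \<le> 16000 * T * (powr_tail (2 * \<sigma>0) (nat \<lceil>Y\<rceil>) + (2 * T) powr (1 - 2 * \<sigma>0))"
        using \<sigma>0_bounds \<sigma>_mem T_bounds elim by (intro zeta_sieve_error_integral_le) auto
      also have "\<dots> \<le> 16000 * T * (\<eta> / 32000 + \<eta> / 32000)" using T_bounds elim by (intro mult_left_mono) auto
      finally show "integral {1..T} (\<lambda>t. (cmod (sieve_error {} Y (Complex \<sigma> t)))\<^sup>2) \<le> \<eta> * T" by (simp add: mult_ac)
    qed
  qed
qed

lemma sieve_error_insert_mean_square_le:
  assumes "prime p" "p \<notin> S" "\<forall>q\<in>S. prime q" "finite S" "\<sigma> \<ge> 0"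
  shows "integral {1..T} (\<lambda>t. (cmod (sieve_error (insert p S) Y (Complex \<sigma> t)))\<^sup>2)
    \<le> 2 * integral {1..T} (\<lambda>t. (cmod (sieve_error S Y (Complex \<sigma> t)))\<^sup>2)
      + 2 * integral {1..T} (\<lambda>t. (cmod (sieve_error S (Y / real p) (Complex \<sigma> t)))\<^sup>2)"
proof -
  let ?E = "\<lambda>S Y t. (cmod (sieve_error S Y (Complex \<sigma> t)))\<^sup>2"
  have integrable: "?E S Y integrable_on {1..T}" if "\<forall>q\<in>S. prime q" for S Y
    using that by (intro integrable_continuous_interval continuous_intros continuous_on_sieve_error_vertical) auto
  have pointwise: "?E (insert p S) Y t \<le> 2 * ?E S Y t + 2 * ?E S (Y / real p) t" for t
  proof -
    let ?s = "Complex \<sigma> t"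
    have "real p powr (-\<sigma>) \<le> 1" using assms prime_ge_1_nat[OF assms(1)] by (intro nat_powr_le_1)
    hence "cmod (of_nat p powr (- ?s)) * cmod (sieve_error S (Y / real p) ?s)
      \<le> cmod (sieve_error S (Y / real p) ?s)"
      using prime_gt_0_nat[OF assms(1)] by (intro mult_left_le_one_le) auto
    hence "(cmod (- (of_nat p powr (- ?s) * sieve_error S (Y / real p) ?s)))\<^sup>2 \<le> ?E S (Y / real p) t"
      unfolding norm_minus_cancel norm_mult by (intro power_mono) auto
    thus ?thesis
      using norm_add_square_le[of "sieve_error S Y ?s" "- (of_nat p powr (- ?s) * sieve_error S (Y / real p) ?s)"]
      unfolding sieve_error_insert[OF assms(1-4)] diff_conv_add_uminus by linarith
  qed
  have "integral {1..T} (?E (insert p S) Y) \<le> integral {1..T} (\<lambda>t. 2 * ?E S Y t + 2 * ?E S (Y / real p) t)"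
    using assms by (intro integral_le integrable integrable_add integrable_on_mult_right pointwise) auto
  also have "\<dots> = 2 * integral {1..T} (?E S Y) + 2 * integral {1..T} (?E S (Y / real p))"
    using integrable[OF assms(3)] by (subst integral_add) (auto intro!: integrable_on_mult_right)
  finally show ?thesis .
qed

lemma filterlim_divide_const_at_top:
  assumes "c > (0::real)"
  shows "filterlim (\<lambda>Y. Y / c) at_top at_top"
  using assms filterlim_tendsto_pos_mult_at_top[OF tendsto_const[of "1 / c"] _ filterlim_ident] by simp

lemma sieve_error_mean_square:
  assumes "finite S" "\<forall>p\<in>S. prime p" and \<sigma>0_bounds: "1 / 2 < \<sigma>0" "\<sigma>0 < 1" and "\<eta> > 0"
  shows "\<forall>\<^sub>F Y in at_top. \<forall>\<^sub>F T in at_top. \<forall>\<sigma>\<in>{\<sigma>0..3}.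
           integral {1..T} (\<lambda>t. (cmod (sieve_error S Y (Complex \<sigma> t)))\<^sup>2) \<le> \<eta> * T"
  using assms(1,2,5)
proof (induction S arbitrary: \<eta> rule: finite_induct)
  case empty
  thus ?case by (intro zeta_sieve_error_mean_square \<sigma>0_bounds)
next
  case (insert p S)
  have primes: "prime p" "\<forall>q\<in>S. prime q" "real p > 0" using insert.prems by (auto intro: prime_gt_0_nat)
  have IH: "\<forall>\<^sub>F Y in at_top. \<forall>\<^sub>F T in at_top. \<forall>\<sigma>\<in>{\<sigma>0..3}.
      integral {1..T} (\<lambda>t. (cmod (sieve_error S Y (Complex \<sigma> t)))\<^sup>2) \<le> \<eta> / 4 * T"
    using insert.prems primes by (intro insert.IH) auto
  show ?case using IH eventually_compose_filterlim[OF IH filterlim_divide_const_at_top[OF primes(3)]]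
  proof eventually_elim
    case (elim Y)
    show ?case using elim
    proof (eventually_elim, intro ballI)
      fix T \<sigma> assume integral_bounds: "\<forall>\<sigma>\<in>{\<sigma>0..3}. integral {1..T}
        (\<lambda>t. (cmod (sieve_error S Y (Complex \<sigma> t)))\<^sup>2) \<le> \<eta> / 4 * T"
        "\<forall>\<sigma>\<in>{\<sigma>0..3}. integral {1..T} (\<lambda>t. (cmod (sieve_error S (Y / real p) (Complex \<sigma> t)))\<^sup>2) \<le> \<eta> / 4 * T"
        and \<sigma>_mem: "\<sigma> \<in> {\<sigma>0..3}"
      have "\<sigma> \<ge> 0" using \<sigma>_mem \<sigma>0_bounds by auto
      from sieve_error_insert_mean_square_le[OF primes(1) insert.hyps(2) primes(2) insert.hyps(1) this, of T Y]
        bspec[OF integral_bounds(1) \<sigma>_mem] bspec[OF integral_bounds(2) \<sigma>_mem]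
      show "integral {1..T} (\<lambda>t. (cmod (sieve_error (insert p S) Y (Complex \<sigma> t)))\<^sup>2) \<le> \<eta> * T" by linarith
    qed
  qed
qed

lemma sieve_error_tendsto_0:
  assumes "finite S" "\<forall>p\<in>S. prime p" "Re s > 1"
  shows "((\<lambda>Y. sieve_error S Y s) \<longlongrightarrow> 0) at_top"
  using assms(1,2)
proof (induction S rule: finite_induct)
  case empty
  have "(\<lambda>n. \<Sum>k=1..<n. of_nat k powr (-s)) \<longlonglongrightarrow> zeta s"
  proof (rule LIMSEQ_imp_Suc)
    have "(\<Sum>k<n. of_nat (Suc k) powr (-s)) = (\<Sum>k=1..<Suc n. of_nat k powr (-s))" for n
      by (rule sum.reindex_bij_witness[of _ "\<lambda>k. k - 1" Suc]) auto
    thus "(\<lambda>n. \<Sum>k=1..<Suc n. of_nat k powr (-s)) \<longlonglongrightarrow> zeta s"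
      using dirichlet_zeta_sums[OF assms(3)] zeta_eq_dirichlet_zeta[OF assms(3)] by (simp add: sums_def)
  qed
  from filterlim_compose[OF this filterlim_nat_ceiling]
  have "((\<lambda>Y. sieved_sum {} Y s) \<longlongrightarrow> zeta s) at_top"
    by (simp add: sieved_sum_def sieved_below_empty)
  from tendsto_diff[OF tendsto_const[of "zeta s"] this] show ?case
    by (simp add: sieve_error_def sieved_zeta_def euler_factor_def)
next
  case (insert p S)
  have primes: "prime p" "\<forall>q\<in>S. prime q" "real p > 0" using insert.prems by (auto intro: prime_gt_0_nat)
  have IH: "((\<lambda>Y. sieve_error S Y s) \<longlongrightarrow> 0) at_top" using insert.IH primes by blast
  have "((\<lambda>Y. sieve_error S Y s - of_nat p powr (-s) * sieve_error S (Y / real p) s)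
    \<longlongrightarrow> 0 - of_nat p powr (-s) * 0) at_top"
    by (intro tendsto_intros IH filterlim_compose[OF IH filterlim_divide_const_at_top] primes)
  thus ?case using sieve_error_insert[OF primes(1) insert.hyps(2) primes(2) insert.hyps(1)] by simp
qed

lemma prime_factors_sieved_below:
  assumes "n \<in> sieved_below (primes_upto N) Y"
  shows "prime_factors n \<subseteq> {N<..}"
  using assms by (auto simp: sieved_below_def prime_factors_dvd not_le[symmetric])

lemma sieved_below_minus_1_subset: "sieved_below (primes_upto N) Y - {1} \<subseteq> {Suc N..}"
proof
  fix n assume n_mem: "n \<in> sieved_below (primes_upto N) Y - {1}"
  then obtain q where q_mem: "q \<in> prime_factors n"
    using prime_factor_nat[of n] by (auto simp: sieved_below_def prime_factors_dvd)
  hence "N < q" "q \<le> n" using n_mem prime_factors_sieved_below[of n N Y]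
    by (auto simp: prime_factors_dvd sieved_below_def intro: dvd_imp_le)
  thus "n \<in> {Suc N..}" by simp
qed

lemma sieved_sum_eq_1_plus:
  assumes "Y > 1"
  shows "sieved_sum (primes_upto N) Y s = 1 + (\<Sum>n\<in>sieved_below (primes_upto N) Y - {1}. of_nat n powr (-s))"
proof -
  have "1 \<in> sieved_below (primes_upto N) Y" using assms by (auto simp: sieved_below_def)
  thus ?thesis unfolding sieved_sum_def by (simp add: sum.remove[OF finite_sieved_below])
qed

lemma sum_sieved_below_powr_le:
  assumes "a > 1"
  shows "(\<Sum>n\<in>sieved_below (primes_upto N) Y - {1}. real n powr (-a)) \<le> powr_tail a (Suc N)"
  using assms sieved_below_minus_1_subset by (intro sum_powr_le_powr_tail) (auto simp: finite_sieved_below)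

lemma norm_sieved_zeta_minus_1_le:
  assumes "a > 1" "Re s \<ge> a"
  shows "cmod (sieved_zeta (primes_upto N) s - 1) \<le> powr_tail a (Suc N)"
proof -
  let ?S = "primes_upto N"
  have "((\<lambda>Y. sieve_error ?S Y s) \<longlongrightarrow> 0) at_top" using assms by (intro sieve_error_tendsto_0) auto
  from tendsto_diff[OF tendsto_const[of "sieved_zeta ?S s - 1"] this]
  have "((\<lambda>Y. sieved_sum ?S Y s - 1) \<longlongrightarrow> sieved_zeta ?S s - 1) at_top"
    by (simp add: sieve_error_def algebra_simps)
  hence "((\<lambda>Y. cmod (sieved_sum ?S Y s - 1)) \<longlongrightarrow> cmod (sieved_zeta ?S s - 1)) at_top" by (rule tendsto_norm)
  moreover have "\<forall>\<^sub>F Y in at_top. cmod (sieved_sum ?S Y s - 1) \<le> powr_tail a (Suc N)"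
    using eventually_gt_at_top[of 1]
  proof eventually_elim
    case (elim Y)
    have "cmod (sieved_sum ?S Y s - 1) \<le> (\<Sum>n\<in>sieved_below ?S Y - {1}. real n powr (-a))"
      unfolding sieved_sum_eq_1_plus[OF elim] add_diff_cancel_left'
      using assms by (intro sum_norm_le) (auto simp: sieved_below_def intro!: powr_mono)
    thus ?case using sum_sieved_below_powr_le[OF assms(1), of N Y] by linarith
  qed
  ultimately show ?thesis by (rule tendsto_upperbound) simp
qed

section \<open>The logarithm of the zeta function\<close>

definition euler_log :: "complex \<Rightarrow> nat \<Rightarrow> complex" where
  "euler_log s n = (if prime n then - Ln (1 - of_nat n powr (-s)) else 0)"

lemma norm_nat_powr_less_1:
  assumes "n \<ge> 2" "Re s > 0"
  shows "cmod (of_nat n powr (-s)) < 1"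
proof -
  have "real n powr (- Re s) < real n powr 0" using assms by (intro powr_less_mono) auto
  thus ?thesis using assms by simp
qed

lemma norm_nat_powr_less_half:
  assumes "n \<ge> 2" "Re s > 1"
  shows "cmod (of_nat n powr (-s)) < 1 / 2"
proof -
  have "real n powr (- Re s) \<le> 2 powr (- Re s)" using assms by (intro powr_mono2') auto
  also have "\<dots> < 2 powr (-1)" using assms by (intro powr_less_mono) auto
  also have "\<dots> = 1 / 2" by (simp add: powr_minus)
  finally show ?thesis by simp
qed

lemma one_minus_not_nonpos_Reals: "cmod w < 1 \<Longrightarrow> 1 - w \<notin> \<real>\<^sub>\<le>\<^sub>0"
  using complex_Re_le_cmod[of w] by (auto simp: complex_nonpos_Reals_iff)

lemma norm_euler_log_le:
  assumes "Re s > 1"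
  shows "cmod (euler_log s n) \<le> 2 * real n powr (- Re s)"
proof (cases "prime n")
  case True
  with norm_Ln_le[of "- (of_nat n powr (-s))"] norm_nat_powr_less_half[OF prime_ge_2_nat[OF True] assms]
  show ?thesis by (simp add: euler_log_def)
qed (simp add: euler_log_def)

lemma summable_norm_euler_log:
  assumes "Re s > 1"
  shows "summable (\<lambda>n. cmod (euler_log s n))"
proof (rule summable_comparison_test'[of "\<lambda>n. 2 * real n powr (- Re s)" 0])
  show "summable (\<lambda>n. 2 * real n powr (- Re s))"
    using assms by (intro summable_mult) (simp add: summable_real_powr_iff)
qed (use norm_euler_log_le[OF assms] in auto)

lemma summable_euler_log: "Re s > 1 \<Longrightarrow> summable (euler_log s)"
  by (rule summable_norm_cancel) (rule summable_norm_euler_log)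

lemma infsum_power_divide_eq_Ln:
  assumes "cmod w < 1"
  shows "(\<Sum>\<^sub>\<infinity>k\<in>{1::nat..}. w ^ k / of_nat k) = - Ln (1 - w)"
proof (rule infsumI)
  have "(\<lambda>n. - ((- (- w)) ^ n) / of_nat n) sums ln (1 + (- w))" by (rule Ln_series') (use assms in simp)
  from sums_minus[OF this] have sums: "(\<lambda>n. w ^ n / of_nat n) sums (- Ln (1 - w))" by simp
  have "summable (\<lambda>n. cmod (w ^ n / of_nat n))"
  proof (rule summable_comparison_test'[of "\<lambda>n. cmod w ^ n" 0])
    show "summable (\<lambda>n. cmod w ^ n)" using assms by (intro summable_geometric) simp
    show "norm (cmod (w ^ n / of_nat n)) \<le> cmod w ^ n" for n
      by (cases "n = 0") (auto simp: norm_divide norm_power divide_le_eq mult_le_cancel_left1)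
  qed
  from norm_summable_imp_has_sum[OF this sums]
  show "((\<lambda>n. w ^ n / of_nat n) has_sum (- Ln (1 - w))) {1::nat..}"
    by (rule has_sum_cong_neutral[THEN iffD1, rotated -1]) auto
qed

lemma log_zeta_series_eq_suminf:
  assumes "Re s > 1"
  shows "log_zeta_series s = (\<Sum>n. euler_log s n)"
proof -
  have local_factor: "(\<Sum>\<^sub>\<infinity>k\<in>{1::nat..}. of_nat p powr (- (of_nat k * s)) / of_nat k) = euler_log s p"
    if prime_p: "prime p" for p
  proof -
    have powr: "of_nat p powr (- (of_nat k * s)) = (of_nat p powr (-s)) ^ k" for k
      using prime_ge_1_nat[OF prime_p] by (simp add: nat_powr_eq_exp mult.assoc flip: exp_of_nat_mult)
    have "cmod (of_nat p powr (-s)) < 1"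
      using prime_ge_2_nat[OF prime_p] assms by (intro norm_nat_powr_less_1) auto
    thus ?thesis using prime_p by (simp only: powr infsum_power_divide_eq_Ln euler_log_def if_True)
  qed
  have "(euler_log s has_sum (\<Sum>n. euler_log s n)) UNIV"
    using assms
    by (intro norm_summable_imp_has_sum summable_norm_euler_log summable_sums summable_euler_log)
  hence "(euler_log s has_sum (\<Sum>n. euler_log s n)) {p. prime p}"
    by (rule has_sum_cong_neutral[THEN iffD1, rotated -1]) (auto simp: euler_log_def)
  moreover have "log_zeta_series s = infsum (euler_log s) {p. prime p}"
    unfolding log_zeta_series_def by (intro infsum_cong local_factor) simp
  ultimately show ?thesis by (simp add: infsumI)
qed

lemma holomorphic_euler_log:
  assumes "A \<subseteq> {s. Re s > 0}"
  shows "(\<lambda>s. euler_log s n) holomorphic_on A"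
proof (cases "prime n")
  case True
  hence "n \<ge> 2" "n \<ge> 1" by (auto dest: prime_ge_2_nat prime_ge_1_nat)
  hence "(\<lambda>s. - Ln (1 - of_nat n powr (-s))) holomorphic_on A"
    using assms
    by (intro holomorphic_intros holomorphic_nat_powr one_minus_not_nonpos_Reals norm_nat_powr_less_1) auto
  thus ?thesis using True by (simp add: euler_log_def)
qed (simp add: euler_log_def)

lemma euler_log_locally_dominated:
  assumes "Re s > 1"
  shows "\<exists>d>0. \<exists>h. cball s d \<subseteq> {s. Re s > 1} \<and> summable h \<and>
           (\<forall>n. \<forall>z\<in>cball s d. cmod (euler_log z n) \<le> h n)"
proof -
  define d where "d = (Re s - 1) / 2"
  have d_bounds: "d > 0" "Re s - d > 1" using assms by (auto simp: d_def field_simps)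
  have Re_ge: "Re z \<ge> Re s - d" if "z \<in> cball s d" for z
    using that abs_Re_le_cmod[of "s - z"] by (simp add: dist_norm)
  have "summable (\<lambda>n. 2 * real n powr (- (Re s - d)))"
    using d_bounds by (intro summable_mult) (simp add: summable_real_powr_iff)
  moreover have "cmod (euler_log z n) \<le> 2 * real n powr (- (Re s - d))" if z_mem: "z \<in> cball s d" for n z
  proof (cases "n \<ge> 1")
    case True
    have "cmod (euler_log z n) \<le> 2 * real n powr (- Re z)"
      using Re_ge[OF z_mem] d_bounds by (intro norm_euler_log_le) simp
    also have "\<dots> \<le> 2 * real n powr (- (Re s - d))"
      using Re_ge[OF z_mem] True by (intro mult_left_mono powr_mono) auto
    finally show ?thesis .
  next
    case False
    thus ?thesis by (auto simp: euler_log_def dest: prime_ge_1_nat)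
  qed
  moreover have "cball s d \<subseteq> {s. Re s > 1}" using Re_ge d_bounds by force
  ultimately show ?thesis using d_bounds(1) by blast
qed

lemma holomorphic_log_zeta_series: "log_zeta_series holomorphic_on {s. Re s > 1}"
proof (rule holomorphic_transform)
  show "(\<lambda>s. \<Sum>n. euler_log s n) holomorphic_on {s. Re s > 1}"
    by (intro holomorphic_suminf open_halfspace_Re_gt holomorphic_euler_log euler_log_locally_dominated) auto
qed (simp add: log_zeta_series_eq_suminf)

lemma sum_euler_log_upto: "(\<Sum>n\<le>N. euler_log s n) = (\<Sum>p\<in>primes_upto N. euler_log s p)"
  by (rule sum.mono_neutral_right) (auto simp: euler_log_def)

lemma exp_sum_euler_log:
  assumes "Re s > 0" "finite S" "\<forall>p\<in>S. prime p"
  shows "exp (\<Sum>p\<in>S. euler_log s p) * euler_factor S s = 1"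
proof -
  have "exp (euler_log s p) * (1 - of_nat p powr (-s)) = 1" if "p \<in> S" for p
  proof -
    have "cmod (of_nat p powr (-s)) < 1"
      using assms that by (intro norm_nat_powr_less_1) (auto dest: prime_ge_2_nat)
    hence "of_nat p powr (-s) \<noteq> (1::complex)" by (metis norm_one less_irrefl)
    thus ?thesis using assms that by (simp add: euler_log_def exp_minus)
  qed
  thus ?thesis using assms(2) by (simp add: euler_factor_def exp_sum flip: prod.distrib)
qed

lemma zeta_eq_sieved_zeta_mult_exp:
  assumes "Re s > 0" "finite S" "\<forall>p\<in>S. prime p"
  shows "zeta s = sieved_zeta S s * exp (\<Sum>p\<in>S. euler_log s p)"
  using exp_sum_euler_log[OF assms] by (simp add: sieved_zeta_def mult.assoc mult.commute[of "euler_factor S s"])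

lemma exp_log_zeta_series:
  assumes "Re s > 1"
  shows "exp (log_zeta_series s) = zeta s"
proof -
  have "(\<lambda>N. sieved_zeta (primes_upto N) s - 1) \<longlonglongrightarrow> 0"
  proof (rule Lim_null_comparison)
    show "\<forall>\<^sub>F N in sequentially. cmod (sieved_zeta (primes_upto N) s - 1) \<le> powr_tail (Re s) (Suc N)"
      using assms by (intro always_eventually allI norm_sieved_zeta_minus_1_le) auto
    show "(\<lambda>N. powr_tail (Re s) (Suc N)) \<longlonglongrightarrow> 0"
      using powr_tail_tendsto_0[OF assms] by (rule LIMSEQ_Suc)
  qed
  hence "(\<lambda>N. sieved_zeta (primes_upto N) s) \<longlonglongrightarrow> 1" by (simp add: LIM_zero_iff)
  moreover have "(\<lambda>N. exp (\<Sum>n\<le>N. euler_log s n)) \<longlonglongrightarrow> exp (log_zeta_series s)"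
    unfolding log_zeta_series_eq_suminf[OF assms]
    by (intro tendsto_exp summable_LIMSEQ' summable_euler_log assms)
  ultimately have "(\<lambda>N. sieved_zeta (primes_upto N) s * exp (\<Sum>n\<le>N. euler_log s n))
      \<longlonglongrightarrow> 1 * exp (log_zeta_series s)"
    by (rule tendsto_mult)
  moreover have "sieved_zeta (primes_upto N) s * exp (\<Sum>n\<le>N. euler_log s n) = zeta s" for N
    unfolding sum_euler_log_upto
    by (rule zeta_eq_sieved_zeta_mult_exp[symmetric]) (use assms in auto)
  ultimately have "(\<lambda>N::nat. zeta s) \<longlonglongrightarrow> exp (log_zeta_series s)" by simp
  thus ?thesis by (simp add: LIMSEQ_const_iff)
qed

lemma zeta_nonzero: "Re s > 1 \<Longrightarrow> zeta s \<noteq> 0"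
  using exp_log_zeta_series by (metis exp_not_eq_zero)

lemma connected_right_ray: "connected (right_ray s)"
proof -
  have "right_ray s = {z. Im z \<ge> Im s} \<inter> {z. Im z \<le> Im s} \<inter> {z. Re z \<ge> Re s}"
    by (auto simp: right_ray_def)
  also have "connected \<dots>"
    by (intro convex_connected convex_Int convex_halfspace_Im_ge convex_halfspace_Im_le convex_halfspace_Re_ge)
  finally show ?thesis .
qed

lemma right_ray_continuation_unique:
  assumes U_nbhd: "open U" "right_ray s \<subseteq> U" and V_nbhd: "open V" "right_ray s \<subseteq> V"
    and holomorphic_g: "g holomorphic_on U" and holomorphic_h: "h holomorphic_on V"
    and eq_right: "\<And>z. z \<in> U \<inter> V \<Longrightarrow> Re z > 1 \<Longrightarrow> g z = h z"
  shows "g s = h s"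
proof -
  define C where "C = connected_component_set (U \<inter> V) s"
  have ray: "s \<in> right_ray s" "Complex (max (Re s) 2) (Im s) \<in> right_ray s" by (auto simp: right_ray_def)
  have C_props: "right_ray s \<subseteq> C" "C \<subseteq> U \<inter> V" "open C" "connected C"
    unfolding C_def using U_nbhd V_nbhd ray
    by (intro connected_component_maximal connected_right_ray connected_component_subset
        open_connected_component connected_connected_component open_Int; auto)+
  have "g holomorphic_on C" "h holomorphic_on C"
    using C_props(2) by (auto intro: holomorphic_on_subset[OF holomorphic_g]
      holomorphic_on_subset[OF holomorphic_h])
  moreover have "s \<in> C" "Complex (max (Re s) 2) (Im s) \<in> C" using ray C_props(1) by auto
  ultimately show ?thesis
    by (rule holomorphic_eq_if_eq_on_halfplane[OF _ _ C_props(3,4)]) (use C_props(2) eq_right in auto)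
qed

lemma log_zeta_eqI:
  assumes "open U" "connected U" "right_ray s \<subseteq> U" "g holomorphic_on U"
    and "\<forall>z\<in>U. Re z > 1 \<longrightarrow> g z = log_zeta_series z"
  shows "log_zeta s = g s"
  unfolding log_zeta_def
proof (rule the_equality)
  let ?P = "\<lambda>w U h. open U \<and> connected U \<and> right_ray s \<subseteq> U \<and> h holomorphic_on U \<and>
    (\<forall>z\<in>U. Re z > 1 \<longrightarrow> h z = log_zeta_series z) \<and> h s = w"
  show "\<exists>U h. ?P (g s) U h" using assms by blast
  fix w assume "\<exists>V h. ?P w V h"
  then obtain V h where continuation: "open V" "right_ray s \<subseteq> V" "h holomorphic_on V"
    "\<forall>z\<in>V. Re z > 1 \<longrightarrow> h z = log_zeta_series z" "h s = w"
    by (elim exE conjE)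
  have "h s = g s"
    by (rule right_ray_continuation_unique[OF continuation(1,2) assms(1,3) continuation(3) assms(4)])
      (use continuation(4) assms(5) in auto)
  thus "w = g s" using continuation(5) by simp
qed

definition half_strip :: "real \<Rightarrow> real \<Rightarrow> real \<Rightarrow> complex set" where
  "half_strip a b c = {z. a < Re z \<and> b < Im z \<and> Im z < c}"

lemma half_strip_eq_Int: "half_strip a b c = {z. Re z > a} \<inter> ({z. Im z > b} \<inter> {z. Im z < c})"
  by (auto simp: half_strip_def)

lemma open_half_strip: "open (half_strip a b c)"
  unfolding half_strip_eq_Int
  by (intro open_Int open_halfspace_Re_gt open_halfspace_Im_gt open_halfspace_Im_lt)

lemma convex_half_strip: "convex (half_strip a b c)"
  unfolding half_strip_eq_Int
  by (intro convex_Int convex_halfspace_Re_gt convex_halfspace_Im_gt convex_halfspace_Im_lt)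

lemma right_ray_subset_half_strip: "z \<in> half_strip a b c \<Longrightarrow> right_ray z \<subseteq> half_strip a b c"
  by (auto simp: half_strip_def right_ray_def)

lemma half_strip_subset_log_zeta_dom:
  assumes "\<forall>z\<in>half_strip a b c. z \<noteq> 1 \<and> zeta z \<noteq> 0"
  shows "half_strip a b c \<subseteq> log_zeta_dom"
  using assms right_ray_subset_half_strip by (fastforce simp: log_zeta_dom_def)

lemma exists_half_strip_in_open:
  assumes "open G" "right_ray s \<subseteq> G" "{z. Re z > a} \<subseteq> G"
  shows "\<exists>a b c. s \<in> half_strip a b c \<and> half_strip a b c \<subseteq> G"
proof -
  define L where "L = cbox s (Complex (max (Re s) a) (Im s))"
  have "L \<subseteq> G" using assms(2) by (auto simp: L_def in_cbox_complex_iff right_ray_def)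
  then obtain e where e_props: "e > 0" "(\<Union>x\<in>L. ball x e) \<subseteq> G"
    using compact_subset_open_imp_ball_epsilon_subset[of L G] assms(1) compact_cbox by (metis L_def)
  have "half_strip (Re s - e / 2) (Im s - e / 2) (Im s + e / 2) \<subseteq> G"
  proof
    fix z assume z_mem: "z \<in> half_strip (Re s - e / 2) (Im s - e / 2) (Im s + e / 2)"
    show "z \<in> G"
    proof (cases "Re z > a")
      case True
      thus ?thesis using assms(3) by auto
    next
      case False
      define x where "x = Complex (max (Re z) (Re s)) (Im s)"
      have "x \<in> L" using False by (auto simp: L_def x_def in_cbox_complex_iff)
      moreover have "\<bar>Re (x - z)\<bar> < e / 2" "\<bar>Im (x - z)\<bar> < e / 2"
        using z_mem e_props(1) by (auto simp: half_strip_def x_def abs_if)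
      hence "cmod (x - z) < e" using cmod_le[of "x - z"] by linarith
      hence "z \<in> ball x e" by (simp add: dist_norm)
      ultimately show ?thesis using e_props(2) by blast
    qed
  qed
  moreover have "s \<in> half_strip (Re s - e / 2) (Im s - e / 2) (Im s + e / 2)"
    using e_props(1) by (simp add: half_strip_def)
  ultimately show ?thesis by blast
qed

lemma exists_zero_free_half_strip:
  assumes "s \<in> log_zeta_dom"
  shows "\<exists>a b c. s \<in> half_strip a b c \<and> (\<forall>z\<in>half_strip a b c. z \<noteq> 1 \<and> zeta z \<noteq> 0)"
proof -
  define G where "G = {z. z \<noteq> 1 \<and> zeta z \<noteq> 0}"
  have "G = - {1} \<inter> zeta -` (- {0})" by (auto simp: G_def)
  hence "open G"
    using continuous_open_preimage[OF holomorphic_on_imp_continuous_on[OF holomorphic_zeta], of "- {0}"]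
    by (simp add: open_Compl)
  moreover have "right_ray s \<subseteq> G" using assms by (auto simp: log_zeta_dom_def G_def)
  moreover have "{z. Re z > 1} \<subseteq> G" using zeta_nonzero by (auto simp: G_def)
  ultimately obtain a b c where "s \<in> half_strip a b c" "half_strip a b c \<subseteq> G"
    using exists_half_strip_in_open by metis
  thus ?thesis unfolding G_def by blast
qed

lemma exp_eq_imp_diff_constant:
  assumes U_region: "open U" "connected U" and holomorphic_fg: "f holomorphic_on U" "g holomorphic_on U"
    and exp_eq: "\<forall>z\<in>U. exp (f z) = exp (g z)"
  shows "\<exists>k. \<forall>z\<in>U. f z = g z + k"
proof -
  define u where "u = (\<lambda>z. f z - g z)"
  have holomorphic_u: "u holomorphic_on U" unfolding u_def by (intro holomorphic_intros holomorphic_fg)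
  have exp_u: "exp (u z) = 1" if "z \<in> U" for z using exp_eq that by (simp add: u_def exp_diff)
  have "(u has_field_derivative 0) (at z)" if z_mem: "z \<in> U" for z
  proof -
    obtain u' where derivative: "(u has_field_derivative u') (at z)"
      using holomorphic_u z_mem U_region(1) by (auto simp: holomorphic_on_open)
    hence "((\<lambda>z. exp (u z)) has_field_derivative exp (u z) * u') (at z)" by (auto intro!: derivative_eq_intros)
    moreover have "((\<lambda>z. exp (u z)) has_field_derivative 0) (at z)"
      by (rule has_field_derivative_transform_within_open[OF DERIV_const U_region(1) z_mem]) (simp add: exp_u)
    ultimately have "exp (u z) * u' = 0" by (rule DERIV_unique)
    thus ?thesis using derivative by simp
  qed
  then obtain k where "\<And>z. z \<in> U \<Longrightarrow> u z = k"
    using has_field_derivative_0_imp_constant_on[of U u] U_region unfolding constant_on_def by blast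
  thus ?thesis unfolding u_def by (metis diff_eq_eq add.commute)
qed

lemma log_zeta_eq_holomorphic_logarithm:
  assumes holomorphic_h: "h holomorphic_on half_strip a b c" and exp_h: "\<forall>z\<in>half_strip a b c. exp (h z) = zeta z"
  shows "\<exists>k. \<forall>z\<in>half_strip a b c. log_zeta z = h z + k"
proof -
  let ?U = "half_strip a b c" and ?U1 = "half_strip (max a 1) b c"
  have U1_eq: "?U1 = ?U \<inter> {z. Re z > 1}" by (auto simp: half_strip_def)
  have "\<exists>k. \<forall>z\<in>?U1. log_zeta_series z = h z + k"
  proof (rule exp_eq_imp_diff_constant)
    show "connected ?U1" by (intro convex_connected convex_half_strip)
    show "log_zeta_series holomorphic_on ?U1" "h holomorphic_on ?U1"
      unfolding U1_eq by (auto intro: holomorphic_on_subset[OF holomorphic_log_zeta_series]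
        holomorphic_on_subset[OF holomorphic_h])
    show "\<forall>z\<in>?U1. exp (log_zeta_series z) = exp (h z)"
      using exp_h by (auto simp: U1_eq exp_log_zeta_series)
  qed (rule open_half_strip)
  then obtain k where series_eq: "\<forall>z\<in>?U1. log_zeta_series z = h z + k" ..
  have "log_zeta z = h z + k" if "z \<in> ?U" for z
  proof (rule log_zeta_eqI[OF open_half_strip _ right_ray_subset_half_strip[OF that]])
    show "connected ?U" by (intro convex_connected convex_half_strip)
    show "(\<lambda>z. h z + k) holomorphic_on ?U" by (intro holomorphic_intros holomorphic_h)
    show "\<forall>z\<in>?U. Re z > 1 \<longrightarrow> h z + k = log_zeta_series z" using series_eq by (simp add: U1_eq)
  qed
  thus ?thesis by blast
qed

lemma log_zeta_dom_half_strip: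
  assumes "s \<in> log_zeta_dom"
  shows "\<exists>a b c. s \<in> half_strip a b c \<and> half_strip a b c \<subseteq> log_zeta_dom \<and>
           log_zeta holomorphic_on half_strip a b c"
proof -
  obtain a b c where s_mem: "s \<in> half_strip a b c" and zero_free: "\<forall>z\<in>half_strip a b c. z \<noteq> 1 \<and> zeta z \<noteq> 0"
    using exists_zero_free_half_strip[OF assms] by blast
  let ?U = "half_strip a b c"
  have "zeta holomorphic_on ?U" using zero_free by (auto intro: holomorphic_on_subset[OF holomorphic_zeta])
  then obtain h where logarithm: "h holomorphic_on ?U" "\<And>z. z \<in> ?U \<Longrightarrow> exp (h z) = zeta z"
    using holomorphic_logarithm_exists[OF convex_half_strip open_half_strip, of zeta a b c s] s_mem
      zero_free by metis
  then obtain k where log_zeta_eq: "\<forall>z\<in>?U. log_zeta z = h z + k"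
    using log_zeta_eq_holomorphic_logarithm[OF logarithm(1)] by blast
  have "(\<lambda>z. h z + k) holomorphic_on ?U" by (intro holomorphic_intros logarithm)
  hence "log_zeta holomorphic_on ?U" by (rule holomorphic_transform) (simp add: log_zeta_eq)
  thus ?thesis using s_mem half_strip_subset_log_zeta_dom[OF zero_free] by blast
qed

lemma open_log_zeta_dom: "open log_zeta_dom"
  unfolding open_subopen[of log_zeta_dom] using log_zeta_dom_half_strip open_half_strip by metis

lemma continuous_on_log_zeta: "continuous_on log_zeta_dom log_zeta"
proof (rule continuous_at_imp_continuous_on, intro ballI)
  fix s assume "s \<in> log_zeta_dom"
  then obtain a b c where "s \<in> half_strip a b c" "log_zeta holomorphic_on half_strip a b c"
    using log_zeta_dom_half_strip by blast
  thus "isCont log_zeta s"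
    using holomorphic_on_imp_continuous_on[of log_zeta "half_strip a b c"]
    by (simp add: continuous_on_eq_continuous_at[OF open_half_strip])
qed

lemma log_zeta_eq_series:
  assumes "Re s > 1"
  shows "log_zeta s = log_zeta_series s"
  using assms holomorphic_log_zeta_series
  by (intro log_zeta_eqI[where U = "{z. Re z > 1}"])
    (auto simp: right_ray_def intro: open_halfspace_Re_gt convex_connected convex_halfspace_Re_gt)

lemma log_zeta_series_eq_sum_plus_Ln:
  assumes tail: "powr_tail 2 (Suc N) < 1 / 4" and Re_gt_2: "Re s > 2"
  shows "log_zeta_series s = (\<Sum>p\<in>primes_upto N. euler_log s p) + Ln (sieved_zeta (primes_upto N) s)"
proof -
  have Re_gt: "Re s > 1" "Re s > 0" using Re_gt_2 by auto
  define L where "L = (\<Sum>n. euler_log s (n + Suc N))"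
  have split: "log_zeta_series s = L + (\<Sum>p\<in>primes_upto N. euler_log s p)"
    using suminf_split_initial_segment[OF summable_euler_log[OF Re_gt(1)], of "Suc N"]
    by (simp only: log_zeta_series_eq_suminf[OF Re_gt(1)] L_def lessThan_Suc_atMost sum_euler_log_upto)
  have "cmod L \<le> (\<Sum>n. 2 * real (n + Suc N) powr (-2))"
    unfolding L_def
  proof (rule norm_suminf_le)
    fix n
    have "cmod (euler_log s (n + Suc N)) \<le> 2 * real (n + Suc N) powr (- Re s)"
      by (rule norm_euler_log_le[OF Re_gt(1)])
    also have "\<dots> \<le> 2 * real (n + Suc N) powr (-2)" using Re_gt_2 by (intro mult_left_mono powr_mono) auto
    finally show "cmod (euler_log s (n + Suc N)) \<le> 2 * real (n + Suc N) powr (-2)" .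
  qed (intro summable_mult summable_shifted_powr, simp)
  also have "\<dots> = 2 * powr_tail 2 (Suc N)"
    unfolding powr_tail_def by (intro suminf_mult summable_shifted_powr) simp
  finally have "\<bar>Im L\<bar> < pi" using tail abs_Im_le_cmod[of L] pi_gt3 by linarith
  hence "Ln (exp L) = L" by (intro Ln_exp) auto
  moreover have "exp L * exp (\<Sum>p\<in>primes_upto N. euler_log s p)
      = sieved_zeta (primes_upto N) s * exp (\<Sum>p\<in>primes_upto N. euler_log s p)"
    using exp_log_zeta_series[OF Re_gt(1)]
    unfolding split exp_add by (subst zeta_eq_sieved_zeta_mult_exp[symmetric, OF Re_gt(2)]) auto
  ultimately show ?thesis using split by simp
qed

lemma log_zeta_eq_sum_plus_Ln:
  assumes tail: "powr_tail 2 (Suc N) < 1 / 4" and a_nonneg: "a \<ge> 0" and one_not_mem: "1 \<notin> half_strip a b c"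
    and close: "\<forall>z\<in>half_strip a b c. Re z \<le> 2 \<longrightarrow> cmod (sieved_zeta (primes_upto N) z - 1) < 1 / 2"
    and s_mem: "s \<in> half_strip a b c"
  shows "s \<in> log_zeta_dom"
    and "log_zeta s = (\<Sum>p\<in>primes_upto N. euler_log s p) + Ln (sieved_zeta (primes_upto N) s)"
proof -
  let ?S = "primes_upto N" and ?U = "half_strip a b c"
  let ?h = "\<lambda>z. (\<Sum>p\<in>?S. euler_log z p) + Ln (sieved_zeta ?S z)"
  have Re_pos: "Re z > 0" if "z \<in> ?U" for z using that a_nonneg by (auto simp: half_strip_def)
  have close_1: "cmod (1 - sieved_zeta ?S z) < 1" if "z \<in> ?U" for z
  proof -
    have "cmod (sieved_zeta ?S z - 1) < 1 / 2"
      using close that norm_sieved_zeta_minus_1_le[of 2 z N] tail by (cases "Re z \<le> 2") auto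
    thus ?thesis by (simp add: norm_minus_commute)
  qed
  have nonzero: "sieved_zeta ?S z \<noteq> 0" if "z \<in> ?U" for z using close_1[OF that] by auto
  show "s \<in> log_zeta_dom"
    using half_strip_subset_log_zeta_dom[of a b c] s_mem one_not_mem nonzero by (auto simp: sieved_zeta_def)
  have "sieved_zeta ?S holomorphic_on ?U"
    using one_not_mem by (intro holomorphic_on_subset[OF holomorphic_sieved_zeta]) auto
  moreover have "sieved_zeta ?S z \<notin> \<real>\<^sub>\<le>\<^sub>0" if "z \<in> ?U" for z
    using one_minus_not_nonpos_Reals[OF close_1[OF that]] by simp
  ultimately have "?h holomorphic_on ?U"
    using Re_pos by (intro holomorphic_intros holomorphic_euler_log) auto
  moreover have "exp (?h z) = zeta z" if "z \<in> ?U" for z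
  proof -
    have "zeta z = sieved_zeta ?S z * exp (\<Sum>p\<in>?S. euler_log z p)"
      using Re_pos[OF that] by (intro zeta_eq_sieved_zeta_mult_exp) auto
    thus ?thesis unfolding exp_add exp_Ln[OF nonzero[OF that]] by (simp only: mult.commute)
  qed
  ultimately obtain k where log_zeta_eq: "\<forall>z\<in>?U. log_zeta z = ?h z + k"
    using log_zeta_eq_holomorphic_logarithm by blast
  define w where "w = Complex (max 3 (Re s)) (Im s)"
  have "w \<in> ?U" "Re w > 2" using s_mem by (auto simp: w_def half_strip_def)
  hence "?h w + k = ?h w"
    using log_zeta_eq log_zeta_eq_series[of w] log_zeta_series_eq_sum_plus_Ln[OF tail, of w] by simp
  thus "log_zeta s = ?h s" using log_zeta_eq s_mem by simp
qed

lemma Ln_one_minus_lipschitz: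
  assumes "cmod w \<le> 3 / 4" "cmod w' \<le> 3 / 4"
  shows "cmod (Ln (1 - w) - Ln (1 - w')) \<le> 4 * cmod (w - w')"
proof (rule field_differentiable_bound[of "cball 0 (3 / 4)" "\<lambda>w. Ln (1 - w)" "\<lambda>w. - (1 / (1 - w))"])
  fix z :: complex assume z_mem: "z \<in> cball 0 (3 / 4)"
  hence "cmod z < 1" by simp
  thus "((\<lambda>w. Ln (1 - w)) has_field_derivative - (1 / (1 - z))) (at z within cball 0 (3 / 4))"
    using one_minus_not_nonpos_Reals by (auto intro!: derivative_eq_intros simp: field_simps)
  have "cmod (1 - z) \<ge> 1 / 4" using z_mem norm_triangle_ineq2[of 1 z] by simp
  hence "1 / cmod (1 - z) \<le> 4" by (simp add: divide_le_eq)
  thus "cmod (- (1 / (1 - z))) \<le> 4" by (simp only: norm_minus_cancel norm_divide norm_one)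
qed (use assms in \<open>simp_all add: convex_cball\<close>)

lemma nat_powr_minus_half_le:
  assumes "n \<ge> 2" "\<sigma> \<ge> 1 / 2"
  shows "real n powr (-\<sigma>) \<le> 3 / 4"
proof -
  have "4 / 3 \<le> sqrt 2" by (rule real_le_rsqrt) (simp add: power2_eq_square)
  also have "\<dots> \<le> sqrt (real n)" using assms by simp
  also have "\<dots> = real n powr (1 / 2)" by (simp add: powr_half_sqrt)
  also have "\<dots> \<le> real n powr \<sigma>" using assms by (intro powr_mono) auto
  finally show ?thesis by (simp add: powr_minus divide_simps)
qed

lemma norm_euler_log_diff_le:
  assumes prime_p: "prime p" and Re_ge: "Re s \<ge> 1 / 2"
  shows "cmod (euler_log (s + \<i> * of_real a) p - euler_log (s + \<i> * of_real b) p)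
           \<le> 4 * cmod (1 - cis ((a - b) * ln (real p)))"
proof -
  have p_ge: "p \<ge> 2" "p \<ge> 1" using prime_ge_2_nat[OF prime_p] by simp_all
  define w where "w = (\<lambda>a. of_nat p powr (- (s + \<i> * of_real a)))"
  have norm_w: "cmod (w a) \<le> 3 / 4" for a
    using nat_powr_minus_half_le[OF p_ge(1) Re_ge] by (simp add: w_def)
  have "w b = w a * cis ((a - b) * ln (real p))"
    unfolding w_def nat_powr_eq_exp[OF p_ge(2)] cis_conv_exp by (simp add: algebra_simps flip: exp_add)
  hence w_diff: "w a - w b = w a * (1 - cis ((a - b) * ln (real p)))" by (simp add: algebra_simps)
  have "cmod (euler_log (s + \<i> * of_real a) p - euler_log (s + \<i> * of_real b) p)
    = cmod (Ln (1 - w a) - Ln (1 - w b))"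
    using prime_p by (simp add: euler_log_def w_def norm_minus_commute)
  also have "\<dots> \<le> 4 * cmod (w a - w b)" by (rule Ln_one_minus_lipschitz[OF norm_w norm_w])
  also have "\<dots> \<le> 4 * cmod (1 - cis ((a - b) * ln (real p)))"
    unfolding w_diff norm_mult using norm_w[of a] by (intro mult_left_mono mult_left_le_one_le) auto
  finally show ?thesis .
qed

definition log_zeta_approx_shifts :: "real \<Rightarrow> complex set \<Rightarrow> real \<Rightarrow> real set" where
  "log_zeta_approx_shifts d K \<epsilon> = {\<tau>. \<forall>s\<in>K. s + \<i> * of_real \<tau> \<in> log_zeta_dom \<and>
     s + \<i> * of_real (d * \<tau>) \<in> log_zeta_dom \<and>
     norm (log_zeta (s + \<i> * of_real \<tau>) - log_zeta (s + \<i> * of_real (d * \<tau>))) < \<epsilon>}"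

lemma open_Collect_compact_section:
  assumes "compact K" "open W"
  shows "open {x. \<forall>y\<in>K. (x, y) \<in> W}"
  unfolding open_subopen[of "{x. \<forall>y\<in>K. (x, y) \<in> W}"]
proof
  fix x assume "x \<in> {x. \<forall>y\<in>K. (x, y) \<in> W}"
  hence "{x} \<times> K \<subseteq> W" by auto
  from Elementary_Topology.tube_lemma[OF assms this]
  show "\<exists>T. open T \<and> x \<in> T \<and> T \<subseteq> {x. \<forall>y\<in>K. (x, y) \<in> W}" by blast
qed

lemma open_log_zeta_approx_shifts:
  assumes "compact K"
  shows "open (log_zeta_approx_shifts d K \<epsilon>)"
proof -
  define a b :: "real \<times> complex \<Rightarrow> complex"
    where "a = (\<lambda>x. snd x + \<i> * of_real (fst x))" and "b = (\<lambda>x. snd x + \<i> * of_real (d * fst x))"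
  define D where "D = a -` log_zeta_dom \<inter> b -` log_zeta_dom"
  define diff where "diff = (\<lambda>x. norm (log_zeta (a x) - log_zeta (b x)))"
  have continuous_ab: "continuous_on A a" "continuous_on A b" for A
    unfolding a_def b_def by (intro continuous_intros)+
  have "open D" unfolding D_def by (intro open_Int open_vimage open_log_zeta_dom continuous_ab)
  moreover have "continuous_on D diff"
    unfolding diff_def
    by (intro continuous_intros continuous_on_compose2[OF continuous_on_log_zeta] continuous_ab) (auto simp: D_def)
  ultimately have "open (D \<inter> diff -` {..<\<epsilon>})" using continuous_open_preimage[of D diff "{..<\<epsilon>}"] by simp
  from open_Collect_compact_section[OF assms this] show ?thesis
    by (simp add: log_zeta_approx_shifts_def D_def diff_def a_def b_def conj_assoc)
qed

lemma SUP_ereal_less_iff_compact: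
  fixes f :: "'a::topological_space \<Rightarrow> real"
  assumes "compact K" "continuous_on K f"
  shows "(SUP x\<in>K. ereal (f x)) < ereal e \<longleftrightarrow> (\<forall>x\<in>K. f x < e)"
proof (cases "K = {}")
  case False
  from continuous_attains_sup[OF assms(1) False assms(2)] obtain x where "x \<in> K" "\<forall>y\<in>K. f y \<le> f x" by blast
  hence "(SUP y\<in>K. ereal (f y)) = ereal (f x)" by (intro SUP_eqI) auto
  thus ?thesis using \<open>x \<in> K\<close> \<open>\<forall>y\<in>K. f y \<le> f x\<close> by force
qed (simp add: bot_ereal_def)

lemma SUP_log_zeta_diff_less_iff:
  assumes "compact K"
  shows "(\<forall>s\<in>K. s + \<i> * of_real \<tau> \<in> log_zeta_dom \<and> s + \<i> * of_real (d * \<tau>) \<in> log_zeta_dom) \<and>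
    (SUP s\<in>K. ereal (norm (log_zeta (s + \<i> * of_real \<tau>) - log_zeta (s + \<i> * of_real (d * \<tau>))))) < ereal \<epsilon>
    \<longleftrightarrow> \<tau> \<in> log_zeta_approx_shifts d K \<epsilon>"
proof (cases "\<forall>s\<in>K. s + \<i> * of_real \<tau> \<in> log_zeta_dom \<and> s + \<i> * of_real (d * \<tau>) \<in> log_zeta_dom")
  case True
  hence "continuous_on K (\<lambda>s. norm (log_zeta (s + \<i> * of_real \<tau>) - log_zeta (s + \<i> * of_real (d * \<tau>))))"
    by (intro continuous_intros continuous_on_compose2[OF continuous_on_log_zeta]) auto
  thus ?thesis using True by (simp add: SUP_ereal_less_iff_compact[OF assms] log_zeta_approx_shifts_def)
next
  case False
  thus ?thesis by (auto simp: log_zeta_approx_shifts_def)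
qed

section \<open>Mean values of trigonometric polynomials\<close>

definition trig_poly :: "'k set \<Rightarrow> ('k \<Rightarrow> complex) \<Rightarrow> ('k \<Rightarrow> real) \<Rightarrow> real \<Rightarrow> complex" where
  "trig_poly I w \<mu> \<tau> = (\<Sum>k\<in>I. w k * cis (\<mu> k * \<tau>))"

definition trig_mean :: "'k set \<Rightarrow> ('k \<Rightarrow> 'b) \<Rightarrow> ('k \<Rightarrow> real) \<Rightarrow> 'b::comm_monoid_add" where
  "trig_mean I w \<mu> = (\<Sum>k\<in>I. if \<mu> k = 0 then w k else 0)"

lemma continuous_on_trig_poly: "continuous_on A (trig_poly I w \<mu>)"
  unfolding trig_poly_def[abs_def] by (intro continuous_intros)

lemma cnj_trig_poly: "cnj (trig_poly I w \<mu> \<tau>) = trig_poly I (\<lambda>k. cnj (w k)) (\<lambda>k. - \<mu> k) \<tau>"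
  by (simp add: trig_poly_def cis_cnj)

lemma trig_poly_mult:
  "trig_poly I w \<mu> \<tau> * trig_poly J v \<nu> \<tau>
     = trig_poly (I \<times> J) (\<lambda>(i, j). w i * v j) (\<lambda>(i, j). \<mu> i + \<nu> j) \<tau>"
  unfolding trig_poly_def sum_product sum.cartesian_product
  by (intro sum.cong refl) (auto simp: distrib_left distrib_right mult_ac simp flip: cis_mult)

lemma of_real_trig_mean: "trig_mean I (\<lambda>k. complex_of_real (w k)) \<mu> = of_real (trig_mean I w \<mu>)"
  unfolding trig_mean_def of_real_sum by (intro sum.cong) auto

text \<open>For \<open>\<omega> = 0\<close> the right-hand side is \<open>0\<close>, because \<open>2 / 0 = 0\<close>.\<close>
lemma norm_integral_cis_minus_le:
  assumes "T \<ge> 0"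
  shows "cmod (integral {0..T} (\<lambda>\<tau>. cis (\<omega> * \<tau>)) - (if \<omega> = 0 then of_real T else 0)) \<le> 2 / \<bar>\<omega>\<bar>"
proof (cases "\<omega> = 0")
  case False
  define \<Phi> where "\<Phi> = (\<lambda>\<tau>. cis (\<omega> * \<tau>) / (\<i> * of_real \<omega>))"
  have "((\<lambda>z. exp (\<i> * of_real \<omega> * z) / (\<i> * of_real \<omega>)) has_field_derivative
      exp (\<i> * of_real \<omega> * of_real \<tau>)) (at (of_real \<tau>))" for \<tau>
    using False by (auto intro!: derivative_eq_intros)
  from has_vector_derivative_real_field[OF this]
  have "(\<Phi> has_vector_derivative cis (\<omega> * \<tau>)) (at \<tau> within {0..T})" for \<tau>
    by (simp add: \<Phi>_def cis_conv_exp mult.assoc)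
  hence "((\<lambda>\<tau>. cis (\<omega> * \<tau>)) has_integral (\<Phi> T - \<Phi> 0)) {0..T}"
    using assms by (intro fundamental_theorem_of_calculus) auto
  moreover have "cmod (\<Phi> \<tau>) = 1 / \<bar>\<omega>\<bar>" for \<tau> by (simp add: \<Phi>_def norm_divide norm_mult)
  ultimately show ?thesis
    using False norm_triangle_ineq4[of "\<Phi> T" "\<Phi> 0"] by (simp add: integral_unique)
qed (use assms in \<open>simp add: scaleR_conv_of_real\<close>)

lemma norm_integral_trig_poly_minus_le:
  assumes "finite I" "T \<ge> 0"
  shows "cmod (integral {0..T} (trig_poly I w \<mu>) - of_real T * trig_mean I w \<mu>)
           \<le> (\<Sum>k\<in>I. cmod (w k) * (2 / \<bar>\<mu> k\<bar>))"
proof -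
  have "integral {0..T} (trig_poly I w \<mu>) = (\<Sum>k\<in>I. integral {0..T} (\<lambda>\<tau>. w k * cis (\<mu> k * \<tau>)))"
    unfolding trig_poly_def[abs_def]
    by (intro integral_sum assms integrable_continuous_interval continuous_intros)
  also have "\<dots> = (\<Sum>k\<in>I. w k * integral {0..T} (\<lambda>\<tau>. cis (\<mu> k * \<tau>)))" by simp
  also have "\<dots> - of_real T * trig_mean I w \<mu>
      = (\<Sum>k\<in>I. w k * (integral {0..T} (\<lambda>\<tau>. cis (\<mu> k * \<tau>)) - (if \<mu> k = 0 then of_real T else 0)))"
    unfolding trig_mean_def sum_distrib_left sum_subtractf[symmetric]
    by (intro sum.cong) (auto simp: algebra_simps)
  also have "cmod \<dots> \<le> (\<Sum>k\<in>I. cmod (w k) * (2 / \<bar>\<mu> k\<bar>))"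
    by (intro sum_norm_le, unfold norm_mult)
      (intro mult_left_mono norm_integral_cis_minus_le assms norm_ge_zero)
  finally show ?thesis .
qed

lemma abs_integral_Re_trig_poly_minus_le:
  assumes "finite I" "T \<ge> 0"
  shows "\<bar>integral {0..T} (\<lambda>\<tau>. Re (trig_poly I w \<mu> \<tau>)) - T * Re (trig_mean I w \<mu>)\<bar>
           \<le> (\<Sum>k\<in>I. cmod (w k) * (2 / \<bar>\<mu> k\<bar>))"
proof -
  have "((\<lambda>\<tau>. Re (trig_poly I w \<mu> \<tau>)) has_integral Re (integral {0..T} (trig_poly I w \<mu>))) {0..T}"
    by (intro has_integral_Re integrable_integral integrable_continuous_interval continuous_on_trig_poly)
  hence "integral {0..T} (\<lambda>\<tau>. Re (trig_poly I w \<mu> \<tau>)) - T * Re (trig_mean I w \<mu>)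
      = Re (integral {0..T} (trig_poly I w \<mu>) - of_real T * trig_mean I w \<mu>)"
    by (simp add: integral_unique)
  thus ?thesis
    using abs_Re_le_cmod norm_integral_trig_poly_minus_le[OF assms, of w \<mu>] by (metis order_trans)
qed

lemma eventually_const_le_mult_at_top:
  fixes C \<eta> :: real
  assumes "\<eta> > 0"
  shows "\<forall>\<^sub>F T in at_top. 0 \<le> T \<and> C \<le> \<eta> * T"
  using eventually_ge_at_top[of 0] eventually_ge_at_top[of "C / \<eta>"]
  by eventually_elim (use assms in \<open>simp add: field_simps\<close>)

lemma eventually_integral_trig_poly_ge:
  assumes "finite I" "\<And>\<tau>. complex_of_real (W \<tau>) = trig_poly I (\<lambda>k. of_real (w k)) \<mu> \<tau>" "\<eta> > 0"
  shows "\<forall>\<^sub>F T in at_top. integral {0..T} W \<ge> (trig_mean I w \<mu> - \<eta>) * T"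
  using eventually_const_le_mult_at_top[OF assms(3), of "\<Sum>k\<in>I. \<bar>w k\<bar> * (2 / \<bar>\<mu> k\<bar>)"]
proof eventually_elim
  case (elim T)
  have "W = (\<lambda>\<tau>. Re (trig_poly I (\<lambda>k. of_real (w k)) \<mu> \<tau>))" by (simp flip: assms(2))
  thus ?case
    using abs_integral_Re_trig_poly_minus_le[OF assms(1) conjunct1[OF elim], of "\<lambda>k. of_real (w k)" \<mu>] elim
    by (simp add: of_real_trig_mean algebra_simps abs_le_iff)
qed

definition weighted_square_coeff :: "('k \<Rightarrow> real) \<Rightarrow> ('n \<Rightarrow> complex) \<Rightarrow> 'k \<times> 'n \<times> 'n \<Rightarrow> complex" where
  "weighted_square_coeff w b = (\<lambda>(k, n, n'). of_real (w k) * (b n * cnj (b n')))"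

definition weighted_square_freq :: "('k \<Rightarrow> real) \<Rightarrow> ('n \<Rightarrow> real) \<Rightarrow> 'k \<times> 'n \<times> 'n \<Rightarrow> real" where
  "weighted_square_freq \<mu> l = (\<lambda>(k, n, n'). \<mu> k + (l n - l n'))"

lemma weighted_square_eq_trig_poly:
  assumes "complex_of_real (W \<tau>) = trig_poly K (\<lambda>k. of_real (w k)) \<mu> \<tau>"
  shows "complex_of_real (W \<tau> * (cmod (trig_poly A b l \<tau>))\<^sup>2)
    = trig_poly (K \<times> A \<times> A) (weighted_square_coeff w b) (weighted_square_freq \<mu> l) \<tau>"
  unfolding of_real_mult complex_norm_square assms cnj_trig_poly trig_poly_mult
  by (simp add: case_prod_unfold weighted_square_coeff_def weighted_square_freq_def)

lemma norm_weighted_square_coeff_le: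
  assumes "\<forall>n\<in>A. cmod (b n) \<le> 1" "i \<in> K \<times> A \<times> A"
  shows "cmod (weighted_square_coeff w b i) \<le> \<bar>w (fst i)\<bar>"
proof -
  obtain k n n' where i_split: "i = (k, n, n')" "n \<in> A" "n' \<in> A" using assms(2) by auto
  hence "cmod (b n) * cmod (b n') \<le> 1" using assms(1) by (intro mult_le_one) auto
  hence "\<bar>w k\<bar> * (cmod (b n) * cmod (b n')) \<le> \<bar>w k\<bar> * 1" by (intro mult_left_mono) auto
  thus ?thesis by (simp add: i_split weighted_square_coeff_def norm_mult)
qed

text \<open>The non-resonance condition removes all off-diagonal terms from the mean value.\<close>
lemma trig_mean_weighted_square:
  assumes finite_A: "finite A" and nonres: "\<forall>k\<in>K. \<forall>n\<in>A. \<forall>n'\<in>A. \<mu> k + (l n - l n') = 0 \<longrightarrow> n = n'"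
  shows "trig_mean (K \<times> A \<times> A) (weighted_square_coeff w b) (weighted_square_freq \<mu> l)
    = of_real (trig_mean K w \<mu> * (\<Sum>n\<in>A. (cmod (b n))\<^sup>2))"
proof -
  let ?t = "\<lambda>k n n'. if \<mu> k + (l n - l n') = 0 then of_real (w k) * (b n * cnj (b n')) else 0"
  have diagonal: "(\<Sum>n'\<in>A. ?t k n n') = of_real (if \<mu> k = 0 then w k else 0) * of_real ((cmod (b n))\<^sup>2)"
    if "k \<in> K" "n \<in> A" for k n
  proof -
    have "(\<Sum>n'\<in>A. ?t k n n') = (\<Sum>n'\<in>A. if n' = n then ?t k n n else 0)"
    proof (intro sum.cong refl)
      fix n' assume "n' \<in> A"
      with nonres that have "\<mu> k + (l n - l n') = 0 \<longrightarrow> n = n'" by blast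
      thus "?t k n n' = (if n' = n then ?t k n n else 0)" by auto
    qed
    thus ?thesis using that finite_A by (simp add: complex_norm_square del: of_real_power)
  qed
  have "trig_mean (K \<times> A \<times> A) (weighted_square_coeff w b) (weighted_square_freq \<mu> l)
      = (\<Sum>k\<in>K. \<Sum>n\<in>A. \<Sum>n'\<in>A. ?t k n n')"
    unfolding trig_mean_def sum.cartesian_product weighted_square_coeff_def weighted_square_freq_def
    by (intro sum.cong) auto
  also have "\<dots> = (\<Sum>k\<in>K. \<Sum>n\<in>A. of_real (if \<mu> k = 0 then w k else 0) * of_real ((cmod (b n))\<^sup>2))"
    by (intro sum.cong refl diagonal)
  also have "\<dots> = of_real (trig_mean K w \<mu> * (\<Sum>n\<in>A. (cmod (b n))\<^sup>2))"
    unfolding trig_mean_def sum_product of_real_sum of_real_mult ..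
  finally show ?thesis .
qed

lemma eventually_weighted_trig_mean_square_le:
  assumes W_eq_trig_poly: "\<And>\<tau>. complex_of_real (W \<tau>) = trig_poly K (\<lambda>k. of_real (w k)) \<mu> \<tau>"
    and finite_sets: "finite K" "finite A" and \<eta>_pos: "\<eta> > 0"
    and nonres: "\<forall>k\<in>K. \<forall>n\<in>A. \<forall>n'\<in>A. \<mu> k + (l n - l n') = 0 \<longrightarrow> n = n'"
  shows "\<forall>\<^sub>F T in at_top. \<forall>b. (\<forall>n\<in>A. cmod (b n) \<le> 1) \<longrightarrow>
    integral {0..T} (\<lambda>\<tau>. W \<tau> * (cmod (trig_poly A b l \<tau>))\<^sup>2)
      \<le> (trig_mean K w \<mu> * (\<Sum>n\<in>A. (cmod (b n))\<^sup>2) + \<eta>) * T"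
proof -
  let ?I = "K \<times> A \<times> A" and ?\<mu> = "weighted_square_freq \<mu> l"
  define C where "C = (\<Sum>i\<in>?I. \<bar>w (fst i)\<bar> * (2 / \<bar>?\<mu> i\<bar>))"
  show ?thesis using eventually_const_le_mult_at_top[OF \<eta>_pos, of C]
  proof (eventually_elim, intro allI impI)
    fix T b assume T_bounds: "0 \<le> T \<and> C \<le> \<eta> * T" and b_le: "\<forall>n\<in>A. cmod (b n) \<le> 1"
    let ?w = "weighted_square_coeff w b"
    have W_eq: "W \<tau> * (cmod (trig_poly A b l \<tau>))\<^sup>2 = Re (trig_poly ?I ?w ?\<mu> \<tau>)" for \<tau>
      unfolding weighted_square_eq_trig_poly[where W = W, OF W_eq_trig_poly, symmetric]
        by (rule Re_complex_of_real[symmetric])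
    have "\<bar>integral {0..T} (\<lambda>\<tau>. Re (trig_poly ?I ?w ?\<mu> \<tau>)) - T * Re (trig_mean ?I ?w ?\<mu>)\<bar>
        \<le> (\<Sum>i\<in>?I. cmod (?w i) * (2 / \<bar>?\<mu> i\<bar>))"
      using finite_sets T_bounds by (intro abs_integral_Re_trig_poly_minus_le) auto
    also have "\<dots> \<le> C"
      unfolding C_def by (intro sum_mono mult_right_mono norm_weighted_square_coeff_le[OF b_le]) auto
    finally have "integral {0..T} (\<lambda>\<tau>. W \<tau> * (cmod (trig_poly A b l \<tau>))\<^sup>2) \<le> T * Re (trig_mean ?I ?w ?\<mu>) + \<eta> * T"
      unfolding W_eq using T_bounds by linarith
    also have "Re (trig_mean ?I ?w ?\<mu>) = trig_mean K w \<mu> * (\<Sum>n\<in>A. (cmod (b n))\<^sup>2)"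
      unfolding trig_mean_weighted_square[OF finite_sets(2) nonres] by (rule Re_complex_of_real)
    finally show "integral {0..T} (\<lambda>\<tau>. W \<tau> * (cmod (trig_poly A b l \<tau>))\<^sup>2)
        \<le> (trig_mean K w \<mu> * (\<Sum>n\<in>A. (cmod (b n))\<^sup>2) + \<eta>) * T"
      by (simp only: distrib_right mult.commute[of T])
  qed
qed

section \<open>The weight\<close>

definition weight :: "nat set \<Rightarrow> nat \<Rightarrow> real \<Rightarrow> real \<Rightarrow> real" where
  "weight S m c \<tau> = (\<Prod>p\<in>S. ((1 + cos (c * \<tau> * ln (real p))) / 2) ^ m)"

definition weight_index :: "nat set \<Rightarrow> nat \<Rightarrow> (nat \<Rightarrow> nat) set" where
  "weight_index S m = PiE S (\<lambda>_. {..2 * m})"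

definition weight_freq :: "nat set \<Rightarrow> nat \<Rightarrow> real \<Rightarrow> (nat \<Rightarrow> nat) \<Rightarrow> real" where
  "weight_freq S m c k = c * (\<Sum>p\<in>S. of_int (int (k p) - int m) * ln (real p))"

definition weight_coeff :: "nat set \<Rightarrow> nat \<Rightarrow> (nat \<Rightarrow> nat) \<Rightarrow> real" where
  "weight_coeff S m k = (\<Prod>p\<in>S. real ((2 * m) choose (k p)) / 4 ^ m)"

definition weight_mean :: "nat set \<Rightarrow> nat \<Rightarrow> real \<Rightarrow> real" where
  "weight_mean S m c = trig_mean (weight_index S m) (weight_coeff S m) (weight_freq S m c)"

lemma finite_weight_index: "finite S \<Longrightarrow> finite (weight_index S m)"
  unfolding weight_index_def by (intro finite_PiE) auto

lemma half_one_plus_cos_eq: "(1 + cos \<theta>) / 2 = 1 - (cmod (1 - cis \<theta>))\<^sup>2 / 4"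
  using sin_cos_squared_add[of \<theta>] by (simp add: cmod_power2 power2_diff field_simps)

lemma one_plus_cos_nonneg: "0 \<le> 1 + cos (\<theta> :: real)"
  using cos_ge_minus_one[of \<theta>] by linarith

lemma half_one_plus_cos_power_bounds:
  fixes \<theta> :: real
  shows "0 \<le> ((1 + cos \<theta>) / 2) ^ m" "((1 + cos \<theta>) / 2) ^ m \<le> 1"
  by (auto intro!: zero_le_power power_le_one one_plus_cos_nonneg divide_nonneg_nonneg)

lemma weight_bounds: "0 \<le> weight S m c \<tau>" "weight S m c \<tau> \<le> 1"
  unfolding weight_def by (auto intro!: prod_nonneg prod_le_1 half_one_plus_cos_power_bounds)

lemma continuous_on_weight: "continuous_on A (weight S m c)"
  unfolding weight_def[abs_def] by (intro continuous_intros) auto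

lemma weight_gt_imp_phase_small:
  assumes "finite S" "p \<in> S" "0 < x" "x \<le> 2" "weight S m c \<tau> > (1 - x\<^sup>2 / 4) ^ m"
  shows "cmod (1 - cis (c * \<tau> * ln (real p))) < x"
proof (rule ccontr)
  let ?u = "\<lambda>p. ((1 + cos (c * \<tau> * ln (real p))) / 2) ^ m"
  assume "\<not> ?thesis"
  hence "x\<^sup>2 \<le> (cmod (1 - cis (c * \<tau> * ln (real p))))\<^sup>2" using assms by (intro power_mono) auto
  hence "(1 + cos (c * \<tau> * ln (real p))) / 2 \<le> 1 - x\<^sup>2 / 4" unfolding half_one_plus_cos_eq by simp
  hence "?u p \<le> (1 - x\<^sup>2 / 4) ^ m" by (intro power_mono) (auto intro: one_plus_cos_nonneg)
  moreover have "weight S m c \<tau> = ?u p * (\<Prod>q\<in>S - {p}. ?u q)"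
    unfolding weight_def by (rule prod.remove[OF assms(1,2)])
  moreover have "?u p * (\<Prod>q\<in>S - {p}. ?u q) \<le> ?u p"
    by (intro mult_right_le_one_le prod_nonneg prod_le_1 conjI half_one_plus_cos_power_bounds)
  ultimately show False using assms(5) by linarith
qed

lemma half_one_plus_cos_power_eq:
  "complex_of_real (((1 + cos \<theta>) / 2) ^ m)
     = (\<Sum>j\<le>2 * m. of_real (real ((2 * m) choose j) / 4 ^ m) * cis (of_int (int j - int m) * \<theta>))"
proof -
  have square: "complex_of_real ((1 + cos \<theta>) / 2) = (cis \<theta> + 1)\<^sup>2 / 4 * cis (- \<theta>)"
  proof -
    have "cis \<theta> * cis (- \<theta>) = 1" by (simp add: cis_mult)
    hence "(cis \<theta> + 1)\<^sup>2 * cis (- \<theta>) = cis \<theta> + 2 + cis (- \<theta>)" by algebra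
    also have "\<dots> = of_real (2 + 2 * cos \<theta>)" by (simp add: complex_eq_iff)
    finally show ?thesis by (simp add: field_simps)
  qed
  have "complex_of_real (((1 + cos \<theta>) / 2) ^ m) = ((cis \<theta> + 1)\<^sup>2 / 4 * cis (- \<theta>)) ^ m"
    by (simp only: of_real_power square)
  also have "\<dots> = (cis \<theta> + 1) ^ (2 * m) / 4 ^ m * cis (- (of_nat m * \<theta>))"
    by (simp only: power_mult_distrib power_divide power_mult Complex.DeMoivre mult_minus_right)
  also have "(cis \<theta> + 1) ^ (2 * m) = (\<Sum>j\<le>2 * m. of_nat ((2 * m) choose j) * cis \<theta> ^ j * 1 ^ (2 * m - j))"
    by (rule binomial_ring)
  also have "\<dots> / 4 ^ m * cis (- (of_nat m * \<theta>))
      = (\<Sum>j\<le>2 * m. of_real (real ((2 * m) choose j) / 4 ^ m) * cis (of_int (int j - int m) * \<theta>))"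
    unfolding sum_divide_distrib sum_distrib_right Complex.DeMoivre
    by (intro sum.cong refl) (simp add: cis_mult left_diff_distrib)
  finally show ?thesis .
qed

lemma prod_cis: "(\<Prod>p\<in>S. cis (f p)) = cis (\<Sum>p\<in>S. f p)"
  by (induction S rule: infinite_finite_induct) (auto simp: cis_mult)

lemma weight_eq_trig_poly:
  assumes "finite S"
  shows "complex_of_real (weight S m c \<tau>)
           = trig_poly (weight_index S m) (\<lambda>k. of_real (weight_coeff S m k)) (weight_freq S m c) \<tau>"
proof -
  let ?a = "\<lambda>j. complex_of_real (real ((2 * m) choose j) / 4 ^ m)"
  let ?e = "\<lambda>j p. of_int (int j - int m) * (c * \<tau> * ln (real p))"
  have freq: "(\<Sum>p\<in>S. ?e (k p) p) = weight_freq S m c k * \<tau>" for k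
    by (simp add: weight_freq_def sum_distrib_left sum_distrib_right mult_ac)
  have "complex_of_real (weight S m c \<tau>) = (\<Prod>p\<in>S. \<Sum>j\<le>2 * m. ?a j * cis (?e j p))"
    unfolding weight_def of_real_prod half_one_plus_cos_power_eq ..
  also have "\<dots> = (\<Sum>k\<in>weight_index S m. \<Prod>p\<in>S. ?a (k p) * cis (?e (k p) p))"
    unfolding weight_index_def using assms by (intro prod_sum_PiE) auto
  also have "\<dots> = trig_poly (weight_index S m) (\<lambda>k. of_real (weight_coeff S m k)) (weight_freq S m c) \<tau>"
    by (simp only: trig_poly_def prod.distrib prod_cis freq weight_coeff_def of_real_prod)
  finally show ?thesis .
qed

lemma weight_mean_ge:
  assumes "finite S"
  shows "weight_mean S m c \<ge> (real ((2 * m) choose m) / 4 ^ m) ^ card S"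
proof -
  define k where "k = (\<lambda>p\<in>S. m)"
  have "(real ((2 * m) choose m) / 4 ^ m) ^ card S = weight_coeff S m k"
    by (simp add: weight_coeff_def k_def)
  also have "\<dots> = (\<Sum>k\<in>{k}. if weight_freq S m c k = 0 then weight_coeff S m k else 0)"
    by (simp add: weight_freq_def k_def)
  also have "\<dots> \<le> weight_mean S m c"
    unfolding weight_mean_def trig_mean_def using assms
    by (intro sum_mono2 finite_weight_index)
      (auto simp: weight_index_def k_def weight_coeff_def intro!: prod_nonneg)
  finally show ?thesis .
qed

lemma weight_mean_pos: "finite S \<Longrightarrow> weight_mean S m c > 0"
  by (rule less_le_trans[OF _ weight_mean_ge]) (auto intro!: zero_less_power divide_pos_pos)

lemma power_mult_geometric_tendsto_0:
  fixes \<kappa> :: real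
  assumes "0 < \<kappa>" "\<kappa> < 1"
  shows "(\<lambda>m. real m ^ n * \<kappa> ^ m) \<longlonglongrightarrow> 0"
proof -
  define b where "b = - ln \<kappa>"
  have b_pos: "b > 0" using assms by (simp add: b_def)
  have "filterlim (\<lambda>m. b * real m) at_top sequentially"
    using b_pos by (intro filterlim_tendsto_pos_mult_at_top[OF tendsto_const _ filterlim_real_sequentially])
  from tendsto_divide[OF filterlim_compose[OF tendsto_power_div_exp_0[of n] this] tendsto_const[of "b ^ n"]]
  have "(\<lambda>m. (b * real m) ^ n / exp (b * real m) / b ^ n) \<longlonglongrightarrow> 0" using b_pos by simp
  moreover have "(b * real m) ^ n / exp (b * real m) / b ^ n = real m ^ n * \<kappa> ^ m" for m
  proof -
    have "\<kappa> ^ m = inverse (exp (b * real m))"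
      using assms by (simp add: b_def exp_minus mult.commute exp_of_nat_mult)
    thus ?thesis using b_pos by (simp add: power_mult_distrib field_simps)
  qed
  ultimately show ?thesis by simp
qed

lemma exists_power_le_weight_mean:
  fixes \<kappa> :: real
  assumes \<kappa>_bounds: "0 < \<kappa>" "\<kappa> < 1" and "finite S"
  shows "\<exists>m. \<kappa> ^ m \<le> weight_mean S m c / 8"
proof -
  let ?n = "card S"
  have "\<forall>\<^sub>F m in sequentially. real m ^ ?n * \<kappa> ^ m < 1 / (8 * 2 ^ ?n)"
    by (rule order_tendstoD[OF power_mult_geometric_tendsto_0[OF \<kappa>_bounds]]) simp
  hence "\<forall>\<^sub>F m in sequentially. real m ^ ?n * \<kappa> ^ m < 1 / (8 * 2 ^ ?n) \<and> m \<ge> 1"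
    using eventually_ge_at_top[of 1] by (rule eventually_conj)
  then obtain m where m_props: "real m ^ ?n * \<kappa> ^ m < 1 / (8 * 2 ^ ?n)" "m \<ge> 1"
    by (auto dest!: eventually_happens)
  have "\<kappa> ^ m \<le> (1 / (2 * real m)) ^ ?n / 8"
    using m_props by (simp add: field_simps power_mult_distrib power_divide)
  also have "(1 / (2 * real m)) ^ ?n \<le> (real ((2 * m) choose m) / 4 ^ m) ^ ?n"
    using central_binomial_lower_bound[of m] m_props(2) by (intro power_mono) (auto simp: field_simps)
  also have "\<dots> \<le> weight_mean S m c" by (rule weight_mean_ge[OF assms(3)])
  finally show ?thesis by auto
qed

section \<open>Weighted mean squares of the sieved zeta function\<close>

abbreviation rect :: "real \<Rightarrow> real \<Rightarrow> real \<Rightarrow> complex set" where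
  "rect a b h \<equiv> cbox (Complex a (- h)) (Complex b h)"

definition sieved_deviation :: "nat set \<Rightarrow> real \<Rightarrow> complex \<Rightarrow> complex" where
  "sieved_deviation S t z = sieved_zeta S (z + \<i> * of_real t) - 1"

lemma weight_freq_log_rationals:
  "\<exists>x\<in>log_rationals {..N}. weight_freq (primes_upto N) m c k = c * x"
proof
  let ?x = "\<Sum>p\<in>primes_upto N. of_int (int (k p) - int m) * ln (real p)"
  show "weight_freq (primes_upto N) m c k = c * ?x" by (simp add: weight_freq_def)
  show "?x \<in> log_rationals {..N}"
  proof (intro log_rationals_sum log_rationals_of_int_mult)
    fix p assume "p \<in> primes_upto N"
    hence "ln (real p) - ln (real 1) \<in> log_rationals {..N}"
      by (intro log_rationalsI) (auto simp: prime_gt_0_nat prime_prime_factors)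
    thus "ln (real p) \<in> log_rationals {..N}" by simp
  qed
qed

lemma weight_freq_nonresonant:
  assumes "\<rho> \<noteq> 0" and nonres: "log_nonresonant N (c / \<rho>)"
    and sieved: "n \<in> sieved_below (primes_upto N) Y" "n' \<in> sieved_below (primes_upto N) Y"
    and resonance: "weight_freq (primes_upto N) m c k + (- \<rho> * ln (real n) - (- \<rho> * ln (real n'))) = 0"
  shows "n = n'"
proof -
  obtain x where x_props: "x \<in> log_rationals {..N}" "weight_freq (primes_upto N) m c k = c * x"
    using weight_freq_log_rationals by blast
  have pos: "n > 0" "n' > 0" using sieved by (auto simp: sieved_below_def)
  have "c / \<rho> * x = ln (real n) - ln (real n')" using resonance x_props(2) assms(1) by (simp add: field_simps)
  moreover have "ln (real n) - ln (real n') \<in> log_rationals {N<..}"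
    using pos sieved by (intro log_rationalsI prime_factors_sieved_below)
  ultimately have "ln (real n) = ln (real n')" using nonres x_props(1) by (auto simp: log_nonresonant_def)
  thus ?thesis using pos by simp
qed

lemma sieved_sum_eq_trig_poly:
  assumes "Y > 1"
  shows "sieved_sum (primes_upto N) Y (z + \<i> * of_real (\<rho> * \<tau>)) - 1
    = trig_poly (sieved_below (primes_upto N) Y - {1}) (\<lambda>n. of_nat n powr (-z)) (\<lambda>n. - \<rho> * ln (real n)) \<tau>"
proof -
  have "of_nat n powr (- (z + \<i> * of_real (\<rho> * \<tau>))) = of_nat n powr (-z) * cis (- \<rho> * ln (real n) * \<tau>)"
    if "n \<ge> 1" for n
    unfolding nat_powr_eq_exp[OF that] cis_conv_exp by (simp add: algebra_simps flip: exp_add)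
  thus ?thesis
    unfolding sieved_sum_eq_1_plus[OF assms] trig_poly_def add_diff_cancel_left'
    by (intro sum.cong) (auto simp: sieved_below_def)
qed

lemma sum_norm_nat_powr_square_le:
  assumes "\<sigma>0 > 1 / 2" "\<sigma>0 \<le> Re z"
  shows "(\<Sum>n\<in>sieved_below (primes_upto N) Y - {1}. (cmod (of_nat n powr (-z)))\<^sup>2) \<le> powr_tail (2 * \<sigma>0) (Suc N)"
proof -
  have "(\<Sum>n\<in>sieved_below (primes_upto N) Y - {1}. (cmod (of_nat n powr (-z)))\<^sup>2)
      \<le> (\<Sum>n\<in>sieved_below (primes_upto N) Y - {1}. real n powr (- (2 * \<sigma>0)))"
    using assms
    by (intro sum_mono) (auto simp: sieved_below_def power2_eq_square intro!: powr_mono simp flip: powr_add)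
  also have "\<dots> \<le> powr_tail (2 * \<sigma>0) (Suc N)" using assms by (intro sum_sieved_below_powr_le) simp
  finally show ?thesis .
qed

lemma eventually_weighted_sieved_sum_mean_square_le:
  assumes \<sigma>0_bounds: "\<sigma>0 > 1 / 2" and \<rho>_nonzero: "\<rho> \<noteq> 0" and Y_gt_1: "Y > 1" and \<eta>_pos: "\<eta> > 0"
    and nonres: "log_nonresonant N (c / \<rho>)"
  shows "\<forall>\<^sub>F T in at_top. \<forall>z. \<sigma>0 \<le> Re z \<longrightarrow>
    integral {0..T} (\<lambda>\<tau>. weight (primes_upto N) m c \<tau> *
      (cmod (sieved_sum (primes_upto N) Y (z + \<i> * of_real (\<rho> * \<tau>)) - 1))\<^sup>2)
      \<le> (weight_mean (primes_upto N) m c * powr_tail (2 * \<sigma>0) (Suc N) + \<eta>) * T"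
proof -
  let ?S = "primes_upto N"
  define A where "A = sieved_below ?S Y - {1}"
  have A_props: "finite A" "\<And>n. n \<in> A \<Longrightarrow> n \<ge> 1"
    unfolding A_def by (auto simp: finite_sieved_below) (auto simp: sieved_below_def)
  have "\<forall>\<^sub>F T in at_top. \<forall>b. (\<forall>n\<in>A. cmod (b n) \<le> 1) \<longrightarrow>
    integral {0..T} (\<lambda>\<tau>. weight ?S m c \<tau> * (cmod (trig_poly A b (\<lambda>n. - \<rho> * ln (real n)) \<tau>))\<^sup>2)
      \<le> (weight_mean ?S m c * (\<Sum>n\<in>A. (cmod (b n))\<^sup>2) + \<eta>) * T"
    unfolding weight_mean_def
    by (intro eventually_weighted_trig_mean_square_le weight_eq_trig_poly finite_weight_index \<eta>_pos A_props
      ballI impI)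
      (auto simp: A_def intro: weight_freq_nonresonant[OF \<rho>_nonzero nonres])
  thus ?thesis using eventually_ge_at_top[of 0]
  proof (eventually_elim, intro allI impI)
    fix T z
    assume uniform_bound: "\<forall>b. (\<forall>n\<in>A. cmod (b n) \<le> 1) \<longrightarrow>
        integral {0..T} (\<lambda>\<tau>. weight ?S m c \<tau> * (cmod (trig_poly A b (\<lambda>n. - \<rho> * ln (real n)) \<tau>))\<^sup>2)
        \<le> (weight_mean ?S m c * (\<Sum>n\<in>A. (cmod (b n))\<^sup>2) + \<eta>) * T"
      and T_nonneg: "0 \<le> T" and Re_z: "\<sigma>0 \<le> Re z"
    let ?b = "\<lambda>n. of_nat n powr (-z)"
    have b_le: "\<forall>n\<in>A. cmod (?b n) \<le> 1" using A_props(2) Re_z \<sigma>0_bounds by (simp add: nat_powr_le_1)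
    have tail: "(\<Sum>n\<in>A. (cmod (?b n))\<^sup>2) \<le> powr_tail (2 * \<sigma>0) (Suc N)"
      unfolding A_def by (rule sum_norm_nat_powr_square_le[OF \<sigma>0_bounds Re_z])
    have "integral {0..T} (\<lambda>\<tau>. weight ?S m c \<tau> * (cmod (sieved_sum ?S Y (z + \<i> * of_real (\<rho> * \<tau>)) - 1))\<^sup>2)
        \<le> (weight_mean ?S m c * (\<Sum>n\<in>A. (cmod (?b n))\<^sup>2) + \<eta>) * T"
      unfolding sieved_sum_eq_trig_poly[OF Y_gt_1] A_def[symmetric]
        by (rule uniform_bound[THEN spec, THEN mp, OF b_le])
    also have "\<dots> \<le> (weight_mean ?S m c * powr_tail (2 * \<sigma>0) (Suc N) + \<eta>) * T"
      using T_nonneg tail less_imp_le[OF weight_mean_pos[of ?S m c]]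
      by (intro mult_right_mono add_right_mono mult_left_mono) auto
    finally show "integral {0..T} (\<lambda>\<tau>. weight ?S m c \<tau> * (cmod (sieved_sum ?S Y (z + \<i> * of_real (\<rho> * \<tau>)) - 1))\<^sup>2)
        \<le> (weight_mean ?S m c * powr_tail (2 * \<sigma>0) (Suc N) + \<eta>) * T" .
  qed
qed

lemma integral_affine_le:
  fixes h :: "real \<Rightarrow> real"
  assumes "a > 0" "h integrable_on {1..a * T + y}" "a * T1 + y \<ge> 1" "T1 \<le> T" and "\<And>t. h t \<ge> 0"
  shows "integral {T1..T} (\<lambda>\<tau>. h (a * \<tau> + y)) \<le> integral {1..a * T + y} h / a"
proof -
  have endpoints: "a * T1 + y \<le> a * T + y" using assms by simp
  have "h integrable_on {a * T1 + y..a * T + y}"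
    by (rule integrable_subinterval_real[OF assms(2)]) (use assms endpoints in auto)
  from has_integral_affinity'[OF integrable_integral[OF this, unfolded box_real(2)[symmetric]] assms(1), of y]
  have "((\<lambda>\<tau>. h (a * \<tau> + y)) has_integral (integral {a * T1 + y..a * T + y} h / a)) {T1..T}"
    using assms(1) by (simp add: field_simps)
  hence "integral {T1..T} (\<lambda>\<tau>. h (a * \<tau> + y)) = integral {a * T1 + y..a * T + y} h / a" by (rule integral_unique)
  also have "\<dots> \<le> integral {1..a * T + y} h / a"
    using assms endpoints by (intro divide_right_mono integral_subset_le
      integrable_subinterval_real[OF assms(2)]) auto
  finally show ?thesis .
qed

lemma shifted_Im_far:
  fixes y \<rho> \<tau> B T1 :: real
  assumes "\<bar>y\<bar> \<le> B" "0 \<le> T1" "B + 1 \<le> \<bar>\<rho>\<bar> * T1" "T1 \<le> \<tau>"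
  shows "\<bar>y + \<rho> * \<tau>\<bar> \<ge> 1"
proof -
  have "\<bar>\<rho>\<bar> * T1 \<le> \<bar>\<rho>\<bar> * \<tau>" using assms by (intro mult_left_mono) auto
  moreover have "\<bar>\<rho> * \<tau>\<bar> = \<bar>\<rho>\<bar> * \<tau>" using assms by (simp add: abs_mult)
  ultimately show ?thesis using assms by linarith
qed

lemma norm_sieve_error_shift:
  assumes "\<rho> \<noteq> 0"
  shows "cmod (sieve_error S Y (z + \<i> * of_real (\<rho> * \<tau>)))
           = cmod (sieve_error S Y (Complex (Re z) (\<bar>\<rho>\<bar> * \<tau> + sgn \<rho> * Im z)))"
proof (cases "\<rho> > 0")
  case True
  hence "z + \<i> * of_real (\<rho> * \<tau>) = Complex (Re z) (\<bar>\<rho>\<bar> * \<tau> + sgn \<rho> * Im z)"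
    by (simp add: complex_eq_iff)
  thus ?thesis by simp
next
  case False
  hence "z + \<i> * of_real (\<rho> * \<tau>) = cnj (Complex (Re z) (\<bar>\<rho>\<bar> * \<tau> + sgn \<rho> * Im z))"
    using assms by (simp add: complex_eq_iff)
  thus ?thesis by (simp only: norm_sieve_error_cnj)
qed

lemma eventually_shifted_sieve_error_mean_square_le:
  assumes primes: "finite S" "\<forall>p\<in>S. prime p" and \<sigma>0_bounds: "1 / 2 < \<sigma>0" "\<sigma>0 < 1" and \<eta>_pos: "\<eta> > 0"
    and \<rho>_nonzero: "\<rho> \<noteq> 0" and T1_bounds: "B + 1 \<le> \<bar>\<rho>\<bar> * T1"
  shows "\<forall>\<^sub>F Y in at_top. \<forall>\<^sub>F T in at_top. \<forall>z\<in>rect \<sigma>0 3 B.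
           integral {T1..T} (\<lambda>\<tau>. (cmod (sieve_error S Y (z + \<i> * of_real (\<rho> * \<tau>))))\<^sup>2) \<le> \<eta> * T"
proof -
  have "\<eta> / 2 > 0" using \<eta>_pos by simp
  from sieve_error_mean_square[OF primes \<sigma>0_bounds this] show ?thesis
  proof eventually_elim
    case (elim Y)
    let ?h = "\<lambda>\<sigma> t. (cmod (sieve_error S Y (Complex \<sigma> t)))\<^sup>2"
    obtain U where threshold: "\<forall>X\<ge>U. \<forall>\<sigma>\<in>{\<sigma>0..3}. integral {1..X} (?h \<sigma>) \<le> \<eta> / 2 * X"
      using elim unfolding eventually_at_top_linorder by (elim exE)
    have "\<bar>\<rho>\<bar> > 0" using \<rho>_nonzero by simp
    from eventually_const_le_mult_at_top[OF this, of "U + B"]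
      eventually_const_le_mult_at_top[OF this, of B] eventually_ge_at_top[of T1] show ?case
    proof (eventually_elim, intro ballI)
      fix T z assume T_bounds: "0 \<le> T \<and> U + B \<le> \<bar>\<rho>\<bar> * T" "0 \<le> T \<and> B \<le> \<bar>\<rho>\<bar> * T" "T1 \<le> T"
        and z_mem: "z \<in> rect \<sigma>0 3 B"
      define y where "y = sgn \<rho> * Im z"
      have y_bounds: "\<bar>y\<bar> \<le> B" using z_mem \<rho>_nonzero by (auto simp: y_def in_cbox_complex_iff abs_mult abs_sgn_eq)
      have Re_z: "Re z \<in> {\<sigma>0..3}" using z_mem by (simp add: in_cbox_complex_iff)
      have "integral {T1..T} (\<lambda>\<tau>. (cmod (sieve_error S Y (z + \<i> * of_real (\<rho> * \<tau>))))\<^sup>2)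
          = integral {T1..T} (\<lambda>\<tau>. ?h (Re z) (\<bar>\<rho>\<bar> * \<tau> + y))"
        unfolding norm_sieve_error_shift[OF \<rho>_nonzero] y_def ..
      also have "\<dots> \<le> integral {1..\<bar>\<rho>\<bar> * T + y} (?h (Re z)) / \<bar>\<rho>\<bar>"
      proof (rule integral_affine_le)
        show "?h (Re z) integrable_on {1..\<bar>\<rho>\<bar> * T + y}"
          using primes by (intro integrable_continuous_interval continuous_intros
            continuous_on_sieve_error_vertical) auto
      qed (use \<rho>_nonzero T1_bounds T_bounds y_bounds in auto)
      also have "\<dots> \<le> (\<eta> / 2 * (\<bar>\<rho>\<bar> * T + y)) / \<bar>\<rho>\<bar>"
        using threshold Re_z T_bounds y_bounds by (intro divide_right_mono) auto
      also have "\<dots> \<le> (\<eta> / 2 * (2 * (\<bar>\<rho>\<bar> * T))) / \<bar>\<rho>\<bar>"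
      proof (intro divide_right_mono mult_left_mono)
        show "\<bar>\<rho>\<bar> * T + y \<le> 2 * (\<bar>\<rho>\<bar> * T)" using T_bounds y_bounds by linarith
      qed (use \<eta>_pos in auto)
      also have "\<dots> = \<eta> * T" using \<rho>_nonzero by simp
      finally show "integral {T1..T} (\<lambda>\<tau>. (cmod (sieve_error S Y (z + \<i> * of_real (\<rho> * \<tau>))))\<^sup>2) \<le> \<eta> * T" .
    qed
  qed
qed

lemma continuous_on_shifted:
  assumes continuous_f: "continuous_on (- {1}) f" and z_mem: "z \<in> rect \<sigma>0 3 B"
    and T1_bounds: "0 \<le> T1" "B + 1 \<le> \<bar>\<rho>\<bar> * T1"
  shows "continuous_on {T1..T} (\<lambda>\<tau>. f (z + \<i> * of_real (\<rho> * \<tau>)))"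
proof (rule continuous_on_compose2[OF continuous_f])
  show "continuous_on {T1..T} (\<lambda>\<tau>. z + \<i> * of_real (\<rho> * \<tau>))" by (intro continuous_intros)
  have "\<bar>Im z\<bar> \<le> B" using z_mem by (auto simp: in_cbox_complex_iff)
  from shifted_Im_far[OF this T1_bounds] show "(\<lambda>\<tau>. z + \<i> * of_real (\<rho> * \<tau>)) ` {T1..T} \<subseteq> - {1}"
    by (fastforce simp: complex_eq_iff)
qed

lemma weighted_mean_square_add_le:
  fixes W :: "real \<Rightarrow> real" and D E :: "real \<Rightarrow> complex"
  assumes "continuous_on {a..b} W" "continuous_on {a..b} D" "continuous_on {a..b} E"
    and W_bounds: "\<And>\<tau>. 0 \<le> W \<tau>" "\<And>\<tau>. W \<tau> \<le> 1"
  shows "integral {a..b} (\<lambda>\<tau>. W \<tau> * (cmod (D \<tau> + E \<tau>))\<^sup>2)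
    \<le> 2 * integral {a..b} (\<lambda>\<tau>. W \<tau> * (cmod (D \<tau>))\<^sup>2) + 2 * integral {a..b} (\<lambda>\<tau>. (cmod (E \<tau>))\<^sup>2)"
proof -
  have integrables: "(\<lambda>\<tau>. W \<tau> * (cmod (D \<tau>))\<^sup>2) integrable_on {a..b}" "(\<lambda>\<tau>. (cmod (E \<tau>))\<^sup>2) integrable_on {a..b}"
    "(\<lambda>\<tau>. W \<tau> * (cmod (D \<tau> + E \<tau>))\<^sup>2) integrable_on {a..b}"
    by (intro integrable_continuous_interval continuous_intros assms)+
  have "integral {a..b} (\<lambda>\<tau>. W \<tau> * (cmod (D \<tau> + E \<tau>))\<^sup>2)
      \<le> integral {a..b} (\<lambda>\<tau>. 2 * (W \<tau> * (cmod (D \<tau>))\<^sup>2) + 2 * (cmod (E \<tau>))\<^sup>2)"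
  proof (intro integral_le integrables integrable_add integrable_on_mult_right)
    fix \<tau>
    have "W \<tau> * (cmod (D \<tau> + E \<tau>))\<^sup>2 \<le> W \<tau> * (2 * (cmod (D \<tau>))\<^sup>2 + 2 * (cmod (E \<tau>))\<^sup>2)"
      by (intro mult_left_mono norm_add_square_le W_bounds)
    moreover have "W \<tau> * (cmod (E \<tau>))\<^sup>2 \<le> 1 * (cmod (E \<tau>))\<^sup>2" by (intro mult_right_mono W_bounds) simp
    ultimately show "W \<tau> * (cmod (D \<tau> + E \<tau>))\<^sup>2 \<le> 2 * (W \<tau> * (cmod (D \<tau>))\<^sup>2) + 2 * (cmod (E \<tau>))\<^sup>2"
      by (simp add: algebra_simps)
  qed
  also have "\<dots> = 2 * integral {a..b} (\<lambda>\<tau>. W \<tau> * (cmod (D \<tau>))\<^sup>2) + 2 * integral {a..b} (\<lambda>\<tau>. (cmod (E \<tau>))\<^sup>2)"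
    by (subst integral_add) (auto intro!: integrable_on_mult_right integrables)
  finally show ?thesis .
qed

lemma weighted_sieved_deviation_mean_square_le:
  fixes \<rho> :: real and N :: nat
  assumes Y_gt_1: "Y > 1" and z_mem: "z \<in> rect \<sigma>0 3 B"
    and T1_bounds: "0 \<le> T1" "B + 1 \<le> \<bar>\<rho>\<bar> * T1"
  defines "S \<equiv> primes_upto N"
  shows "integral {T1..T} (\<lambda>\<tau>. weight S m c \<tau> * (cmod (sieved_deviation S (\<rho> * \<tau>) z))\<^sup>2)
    \<le> 2 * integral {0..T} (\<lambda>\<tau>. weight S m c \<tau> * (cmod (sieved_sum S Y (z + \<i> * of_real (\<rho> * \<tau>)) - 1))\<^sup>2)
      + 2 * integral {T1..T} (\<lambda>\<tau>. (cmod (sieve_error S Y (z + \<i> * of_real (\<rho> * \<tau>))))\<^sup>2)"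
proof -
  define D E where "D = (\<lambda>\<tau>. sieved_sum S Y (z + \<i> * of_real (\<rho> * \<tau>)) - 1)"
    and "E = (\<lambda>\<tau>. sieve_error S Y (z + \<i> * of_real (\<rho> * \<tau>)))"
  have continuous_D: "continuous_on A D" for A
    unfolding D_def S_def sieved_sum_eq_trig_poly[OF Y_gt_1] by (rule continuous_on_trig_poly)
  have continuous_E: "continuous_on {T1..T} E"
    unfolding E_def
    by (intro continuous_on_shifted[OF _ z_mem T1_bounds] holomorphic_on_imp_continuous_on
      holomorphic_sieve_error) (simp add: S_def)
  have "sieved_deviation S (\<rho> * \<tau>) z = D \<tau> + E \<tau>" for \<tau>
    by (simp add: sieved_deviation_def sieve_error_def D_def E_def)
  hence "integral {T1..T} (\<lambda>\<tau>. weight S m c \<tau> * (cmod (sieved_deviation S (\<rho> * \<tau>) z))\<^sup>2)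
      \<le> 2 * integral {T1..T} (\<lambda>\<tau>. weight S m c \<tau> * (cmod (D \<tau>))\<^sup>2) + 2 * integral {T1..T} (\<lambda>\<tau>. (cmod (E \<tau>))\<^sup>2)"
    by (simp only:) (intro weighted_mean_square_add_le continuous_on_weight continuous_D continuous_E weight_bounds)
  also have "integral {T1..T} (\<lambda>\<tau>. weight S m c \<tau> * (cmod (D \<tau>))\<^sup>2)
    \<le> integral {0..T} (\<lambda>\<tau>. weight S m c \<tau> * (cmod (D \<tau>))\<^sup>2)"
    using T1_bounds(1)
    by (intro integral_subset_le integrable_continuous_interval continuous_intros continuous_on_weight continuous_D)
      (auto intro!: mult_nonneg_nonneg weight_bounds)
  finally show ?thesis by (simp add: D_def E_def)
qed

lemma eventually_weighted_sieved_deviation_mean_square_le: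
  assumes \<sigma>0_bounds: "1 / 2 < \<sigma>0" "\<sigma>0 < 1" and \<eta>_pos: "\<eta> > 0" and \<rho>_nonzero: "\<rho> \<noteq> 0"
    and T1_bounds: "0 \<le> T1" "B + 1 \<le> \<bar>\<rho>\<bar> * T1"
    and nonres: "log_nonresonant N (c / \<rho>)"
  shows "\<forall>\<^sub>F T in at_top. \<forall>z\<in>rect \<sigma>0 3 B.
    integral {T1..T} (\<lambda>\<tau>. weight (primes_upto N) m c \<tau> * (cmod (sieved_deviation (primes_upto N) (\<rho> * \<tau>) z))\<^sup>2)
      \<le> (2 * weight_mean (primes_upto N) m c * powr_tail (2 * \<sigma>0) (Suc N) + \<eta>) * T"
proof -
  let ?S = "primes_upto N" and ?Z = "rect \<sigma>0 3 B"
  have primes: "finite ?S" "\<forall>p\<in>?S. prime p" by auto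
  have \<eta>_quarter_pos: "\<eta> / 4 > 0" using \<eta>_pos by simp
  obtain Y where Y_gt_1: "Y > 1" and error: "\<forall>\<^sub>F T in at_top. \<forall>z\<in>?Z.
      integral {T1..T} (\<lambda>\<tau>. (cmod (sieve_error ?S Y (z + \<i> * of_real (\<rho> * \<tau>))))\<^sup>2) \<le> \<eta> / 4 * T"
    using eventually_happens'[OF trivial_limit_at_top_linorder
        eventually_conj[OF eventually_gt_at_top[of 1]
          eventually_shifted_sieve_error_mean_square_le[OF primes \<sigma>0_bounds \<eta>_quarter_pos \<rho>_nonzero T1_bounds(2)]]]
    by (elim exE conjE)
  from eventually_weighted_sieved_sum_mean_square_le[OF \<sigma>0_bounds(1) \<rho>_nonzero Y_gt_1 \<eta>_quarter_pos
    nonres, of m] error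
  show ?thesis
  proof (eventually_elim, intro ballI)
    fix T z
    assume main: "\<forall>z. \<sigma>0 \<le> Re z \<longrightarrow>
        integral {0..T} (\<lambda>\<tau>. weight ?S m c \<tau> * (cmod (sieved_sum ?S Y (z + \<i> * of_real (\<rho> * \<tau>)) - 1))\<^sup>2)
        \<le> (weight_mean ?S m c * powr_tail (2 * \<sigma>0) (Suc N) + \<eta> / 4) * T"
      and error: "\<forall>z\<in>?Z. integral {T1..T} (\<lambda>\<tau>. (cmod (sieve_error ?S Y (z + \<i> * of_real (\<rho> * \<tau>))))\<^sup>2) \<le> \<eta> / 4 * T"
      and z_mem: "z \<in> ?Z"
    have "\<sigma>0 \<le> Re z" using z_mem by (simp add: in_cbox_complex_iff)
    note weighted_sieved_deviation_mean_square_le[OF Y_gt_1 z_mem T1_bounds, of T N m c]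
      main[THEN spec, THEN mp, OF this] bspec[OF error z_mem]
    thus "integral {T1..T} (\<lambda>\<tau>. weight ?S m c \<tau> * (cmod (sieved_deviation ?S (\<rho> * \<tau>) z))\<^sup>2)
        \<le> (2 * weight_mean ?S m c * powr_tail (2 * \<sigma>0) (Suc N) + \<eta>) * T"
      unfolding distrib_right mult.assoc by linarith
  qed
qed

section \<open>Circle means\<close>

definition circle_mean_square :: "(complex \<Rightarrow> complex) \<Rightarrow> complex \<Rightarrow> real \<Rightarrow> real" where
  "circle_mean_square f c r = integral {0..1} (\<lambda>t. (cmod (f (circlepath c r t)))\<^sup>2)"

lemma circle_mean_square_nonneg: "circle_mean_square f c r \<ge> 0"
  unfolding circle_mean_square_def
  by (cases "(\<lambda>t. (cmod (f (circlepath c r t)))\<^sup>2) integrable_on {0..1}")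
    (auto intro: integral_nonneg simp: not_integrable_integral)

lemma circlepath_in_cball: "0 < r \<Longrightarrow> circlepath c r t \<in> cball c r"
  by (simp add: circlepath dist_norm norm_mult)

lemma norm_cauchy_integrand_le:
  assumes r_pos: "r > 0" and z_near: "cmod (z - c) \<le> r / 2" and t_mem: "t \<in> {0..1}"
  shows "cmod (w / (circlepath c r t - z) * vector_derivative (circlepath c r) (at t within {0..1}))
    \<le> 4 * pi * cmod w"
proof -
  have "cmod (circlepath c r t - c) = r" using r_pos by (simp add: circlepath norm_mult)
  moreover have "cmod (circlepath c r t - c) \<le> cmod (circlepath c r t - z) + cmod (z - c)"
    using norm_triangle_ineq[of "circlepath c r t - z" "z - c"] by simp
  ultimately have far: "cmod (circlepath c r t - z) \<ge> r / 2" using z_near by linarith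
  have speed: "cmod (vector_derivative (circlepath c r) (at t within {0..1})) = 2 * pi * r"
    using t_mem r_pos by (simp add: vector_derivative_circlepath01 norm_mult)
  have "cmod (w / (circlepath c r t - z) * vector_derivative (circlepath c r) (at t within {0..1}))
      \<le> cmod w / (r / 2) * (2 * pi * r)"
    unfolding norm_mult norm_divide speed
    using far r_pos by (intro mult_right_mono divide_left_mono mult_pos_pos) auto
  also have "\<dots> = 4 * pi * cmod w" using r_pos by (simp add: field_simps)
  finally show ?thesis .
qed

text \<open>Cauchy's formula applied to \<open>f\<^sup>2\<close>.\<close>
lemma norm_square_le_circle_mean_square:
  assumes holomorphic_f: "f holomorphic_on cball c r" and r_pos: "r > 0" and z_near: "cmod (z - c) \<le> r / 2"
  shows "(cmod (f z))\<^sup>2 \<le> 2 * circle_mean_square f c r"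
proof -
  let ?g = "\<lambda>t. (f (circlepath c r t))\<^sup>2 / (circlepath c r t - z) * vector_derivative (circlepath c r)
    (at t within {0..1})"
  have "(\<lambda>u. (f u)\<^sup>2) holomorphic_on cball c r" using holomorphic_f by (intro holomorphic_intros)
  from Cauchy_integral_circlepath_simple[OF this, of z] z_near r_pos
  have cauchy: "(?g has_integral (2 * of_real pi * \<i> * (f z)\<^sup>2)) {0..1}" by (simp add: has_contour_integral_def)
  have "continuous_on {0..1} (\<lambda>t. (cmod (f (circlepath c r t)))\<^sup>2)"
  proof (intro continuous_intros continuous_on_compose2[OF holomorphic_on_imp_continuous_on[OF holomorphic_f]])
    show "continuous_on {0..1} (circlepath c r)" unfolding circlepath by (intro continuous_intros)
  qed (use circlepath_in_cball[OF r_pos] in auto)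
  hence "cmod (2 * of_real pi * \<i> * (f z)\<^sup>2) \<le> integral {0..1} (\<lambda>t. 4 * pi * (cmod (f (circlepath c r t)))\<^sup>2)"
    unfolding integral_unique[OF cauchy, symmetric] norm_power[symmetric]
    using norm_cauchy_integrand_le[OF r_pos z_near]
    by (intro integral_norm_bound_integral has_integral_integrable[OF cauchy] integrable_on_mult_right
        integrable_continuous_interval) auto
  also have "\<dots> = 4 * pi * circle_mean_square f c r" by (simp add: circle_mean_square_def)
  finally show ?thesis by (simp add: norm_mult norm_power)
qed

lemma continuous_on_circle_param:
  fixes f :: "real \<Rightarrow> complex \<Rightarrow> complex"
  assumes "r > 0" "continuous_on (A \<times> cball c r) (\<lambda>x. f (fst x) (snd x))"
  shows "continuous_on (A \<times> B) (\<lambda>x. (cmod (f (fst x) (circlepath c r (snd x))))\<^sup>2)"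
proof -
  have "continuous_on (A \<times> B) (\<lambda>x. (fst x, circlepath c r (snd x)))"
    unfolding circlepath by (intro continuous_intros)
  from continuous_on_compose2[OF assms(2) this]
  have "continuous_on (A \<times> B) (\<lambda>x. f (fst x) (circlepath c r (snd x)))"
    using circlepath_in_cball[OF assms(1)] by (simp add: image_subset_iff mem_Times_iff)
  thus ?thesis by (intro continuous_intros)
qed

lemma continuous_on_circle_mean_square:
  fixes f :: "real \<Rightarrow> complex \<Rightarrow> complex"
  assumes "r > 0" "continuous_on ({a..b} \<times> cball c r) (\<lambda>x. f (fst x) (snd x))"
  shows "continuous_on {a..b} (\<lambda>\<tau>. circle_mean_square (f \<tau>) c r)"
  using integral_continuous_on_param[of "{a..b}" 0 1 "\<lambda>\<tau> t. (cmod (f \<tau> (circlepath c r t)))\<^sup>2"]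
    continuous_on_circle_param[OF assms, of "cbox 0 1"]
  by (simp add: circle_mean_square_def case_prod_beta')

lemma integral_weighted_circle_mean_square_le:
  fixes f :: "real \<Rightarrow> complex \<Rightarrow> complex" and W :: "real \<Rightarrow> real"
  assumes r_pos: "r > 0" and continuous_f: "continuous_on ({a..b} \<times> cball c r) (\<lambda>x. f (fst x) (snd x))"
    and continuous_W: "continuous_on {a..b} W"
    and pointwise_bound: "\<And>z. z \<in> cball c r \<Longrightarrow> integral {a..b} (\<lambda>\<tau>. W \<tau> * (cmod (f \<tau> z))\<^sup>2) \<le> Bd"
  shows "integral {a..b} (\<lambda>\<tau>. W \<tau> * circle_mean_square (f \<tau>) c r) \<le> Bd"
proof -
  let ?F = "\<lambda>\<tau> t. W \<tau> * (cmod (f \<tau> (circlepath c r t)))\<^sup>2"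
  have "continuous_on ({a..b} \<times> {0..1}) (\<lambda>x. ?F (fst x) (snd x))"
    by (intro continuous_intros continuous_on_circle_param[OF r_pos continuous_f]
      continuous_on_compose2[OF continuous_W]) auto
  hence cont: "continuous_on (cbox (a, 0) (b, 1)) (\<lambda>(\<tau>, t). ?F \<tau> t)"
    by (simp add: case_prod_beta' cbox_Pair_eq)
  have "continuous_on ({0..1} \<times> {a..b}) (\<lambda>x. (\<lambda>(\<tau>, t). ?F \<tau> t) (snd x, fst x))"
    by (rule continuous_on_compose2[OF cont]) (auto intro!: continuous_intros simp: cbox_Pair_eq)
  hence continuous_inner: "continuous_on {0..1} (\<lambda>t. integral {a..b} (\<lambda>\<tau>. ?F \<tau> t))"
    using integral_continuous_on_param[of "{0..1}" a b "\<lambda>t \<tau>. ?F \<tau> t"] by (simp add: case_prod_beta')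
  have "integral {a..b} (\<lambda>\<tau>. W \<tau> * circle_mean_square (f \<tau>) c r) = integral {a..b} (\<lambda>\<tau>. integral {0..1} (?F \<tau>))"
    by (simp add: circle_mean_square_def)
  also have "\<dots> = integral {0..1} (\<lambda>t. integral {a..b} (\<lambda>\<tau>. ?F \<tau> t))"
    using integral_swap_continuous[OF cont] by simp
  also have "\<dots> \<le> integral {0..1} (\<lambda>t::real. Bd)"
    using continuous_inner pointwise_bound[OF circlepath_in_cball[OF r_pos]]
      by (intro integral_le integrable_continuous_interval) auto
  also have "\<dots> = Bd" by simp
  finally show ?thesis .
qed

lemma exists_square_majorant:
  fixes f :: "real \<Rightarrow> complex \<Rightarrow> complex" and W :: "real \<Rightarrow> real"
  assumes cover: "finite C" "Q \<subseteq> (\<Union>c\<in>C. ball c (r / 2))" "\<forall>c\<in>C. cball c r \<subseteq> U" and r_pos: "r > 0"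
    and regular_f: "continuous_on ({a..b} \<times> U) (\<lambda>x. f (fst x) (snd x))" "\<forall>\<tau>\<in>{a..b}. f \<tau> holomorphic_on U"
    and continuous_W: "continuous_on {a..b} W"
    and pointwise_bound: "\<forall>z\<in>U. integral {a..b} (\<lambda>\<tau>. W \<tau> * (cmod (f \<tau> z))\<^sup>2) \<le> Bd"
  shows "\<exists>G. continuous_on {a..b} G \<and> (\<forall>\<tau>\<in>{a..b}. 0 \<le> G \<tau> \<and> (\<forall>z\<in>Q. (cmod (f \<tau> z))\<^sup>2 \<le> G \<tau>)) \<and>
           integral {a..b} (\<lambda>\<tau>. W \<tau> * G \<tau>) \<le> 2 * real (card C) * Bd"
proof (intro exI conjI ballI)
  let ?M = "\<lambda>c \<tau>. circle_mean_square (f \<tau>) c r"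
  have f_cball: "continuous_on ({a..b} \<times> cball c r) (\<lambda>x. f (fst x) (snd x))" if "c \<in> C" for c
    using cover(3) that by (intro continuous_on_subset[OF regular_f(1)]) auto
  have continuous_M: "continuous_on {a..b} (?M c)" if "c \<in> C" for c
    by (rule continuous_on_circle_mean_square[OF r_pos f_cball[OF that]])
  have le_cball: "\<forall>c\<in>C. \<forall>z\<in>cball c r. integral {a..b} (\<lambda>\<tau>. W \<tau> * (cmod (f \<tau> z))\<^sup>2) \<le> Bd"
    using cover(3) pointwise_bound by blast
  show "continuous_on {a..b} (\<lambda>\<tau>. 2 * (\<Sum>c\<in>C. ?M c \<tau>))" by (intro continuous_intros continuous_M)
  show "0 \<le> 2 * (\<Sum>c\<in>C. ?M c \<tau>)" for \<tau> by (intro mult_nonneg_nonneg sum_nonneg circle_mean_square_nonneg) simp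
  show "(cmod (f \<tau> z))\<^sup>2 \<le> 2 * (\<Sum>c\<in>C. ?M c \<tau>)" if \<tau>_mem: "\<tau> \<in> {a..b}" and z_mem: "z \<in> Q" for \<tau> z
  proof -
    obtain c where near_center: "c \<in> C" "cmod (z - c) < r / 2"
      using cover(2) z_mem by (auto simp: dist_norm norm_minus_commute)
    have "(cmod (f \<tau> z))\<^sup>2 \<le> 2 * ?M c \<tau>"
      using cover(3) near_center r_pos
      by (intro norm_square_le_circle_mean_square holomorphic_on_subset[OF bspec[OF regular_f(2) \<tau>_mem]]) auto
    moreover have "?M c \<tau> \<le> (\<Sum>c\<in>C. ?M c \<tau>)"
      by (rule member_le_sum[OF near_center(1)]) (auto intro: circle_mean_square_nonneg cover)
    ultimately show ?thesis by linarith
  qed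
  have "integral {a..b} (\<lambda>\<tau>. W \<tau> * (2 * (\<Sum>c\<in>C. ?M c \<tau>))) = 2 * (\<Sum>c\<in>C. integral {a..b} (\<lambda>\<tau>. W \<tau> * ?M c \<tau>))"
    unfolding mult.left_commute[of _ 2] integral_mult_right sum_distrib_left
    by (subst integral_sum) (auto intro!: cover integrable_continuous_interval continuous_intros
      continuous_W continuous_M)
  also have "\<dots> \<le> 2 * (\<Sum>c\<in>C. Bd)"
    using le_cball by (intro mult_left_mono sum_mono integral_weighted_circle_mean_square_le r_pos f_cball
      continuous_W) auto
  finally show "integral {a..b} (\<lambda>\<tau>. W \<tau> * (2 * (\<Sum>c\<in>C. ?M c \<tau>))) \<le> 2 * real (card C) * Bd" by simp
qed

section \<open>Positive density\<close>

lemma in_rect_iff: "z \<in> rect a b h \<longleftrightarrow> a \<le> Re z \<and> Re z \<le> b \<and> \<bar>Im z\<bar> \<le> h"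
  by (auto simp: in_cbox_complex_iff)

lemma cball_subset_rect:
  assumes "c \<in> rect a b h" "a' \<le> a - r" "b + r \<le> b'" "h + r \<le> h'"
  shows "cball c r \<subseteq> rect a' b' h'"
proof
  fix z assume "z \<in> cball c r"
  hence "\<bar>Re (z - c)\<bar> \<le> r" "\<bar>Im (z - c)\<bar> \<le> r"
    using abs_Re_le_cmod[of "z - c"] abs_Im_le_cmod[of "z - c"] by (auto simp: dist_norm norm_minus_commute)
  thus "z \<in> rect a' b' h'" using assms unfolding in_rect_iff by auto
qed

lemma
  assumes T1_bounds: "0 \<le> T1" "B + 1 \<le> \<bar>\<rho>\<bar> * T1" and primes: "\<forall>p\<in>S. prime p"
  shows continuous_on_sieved_deviation:
      "continuous_on ({T1..T} \<times> rect a b B) (\<lambda>x. sieved_deviation S (\<rho> * fst x) (snd x))"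
    and holomorphic_sieved_deviation: "T1 \<le> \<tau> \<Longrightarrow> sieved_deviation S (\<rho> * \<tau>) holomorphic_on rect a b B"
proof -
  have shift: "z + \<i> * of_real (\<rho> * \<tau>) \<noteq> 1" if "z \<in> rect a b B" "T1 \<le> \<tau>" for z \<tau>
  proof -
    have "\<bar>Im z\<bar> \<le> B" using that(1) unfolding in_rect_iff by simp
    thus ?thesis using shifted_Im_far[of "Im z" B T1 \<rho> \<tau>] that(2) T1_bounds by (auto simp: complex_eq_iff)
  qed
  have zeta: "sieved_zeta S holomorphic_on - {1}" by (rule holomorphic_sieved_zeta[OF primes])
  show "continuous_on ({T1..T} \<times> rect a b B) (\<lambda>x. sieved_deviation S (\<rho> * fst x) (snd x))"
    unfolding sieved_deviation_def using shift
    by (intro continuous_intros continuous_on_compose2[OF holomorphic_on_imp_continuous_on[OF zeta]]) auto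
  show "T1 \<le> \<tau> \<Longrightarrow> sieved_deviation S (\<rho> * \<tau>) holomorphic_on rect a b B"
    unfolding sieved_deviation_def[abs_def] using shift
    by (intro holomorphic_intros holomorphic_on_compose_gen[OF _ zeta, unfolded o_def]) auto
qed

definition is_deviation_majorant :: "nat set \<Rightarrow> real \<Rightarrow> complex set \<Rightarrow> real \<Rightarrow> real \<Rightarrow> (real \<Rightarrow> real) \<Rightarrow> bool" where
  "is_deviation_majorant S \<rho> Q a b G \<longleftrightarrow> continuous_on {a..b} G \<and>
     (\<forall>\<tau>\<in>{a..b}. 0 \<le> G \<tau> \<and> (\<forall>z\<in>Q. (cmod (sieved_deviation S (\<rho> * \<tau>) z))\<^sup>2 \<le> G \<tau>))"

lemma eventually_sieved_deviation_majorant: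
  assumes cover: "finite C" "C \<subseteq> rect \<sigma>1 2 H" "rect \<sigma>1 2 H \<subseteq> (\<Union>c\<in>C. ball c (r / 2))"
    and r_bounds: "0 < r" "r \<le> 1" and \<sigma>0_bounds: "1 / 2 < \<sigma>0" "\<sigma>0 < 1" "\<sigma>0 + r \<le> \<sigma>1"
    and \<rho>_nonzero: "\<rho> \<noteq> 0" and T1_bounds: "0 \<le> T1" "H + 2 \<le> \<bar>\<rho>\<bar> * T1"
    and nonres: "log_nonresonant N (c / \<rho>)"
    and \<xi>_bounds: "4 * real (card C) * powr_tail (2 * \<sigma>0) (Suc N) < \<xi>"
  shows "\<forall>\<^sub>F T in at_top. \<exists>G. is_deviation_majorant (primes_upto N) \<rho> (rect \<sigma>1 2 H) T1 T G \<and>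
    integral {T1..T} (\<lambda>\<tau>. weight (primes_upto N) m c \<tau> * G \<tau>) \<le> \<xi> * weight_mean (primes_upto N) m c * T"
proof -
  let ?S = "primes_upto N" and ?U = "rect \<sigma>0 3 (H + 1)"
  let ?w = "weight_mean ?S m c" and ?tail = "powr_tail (2 * \<sigma>0) (Suc N)"
  define \<eta> where "\<eta> = ?w * (\<xi> - 4 * real (card C) * ?tail) / (2 * (real (card C) + 1))"
  have \<eta>_pos: "\<eta> > 0" using \<xi>_bounds weight_mean_pos[of ?S m c] by (simp add: \<eta>_def)
  have "2 * real (card C) * \<eta> \<le> (2 * (real (card C) + 1)) * \<eta>" using \<eta>_pos by (intro mult_right_mono) auto
  also have "\<dots> = ?w * (\<xi> - 4 * real (card C) * ?tail)" unfolding \<eta>_def by (simp add: field_simps)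
  finally have \<xi>_ge: "2 * real (card C) * (2 * ?w * ?tail + \<eta>) \<le> \<xi> * ?w"
    by (simp add: algebra_simps)
  have cover_subset: "\<forall>c\<in>C. cball c r \<subseteq> ?U"
    using cover(2) r_bounds \<sigma>0_bounds(3) by (intro ballI cball_subset_rect[where a = \<sigma>1 and b = 2 and h = H]) auto
  have T1_far: "H + 1 + 1 \<le> \<bar>\<rho>\<bar> * T1" using T1_bounds by simp
  from eventually_weighted_sieved_deviation_mean_square_le[OF \<sigma>0_bounds(1,2) \<eta>_pos \<rho>_nonzero T1_bounds(1)
    T1_far nonres, of m]
    eventually_ge_at_top[of 0]
  show ?thesis
  proof eventually_elim
    case (elim T)
    have "\<exists>G. is_deviation_majorant ?S \<rho> (rect \<sigma>1 2 H) T1 T G \<and>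
      integral {T1..T} (\<lambda>\<tau>. weight ?S m c \<tau> * G \<tau>)
        \<le> 2 * real (card C) * ((2 * ?w * ?tail + \<eta>) * T)"
      unfolding is_deviation_majorant_def conj_assoc using elim T1_bounds(1) T1_far
      by (intro exists_square_majorant[OF cover(1,3) cover_subset r_bounds(1)]
        continuous_on_sieved_deviation continuous_on_weight ballI
          holomorphic_sieved_deviation) auto
    moreover have "2 * real (card C) * ((2 * ?w * ?tail + \<eta>) * T) \<le> \<xi> * ?w * T"
      using mult_right_mono[OF \<xi>_ge elim(2)] by (simp only: mult.assoc)
    ultimately show ?case using order_trans by blast
  qed
qed

lemma weighted_chebyshev:
  fixes W G :: "real \<Rightarrow> real"
  assumes "a \<le> b" and W_props: "continuous_on {a..b} W" "\<And>\<tau>. 0 \<le> W \<tau>" "\<And>\<tau>. W \<tau> \<le> 1"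
    and G_props: "continuous_on {a..b} G" "\<forall>\<tau>\<in>{a..b}. 0 \<le> G \<tau>" and open_A: "open A"
    and q_nonneg: "q \<ge> 0" and \<eta>_pos: "\<eta> > 0" and exceptional: "\<forall>\<tau>\<in>{a..b} - A. W \<tau> \<le> q \<or> \<eta> \<le> G \<tau>"
  shows "integral {a..b} W \<le> measure lebesgue ({a..b} \<inter> A) + q * (b - a) + integral {a..b} (\<lambda>\<tau>. W \<tau> * G \<tau>) / \<eta>"
proof (rule has_integral_le)
  show "(W has_integral integral {a..b} W) {a..b}"
    by (intro integrable_integral integrable_continuous_interval W_props)
  have int_WG: "(\<lambda>\<tau>. W \<tau> * G \<tau>) integrable_on {a..b}"
    by (intro integrable_continuous_interval continuous_intros G_props W_props)
  show "((\<lambda>\<tau>. indicat_real A \<tau> + q + W \<tau> * G \<tau> / \<eta>) has_integral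
      (measure lebesgue ({a..b} \<inter> A) + q * (b - a) + integral {a..b} (\<lambda>\<tau>. W \<tau> * G \<tau>) / \<eta>)) {a..b}"
  proof (intro has_integral_add has_integral_divide integrable_integral[OF int_WG])
    have "{a..b} \<inter> A \<in> lmeasurable" using open_A by (intro fmeasurable_Int_fmeasurable) auto
    thus "(indicat_real A has_integral measure lebesgue ({a..b} \<inter> A)) {a..b}"
      by (simp add: has_integral_iff integrable_on_indicator integral_indicator Int_commute)
    show "((\<lambda>\<tau>. q) has_integral q * (b - a)) {a..b}"
      using has_integral_const_real[of q a b] assms(1) by (simp add: mult.commute)
  qed
  fix \<tau> assume \<tau>_mem: "\<tau> \<in> {a..b}"
  have nonneg: "0 \<le> W \<tau> * G \<tau> / \<eta>" "0 \<le> indicat_real A \<tau>" using G_props(2) \<tau>_mem W_props(2) \<eta>_pos by simp_all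
  from exceptional \<tau>_mem consider "\<tau> \<in> A" | "W \<tau> \<le> q" | "\<eta> \<le> G \<tau>" by blast
  thus "W \<tau> \<le> indicat_real A \<tau> + q + W \<tau> * G \<tau> / \<eta>"
  proof cases
    case 1
    thus ?thesis using W_props(3)[of \<tau>] nonneg q_nonneg by simp
  next
    case 2
    thus ?thesis using nonneg by linarith
  next
    case 3
    hence "W \<tau> \<le> W \<tau> * G \<tau> / \<eta>" using mult_left_mono[OF 3 W_props(2)[of \<tau>]] \<eta>_pos by (simp add: field_simps)
    thus ?thesis using nonneg q_nonneg by linarith
  qed
qed

lemma weighted_measure_lower_bound:
  fixes W G :: "real \<Rightarrow> real"
  assumes endpoints: "0 \<le> T1" "T1 \<le> T" and W_props: "\<And>B. continuous_on B W" "\<And>\<tau>. 0 \<le> W \<tau>" "\<And>\<tau>. W \<tau> \<le> 1"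
    and G_props: "continuous_on {T1..T} G" "\<forall>\<tau>\<in>{T1..T}. 0 \<le> G \<tau>" and open_A: "open A"
    and q_nonneg: "q \<ge> 0" and \<eta>_pos: "\<eta> > 0" and exceptional: "\<forall>\<tau>\<in>{T1..T} - A. W \<tau> \<le> q \<or> \<eta> \<le> G \<tau>"
  shows "integral {0..T} W \<le> measure lebesgue ({0..T} \<inter> A) + T1 + q * T + integral {T1..T} (\<lambda>\<tau>. W \<tau> * G \<tau>) / \<eta>"
proof -
  have int_W: "W integrable_on {a..b}" for a b by (intro integrable_continuous_interval W_props)
  have "integral {0..T} W = integral {0..T1} W + integral {T1..T} W"
    using Henstock_Kurzweil_Integration.integral_combine[OF endpoints int_W] by simp
  moreover have "integral {0..T1} W \<le> T1"
    using integral_le[OF int_W integrable_const_ivl[of 1 0 T1] W_props(3)] endpoints by simp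
  moreover have "{a..b} \<inter> A \<in> lmeasurable" for a b :: real
    using open_A by (intro fmeasurable_Int_fmeasurable) auto
  hence "measure lebesgue ({T1..T} \<inter> A) \<le> measure lebesgue ({0..T} \<inter> A)"
    using endpoints by (intro measure_mono_fmeasurable) (auto dest: fmeasurableD)
  moreover have "q * (T - T1) \<le> q * T" using q_nonneg endpoints by (intro mult_left_mono) auto
  ultimately show ?thesis
    using weighted_chebyshev[OF endpoints(2) W_props G_props open_A q_nonneg \<eta>_pos exceptional] by linarith
qed

lemma compact_subset_strip_bounds:
  assumes "compact K" "K \<subseteq> {s. 1 / 2 < Re s \<and> Re s < 1}"
  shows "\<exists>\<sigma>1 H. 1 / 2 < \<sigma>1 \<and> \<sigma>1 < 1 \<and> (\<forall>s\<in>K. \<sigma>1 < Re s \<and> Re s < 1 \<and> \<bar>Im s\<bar> < H)"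
proof (cases "K = {}")
  case False
  obtain s0 where leftmost: "s0 \<in> K" "\<forall>s\<in>K. Re s0 \<le> Re s"
    using continuous_attains_inf[OF assms(1) False continuous_on_Re[OF continuous_on_id]] by auto
  obtain B where norm_le: "B > 0" "\<forall>s\<in>K. norm s \<le> B" using compact_imp_bounded[OF assms(1)] bounded_pos by blast
  obtain \<sigma>1 where \<sigma>1_bounds: "1 / 2 < \<sigma>1" "\<sigma>1 < Re s0" using dense[of "1 / 2" "Re s0"] leftmost(1) assms(2) by auto
  have "\<sigma>1 < Re s \<and> Re s < 1 \<and> \<bar>Im s\<bar> < B + 1" if "s \<in> K" for s
    using that leftmost(2) \<sigma>1_bounds(2) norm_le(2) abs_Im_le_cmod[of s] assms(2) by force
  moreover from this[OF leftmost(1)] have "\<sigma>1 < 1" by linarith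
  ultimately show ?thesis using \<sigma>1_bounds(1) norm_le(1) by (intro exI[of _ \<sigma>1] exI[of _ "B + 1"]) auto
qed (rule exI[of _ "3 / 4"], rule exI[of _ 1], simp)

lemma exists_sieve_level:
  assumes "a > 1" "\<eta> > 0" "finite I"
  shows "\<exists>N. powr_tail 2 (Suc N) < 1 / 4 \<and> B * powr_tail a (Suc N) < \<eta> \<and> (\<forall>i\<in>I. log_nonresonant N (\<beta> i))"
proof -
  have tail: "\<forall>\<^sub>F N in sequentially. B * powr_tail b (Suc N) < \<delta>" if "b > 1" "\<delta> > 0" for B b \<delta>
    using tendsto_mult_right_zero[OF LIMSEQ_Suc[OF powr_tail_tendsto_0[OF that(1)]], of B] that(2)
    by (rule order_tendstoD)
  have "\<forall>\<^sub>F N in sequentially. 1 * powr_tail 2 (Suc N) < 1 / 4 \<and> B * powr_tail a (Suc N) < \<eta> \<and>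
      (\<forall>i\<in>I. log_nonresonant N (\<beta> i))"
    using assms by (intro eventually_conj tail eventually_ball_finite ballI eventually_log_nonresonant) auto
  thus ?thesis unfolding mult_1 by (rule eventually_happens'[OF sequentially_bot])
qed

lemma exists_ge_divided_by_finite_set:
  fixes R :: "real set"
  assumes "finite R" "0 \<notin> R"
  shows "\<exists>T\<ge>0. \<forall>\<rho>\<in>R. h \<le> \<bar>\<rho>\<bar> * T"
proof -
  have "\<forall>\<^sub>F T in at_top. 0 \<le> T \<and> h \<le> \<bar>\<rho>\<bar> * T" if "\<rho> \<in> R" for \<rho>
    using that assms(2) by (intro eventually_const_le_mult_at_top) auto
  from eventually_ball_finite[OF assms(1) ballI[OF this]]
  have "\<forall>\<^sub>F T in at_top. 0 \<le> T \<and> (\<forall>\<rho>\<in>R. 0 \<le> T \<and> h \<le> \<bar>\<rho>\<bar> * T)"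
    by (rule eventually_conj[OF eventually_ge_at_top])
  from eventually_happens'[OF trivial_limit_at_top_linorder this] show ?thesis by auto
qed

lemma log_zeta_near_sum_euler_log:
  assumes tail: "powr_tail 2 (Suc N) < 1 / 4" and \<sigma>1_nonneg: "\<sigma>1 \<ge> 0" and H_bounds: "H \<le> \<bar>t\<bar>"
    and \<delta>_bounds: "\<delta> \<le> 1 / 2"
    and close: "\<forall>z\<in>rect \<sigma>1 2 H. cmod (sieved_deviation (primes_upto N) t z) < \<delta>"
    and s_bounds: "\<sigma>1 < Re s" "Re s \<le> 2" "\<bar>Im s\<bar> < H"
  shows "s + \<i> * of_real t \<in> log_zeta_dom"
    and "cmod (log_zeta (s + \<i> * of_real t) - (\<Sum>p\<in>primes_upto N. euler_log (s + \<i> * of_real t) p)) < 2 * \<delta>"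
proof -
  let ?U = "half_strip \<sigma>1 (t - H) (t + H)" and ?s = "s + \<i> * of_real t"
  have strip_close: "\<forall>z\<in>?U. Re z \<le> 2 \<longrightarrow> cmod (sieved_zeta (primes_upto N) z - 1) < 1 / 2"
  proof (intro ballI impI)
    fix z assume "z \<in> ?U" "Re z \<le> 2"
    hence "z - \<i> * of_real t \<in> rect \<sigma>1 2 H" by (auto simp: in_rect_iff half_strip_def abs_le_iff)
    from bspec[OF close this] show "cmod (sieved_zeta (primes_upto N) z - 1) < 1 / 2"
      using \<delta>_bounds by (simp add: sieved_deviation_def)
  qed
  have "1 \<notin> ?U" using H_bounds by (auto simp: half_strip_def)
  moreover have "?s \<in> ?U" using s_bounds by (auto simp: half_strip_def)
  ultimately have log_zeta_eq: "?s \<in> log_zeta_dom"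
    "log_zeta ?s = (\<Sum>p\<in>primes_upto N. euler_log ?s p) + Ln (sieved_zeta (primes_upto N) ?s)"
    using log_zeta_eq_sum_plus_Ln[OF tail \<sigma>1_nonneg _ strip_close] by auto
  show "?s \<in> log_zeta_dom" by (rule log_zeta_eq(1))
  have "cmod (sieved_deviation (primes_upto N) t s) < \<delta>" using close s_bounds by (auto simp: in_rect_iff)
  moreover from this have "cmod (Ln (1 + sieved_deviation (primes_upto N) t s))
    \<le> 2 * cmod (sieved_deviation (primes_upto N) t s)"
    using \<delta>_bounds by (intro norm_Ln_le) simp
  ultimately show "cmod (log_zeta ?s - (\<Sum>p\<in>primes_upto N. euler_log ?s p)) < 2 * \<delta>"
    unfolding log_zeta_eq(2) by (simp add: sieved_deviation_def)
qed

lemma log_zeta_approx_shiftsI: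
  assumes tail: "powr_tail 2 (Suc N) < 1 / 4" and \<sigma>1_bounds: "\<sigma>1 \<ge> 1 / 2" and far_up: "\<forall>\<rho>\<in>{1, d}. H \<le> \<bar>\<rho> * \<tau>\<bar>"
    and close: "\<forall>\<rho>\<in>{1, d}. \<forall>z\<in>rect \<sigma>1 2 H. cmod (sieved_deviation (primes_upto N) (\<rho> * \<tau>) z) < \<delta>"
    and phases: "\<forall>p\<in>primes_upto N. cmod (1 - cis ((1 - d) * \<tau> * ln (real p))) < x"
    and \<delta>_bounds: "\<delta> \<le> 1 / 2" "4 * \<delta> + 4 * x * real (card (primes_upto N)) \<le> \<epsilon>"
    and K_bounds: "\<forall>s\<in>K. \<sigma>1 < Re s \<and> Re s < 1 \<and> \<bar>Im s\<bar> < H"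
  shows "\<tau> \<in> log_zeta_approx_shifts d K \<epsilon>"
  unfolding log_zeta_approx_shifts_def
proof (intro CollectI ballI)
  fix s assume "s \<in> K"
  hence s_bounds: "\<sigma>1 < Re s" "Re s \<le> 2" "\<bar>Im s\<bar> < H" using K_bounds by force+
  let ?s = "\<lambda>\<rho>. s + \<i> * of_real (\<rho> * \<tau>)"
  let ?L = "\<lambda>\<rho>. \<Sum>p\<in>primes_upto N. euler_log (?s \<rho>) p"
  have near: "?s \<rho> \<in> log_zeta_dom \<and> cmod (log_zeta (?s \<rho>) - ?L \<rho>) < 2 * \<delta>" if "\<rho> \<in> {1, d}" for \<rho>
    using log_zeta_near_sum_euler_log[OF tail _ bspec[OF far_up that] \<delta>_bounds(1) bspec[OF close that]
      s_bounds] \<sigma>1_bounds by simp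
  have "cmod (?L 1 - ?L d) \<le> (\<Sum>p\<in>primes_upto N. 4 * x)"
    unfolding sum_subtractf[symmetric]
  proof (intro sum_norm_le)
    fix p assume p_mem: "p \<in> primes_upto N"
    have "cmod (euler_log (?s 1) p - euler_log (?s d) p) \<le> 4 * cmod (1 - cis ((1 * \<tau> - d * \<tau>) * ln (real p)))"
      using p_mem s_bounds \<sigma>1_bounds by (intro norm_euler_log_diff_le) auto
    also have "(1 * \<tau> - d * \<tau>) * ln (real p) = (1 - d) * \<tau> * ln (real p)" by (simp add: algebra_simps)
    also have "4 * cmod (1 - cis ((1 - d) * \<tau> * ln (real p))) \<le> 4 * x"
      using phases p_mem by (simp add: less_imp_le)
    finally show "cmod (euler_log (?s 1) p - euler_log (?s d) p) \<le> 4 * x" .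
  qed
  hence euler_logs_close: "cmod (?L 1 - ?L d) \<le> 4 * x * real (card (primes_upto N))" by (simp add: mult_ac)
  have "cmod (log_zeta (?s 1) - log_zeta (?s d))
      \<le> cmod (log_zeta (?s 1) - ?L 1) + cmod (?L 1 - ?L d) + cmod (log_zeta (?s d) - ?L d)"
    using norm_triangle_ineq4[of "log_zeta (?s 1) - ?L 1 + (?L 1 - ?L d)" "log_zeta (?s d) - ?L d"]
      norm_triangle_ineq[of "log_zeta (?s 1) - ?L 1" "?L 1 - ?L d"] by simp
  also have "\<dots> < \<epsilon>" using near[of 1] near[of d] euler_logs_close \<delta>_bounds(2) by auto
  finally show "s + \<i> * of_real \<tau> \<in> log_zeta_dom \<and> s + \<i> * of_real (d * \<tau>) \<in> log_zeta_dom \<and>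
      norm (log_zeta (s + \<i> * of_real \<tau>) - log_zeta (s + \<i> * of_real (d * \<tau>))) < \<epsilon>"
    using near[of 1] near[of d] by simp
qed

lemma log_zeta_approx_shifts_if_weight_large:
  assumes tail: "powr_tail 2 (Suc N) < 1 / 4" and \<sigma>1_bounds: "\<sigma>1 \<ge> 1 / 2"
    and K_bounds: "\<forall>s\<in>K. \<sigma>1 < Re s \<and> Re s < 1 \<and> \<bar>Im s\<bar> < H"
    and T1_far: "0 \<le> T1" "\<forall>\<rho>\<in>{1, d}. H \<le> \<bar>\<rho>\<bar> * T1"
    and \<delta>_bounds: "0 < \<delta>" "\<delta> \<le> 1 / 2" and x_bounds: "0 < x" "x \<le> 2"
    and \<epsilon>_bounds: "4 * \<delta> + 4 * x * real (card (primes_upto N)) \<le> \<epsilon>"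
    and majorants: "\<forall>\<rho>\<in>{1, d}. is_deviation_majorant (primes_upto N) \<rho> (rect \<sigma>1 2 H) T1 T (G \<rho>)"
    and \<tau>_mem: "\<tau> \<in> {T1..T}" and large: "weight (primes_upto N) m (1 - d) \<tau> > (1 - x\<^sup>2 / 4) ^ m"
    and small: "G 1 \<tau> + G d \<tau> < \<delta>\<^sup>2"
  shows "\<tau> \<in> log_zeta_approx_shifts d K \<epsilon>"
proof (rule log_zeta_approx_shiftsI[OF tail \<sigma>1_bounds _ _ _ \<delta>_bounds(2) \<epsilon>_bounds K_bounds])
  show "\<forall>p\<in>primes_upto N. cmod (1 - cis ((1 - d) * \<tau> * ln (real p))) < x"
    using x_bounds large by (intro ballI weight_gt_imp_phase_small[of "primes_upto N"]) auto
  show "\<forall>\<rho>\<in>{1, d}. \<forall>z\<in>rect \<sigma>1 2 H. cmod (sieved_deviation (primes_upto N) (\<rho> * \<tau>) z) < \<delta>"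
  proof (intro ballI)
    fix \<rho> z assume \<rho>_mem: "\<rho> \<in> {1, d}" and z_mem: "z \<in> rect \<sigma>1 2 H"
    have "(cmod (sieved_deviation (primes_upto N) (\<rho> * \<tau>) z))\<^sup>2 \<le> G \<rho> \<tau>" "0 \<le> G 1 \<tau>" "0 \<le> G d \<tau>"
      using majorants \<rho>_mem z_mem \<tau>_mem unfolding is_deviation_majorant_def by blast+
    hence "(cmod (sieved_deviation (primes_upto N) (\<rho> * \<tau>) z))\<^sup>2 < \<delta>\<^sup>2" using \<rho>_mem small by auto
    thus "cmod (sieved_deviation (primes_upto N) (\<rho> * \<tau>) z) < \<delta>"
      using \<delta>_bounds(1) by (simp add: power2_less_imp_less)
  qed
  show "\<forall>\<rho>\<in>{1, d}. H \<le> \<bar>\<rho> * \<tau>\<bar>"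
  proof
    fix \<rho> assume "\<rho> \<in> {1, d}"
    hence "H \<le> \<bar>\<rho>\<bar> * T1" using T1_far(2) by blast
    also have "\<dots> \<le> \<bar>\<rho>\<bar> * \<tau>" using \<tau>_mem by (intro mult_left_mono) auto
    finally show "H \<le> \<bar>\<rho> * \<tau>\<bar>" using \<tau>_mem T1_far(1) by (simp add: abs_mult)
  qed
qed

lemma weight_integral_le_measure_approx_shifts:
  assumes tail: "powr_tail 2 (Suc N) < 1 / 4" and \<sigma>1_bounds: "\<sigma>1 \<ge> 1 / 2"
    and compact_K_bounds: "compact K" "\<forall>s\<in>K. \<sigma>1 < Re s \<and> Re s < 1 \<and> \<bar>Im s\<bar> < H"
    and T1_far: "0 \<le> T1" "\<forall>\<rho>\<in>{1, d}. H \<le> \<bar>\<rho>\<bar> * T1" "T1 \<le> T"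
    and \<delta>_bounds: "0 < \<delta>" "\<delta> \<le> 1 / 2" and x_bounds: "0 < x" "x \<le> 2"
    and \<epsilon>_bounds: "4 * \<delta> + 4 * x * real (card (primes_upto N)) \<le> \<epsilon>"
    and majorant: "\<forall>\<rho>\<in>{1, d}. \<exists>G. is_deviation_majorant (primes_upto N) \<rho> (rect \<sigma>1 2 H) T1 T G \<and>
      integral {T1..T} (\<lambda>\<tau>. weight (primes_upto N) m (1 - d) \<tau> * G \<tau>) \<le> \<xi> * T"
  shows "integral {0..T} (weight (primes_upto N) m (1 - d))
    \<le> measure lebesgue ({0..T} \<inter> log_zeta_approx_shifts d K \<epsilon>) + T1 + (1 - x\<^sup>2 / 4) ^ m * T + 2 * \<xi> * T / \<delta>\<^sup>2"
proof -
  let ?W = "weight (primes_upto N) m (1 - d)" and ?q = "(1 - x\<^sup>2 / 4) ^ m"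
  obtain G where majorants: "\<forall>\<rho>\<in>{1, d}. is_deviation_majorant (primes_upto N) \<rho> (rect \<sigma>1 2 H) T1 T (G \<rho>)"
    and majorant_integrals: "\<forall>\<rho>\<in>{1, d}. integral {T1..T} (\<lambda>\<tau>. ?W \<tau> * G \<rho> \<tau>) \<le> \<xi> * T"
    using bchoice[OF majorant] unfolding ball_conj_distrib by (elim exE conjE)
  have continuous_G: "continuous_on {T1..T} (G 1)" "continuous_on {T1..T} (G d)"
    using majorants by (auto simp: is_deviation_majorant_def)
  have exceptional: "?W \<tau> \<le> ?q \<or> \<delta>\<^sup>2 \<le> G 1 \<tau> + G d \<tau>" if "\<tau> \<in> {T1..T} - log_zeta_approx_shifts d K \<epsilon>" for \<tau>
    using log_zeta_approx_shifts_if_weight_large[OF tail \<sigma>1_bounds compact_K_bounds(2) T1_far(1,2) \<delta>_bounds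
      x_bounds \<epsilon>_bounds majorants, of \<tau> m] that
    by (auto simp: not_less[symmetric])
  have "integral {0..T} ?W \<le> measure lebesgue ({0..T} \<inter> log_zeta_approx_shifts d K \<epsilon>) + T1 + ?q * T
      + integral {T1..T} (\<lambda>\<tau>. ?W \<tau> * (G 1 \<tau> + G d \<tau>)) / \<delta>\<^sup>2"
  proof (intro weighted_measure_lower_bound T1_far continuous_on_weight weight_bounds continuous_on_add continuous_G
      open_log_zeta_approx_shifts compact_K_bounds(1))
    have "x\<^sup>2 \<le> 2\<^sup>2" using x_bounds by (intro power_mono) auto
    thus "0 \<le> ?q" by (intro zero_le_power) simp
  qed (use majorants exceptional \<delta>_bounds in \<open>auto simp: is_deviation_majorant_def\<close>)
  also have "integral {T1..T} (\<lambda>\<tau>. ?W \<tau> * (G 1 \<tau> + G d \<tau>))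
      = integral {T1..T} (\<lambda>\<tau>. ?W \<tau> * G 1 \<tau>) + integral {T1..T} (\<lambda>\<tau>. ?W \<tau> * G d \<tau>)"
    unfolding distrib_left
    by (intro integral_add integrable_continuous_interval continuous_intros continuous_on_weight continuous_G)
  also have "\<dots> \<le> 2 * \<xi> * T" using majorant_integrals by auto
  finally show ?thesis using \<delta>_bounds by (simp add: divide_right_mono)
qed

lemma eventually_measure_approx_shifts_ge:
  fixes N m :: nat and d :: real
  defines "w \<equiv> weight_mean (primes_upto N) m (1 - d)"
  assumes tail: "powr_tail 2 (Suc N) < 1 / 4" and d_nonzero: "d \<noteq> 0"
    and compact_K_bounds: "compact K" "\<forall>s\<in>K. \<sigma>1 < Re s \<and> Re s < 1 \<and> \<bar>Im s\<bar> < H"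
    and cover: "finite C" "C \<subseteq> rect \<sigma>1 2 H" "rect \<sigma>1 2 H \<subseteq> (\<Union>c\<in>C. ball c (r / 2))"
    and r_bounds: "0 < r" "r \<le> 1" and \<sigma>0_bounds: "1 / 2 < \<sigma>0" "\<sigma>0 < 1" "\<sigma>0 + r \<le> \<sigma>1"
    and nonres: "\<forall>\<rho>\<in>{1, d}. log_nonresonant N ((1 - d) / \<rho>)"
    and \<delta>_bounds: "0 < \<delta>" "\<delta> \<le> 1 / 2" and x_bounds: "0 < x" "x \<le> 2"
    and \<epsilon>_bounds: "4 * \<delta> + 4 * x * real (card (primes_upto N)) \<le> \<epsilon>"
    and small: "32 * real (card C) * powr_tail (2 * \<sigma>0) (Suc N) < \<delta>\<^sup>2" "(1 - x\<^sup>2 / 4) ^ m \<le> w / 8"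
  shows "\<forall>\<^sub>F T in at_top. 3 / 8 * w * T \<le> measure lebesgue ({0..T} \<inter> log_zeta_approx_shifts d K \<epsilon>)"
proof -
  let ?S = "primes_upto N"
  have w_bounds: "w / 8 > 0" unfolding w_def using weight_mean_pos[of ?S m "1 - d"] by simp
  obtain T1 where T1_far: "0 \<le> T1" "\<forall>\<rho>\<in>{1, d}. H + 2 \<le> \<bar>\<rho>\<bar> * T1"
    using exists_ge_divided_by_finite_set[of "{1, d}" "H + 2"] d_nonzero by auto
  have T1_ge: "\<forall>\<rho>\<in>{1, d}. H \<le> \<bar>\<rho>\<bar> * T1" using T1_far(2) by fastforce
  have "\<forall>\<^sub>F T in at_top. \<forall>\<rho>\<in>{1, d}. \<exists>G. is_deviation_majorant ?S \<rho> (rect \<sigma>1 2 H) T1 T G \<and>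
      integral {T1..T} (\<lambda>\<tau>. weight ?S m (1 - d) \<tau> * G \<tau>) \<le> \<delta>\<^sup>2 / 8 * w * T"
    using T1_far d_nonzero bspec[OF nonres] small(1) unfolding w_def
    by (intro eventually_ball_finite ballI eventually_sieved_deviation_majorant[OF cover r_bounds \<sigma>0_bounds]) auto
  moreover have "\<forall>\<^sub>F T in at_top. integral {0..T} (weight ?S m (1 - d)) \<ge> (w - w / 8) * T"
    unfolding w_def weight_mean_def
    by (intro eventually_integral_trig_poly_ge finite_weight_index weight_eq_trig_poly)
      (use w_bounds in \<open>simp_all add: w_def weight_mean_def\<close>)
  ultimately show ?thesis
    using eventually_const_le_mult_at_top[OF w_bounds, of T1] eventually_ge_at_top[of T1]
  proof eventually_elim
    case (elim T)
    have "2 * (\<delta>\<^sup>2 / 8 * w) * T / \<delta>\<^sup>2 = w / 4 * T" using \<delta>_bounds(1) by simp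
    moreover have "(1 - x\<^sup>2 / 4) ^ m * T \<le> w / 8 * T" using small(2) elim(3) by (intro mult_right_mono) auto
    moreover have "integral {0..T} (weight ?S m (1 - d))
        \<le> measure lebesgue ({0..T} \<inter> log_zeta_approx_shifts d K \<epsilon>) + T1 + (1 - x\<^sup>2 / 4) ^ m * T
          + 2 * (\<delta>\<^sup>2 / 8 * w) * T / \<delta>\<^sup>2"
      using \<sigma>0_bounds r_bounds elim
      by (intro weight_integral_le_measure_approx_shifts[OF tail _ compact_K_bounds T1_far(1) T1_ge _
        \<delta>_bounds x_bounds \<epsilon>_bounds]) auto
    ultimately show ?case using elim(2,3) by (simp add: left_diff_distrib)
  qed
qed

lemma compact_finite_ball_cover:
  fixes Q :: "'a::metric_space set"
  assumes "compact Q" "e > 0"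
  shows "\<exists>C. finite C \<and> C \<subseteq> Q \<and> Q \<subseteq> (\<Union>c\<in>C. ball c e)"
proof -
  have "Q \<subseteq> (\<Union>c\<in>Q. ball c e)" using assms(2) by auto
  from compactE_image[OF assms(1) _ this] show ?thesis by (metis open_ball)
qed

lemma exists_small_multiple:
  fixes \<epsilon> n :: real
  assumes "\<epsilon> > 0" "n \<ge> 0"
  shows "\<exists>x>0. x \<le> 1 \<and> x * n \<le> \<epsilon>"
proof -
  have "min 1 (\<epsilon> / (n + 1)) * n \<le> \<epsilon> / (n + 1) * (n + 1)" using assms by (intro mult_mono) auto
  thus ?thesis using assms by (intro exI[of _ "min 1 (\<epsilon> / (n + 1))"]) auto
qed

lemma log_zeta_approx_shifts_positive_density:
  assumes d_nonzero: "d \<noteq> 0" and compact_K: "compact K" "K \<subseteq> {s. 1 / 2 < Re s \<and> Re s < 1}" and \<epsilon>_pos: "\<epsilon> > 0"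
  shows "\<exists>\<delta>>0. \<forall>\<^sub>F T in at_top. \<delta> * T \<le> measure lebesgue ({0..T} \<inter> log_zeta_approx_shifts d K \<epsilon>)"
proof -
  obtain \<sigma>1 H where \<sigma>1_bounds: "1 / 2 < \<sigma>1" "\<sigma>1 < 1"
    and K_bounds: "\<forall>s\<in>K. \<sigma>1 < Re s \<and> Re s < 1 \<and> \<bar>Im s\<bar> < H"
    using compact_subset_strip_bounds[OF compact_K] by (elim exE conjE)
  define r where "r = (\<sigma>1 - 1 / 2) / 2"
  define \<sigma>0 where "\<sigma>0 = \<sigma>1 - r"
  have r_bounds: "0 < r" "r \<le> 1" and \<sigma>0_bounds: "1 / 2 < \<sigma>0" "\<sigma>0 < 1" "\<sigma>0 + r \<le> \<sigma>1"
    using \<sigma>1_bounds by (auto simp: r_def \<sigma>0_def field_simps)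
  have "r / 2 > 0" using r_bounds by simp
  from compact_finite_ball_cover[OF compact_cbox[of "Complex \<sigma>1 (- H)" "Complex 2 H"] this]
  obtain C where cover: "finite C" "C \<subseteq> rect \<sigma>1 2 H" "rect \<sigma>1 2 H \<subseteq> (\<Union>c\<in>C. ball c (r / 2))"
    by (elim exE conjE)
  define \<delta> where "\<delta> = min (1 / 2) (\<epsilon> / 8)"
  have \<delta>_bounds: "0 < \<delta>" "\<delta> \<le> 1 / 2" "4 * \<delta> \<le> \<epsilon> / 2" using \<epsilon>_pos by (auto simp: \<delta>_def)
  have "2 * \<sigma>0 > 1" "\<delta>\<^sup>2 > 0" "finite {1, d}" using \<sigma>0_bounds \<delta>_bounds by auto
  from exists_sieve_level[OF this, of "32 * real (card C)" "\<lambda>\<rho>. (1 - d) / \<rho>"]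
  obtain N where N_bounds: "powr_tail 2 (Suc N) < 1 / 4" "32 * real (card C) * powr_tail (2 * \<sigma>0) (Suc N) < \<delta>\<^sup>2"
    and nonres: "\<forall>\<rho>\<in>{1, d}. log_nonresonant N ((1 - d) / \<rho>)"
    by (elim exE conjE)
  have "\<epsilon> / 8 > 0" "0 \<le> real (card (primes_upto N))" using \<epsilon>_pos by auto
  from exists_small_multiple[OF this]
  obtain x where x_bounds: "0 < x" "x \<le> 1" "x * real (card (primes_upto N)) \<le> \<epsilon> / 8" by (elim exE conjE)
  have \<epsilon>_ge: "4 * \<delta> + 4 * x * real (card (primes_upto N)) \<le> \<epsilon>" using \<delta>_bounds(3) x_bounds(3) by simp
  have "x\<^sup>2 \<le> 1\<^sup>2" using x_bounds by (intro power_mono) auto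
  hence "0 < 1 - x\<^sup>2 / 4" "1 - x\<^sup>2 / 4 < 1" "finite (primes_upto N)" using x_bounds(1) by auto
  from exists_power_le_weight_mean[OF this, of "1 - d"]
  obtain m where power_le: "(1 - x\<^sup>2 / 4) ^ m \<le> weight_mean (primes_upto N) m (1 - d) / 8" by (elim exE)
  have "\<forall>\<^sub>F T in at_top. 3 / 8 * weight_mean (primes_upto N) m (1 - d) * T
      \<le> measure lebesgue ({0..T} \<inter> log_zeta_approx_shifts d K \<epsilon>)"
    by (rule eventually_measure_approx_shifts_ge[OF N_bounds(1) d_nonzero compact_K(1) K_bounds cover
      r_bounds \<sigma>0_bounds nonres \<delta>_bounds(1,2) x_bounds(1) order_trans[OF x_bounds(2)]
        \<epsilon>_ge N_bounds(2) power_le]) simp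
  thus ?thesis
    using weight_mean_pos[of "primes_upto N" m "1 - d"]
    by (intro exI[of _ "3 / 8 * weight_mean (primes_upto N) m (1 - d)"]) simp
qed

theorem theorem2:
  fixes d \<epsilon> :: real and K :: "complex set"
  assumes "d \<noteq> 0"
    and "compact K"
    and "K \<subseteq> {s. 1 / 2 < Re s \<and> Re s < 1}"
    and "connected (- K)"
    and "\<epsilon> > 0"
  shows "Liminf at_top (\<lambda>T::real. ereal (1 / T * measure lebesgue
           {\<tau> \<in> {0..T}.
              (\<forall>s\<in>K. s + \<i> * of_real \<tau> \<in> log_zeta_dom \<and> s + \<i> * of_real (d * \<tau>) \<in> log_zeta_dom) \<and>
              (SUP s\<in>K. ereal (norm (log_zeta (s + \<i> * of_real \<tau>) - log_zeta (s + \<i> * of_real (d * \<tau>)))))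
                < ereal \<epsilon>})) > 0"
  unfolding SUP_log_zeta_diff_less_iff[OF assms(2)]
proof -
  let ?A = "\<lambda>T. {\<tau> \<in> {0..T}. \<tau> \<in> log_zeta_approx_shifts d K \<epsilon>}"
  obtain \<delta> where \<delta>_pos: "\<delta> > 0"
    and density: "\<forall>\<^sub>F T in at_top. \<delta> * T \<le> measure lebesgue ({0..T} \<inter> log_zeta_approx_shifts d K \<epsilon>)"
    using log_zeta_approx_shifts_positive_density[OF assms(1-3,5)] by (elim exE conjE)
  have "\<forall>\<^sub>F T in at_top. ereal \<delta> \<le> ereal (1 / T * measure lebesgue (?A T))"
    using density eventually_gt_at_top[of 0]
    by eventually_elim (simp add: Int_def field_simps)
  hence "ereal \<delta> \<le> Liminf at_top (\<lambda>T. ereal (1 / T * measure lebesgue (?A T)))" by (rule Liminf_bounded)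
  moreover have "0 < ereal \<delta>" using \<delta>_pos by simp
  ultimately show "Liminf at_top (\<lambda>T. ereal (1 / T * measure lebesgue (?A T))) > 0"
    by (rule less_le_trans[rotated])
qed

end
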